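(* The following hold. (i) For $d\ge1$, the module $\hat\Phi_{[0,d-1]}$ is an irreducible $\mathcal H(d)$-module of type Q. (ii) Let $0<a\le b$, $d=b-a+1$, and let $\kappa_1,\dots,\kappa_d\in\mathbb R$ satisfy $\kappa_i^2=q(a+i-1)$. Put $w=X_\emptyset.\hat{\mathbf 1}$ and $w'=(x_1-\kappa_1)X_{\{1\}}.\hat{\mathbf 1}$ in $\hat\Phi_{[a,b]}$. Then $\hat\Phi^+_{[a,b]}=\mathcal C\ell(d).w$ and $\hat\Phi^-_{[a,b]}=\mathcal C\ell(d).w'$ are $\mathcal H(d)$-submodules, $\hat\Phi_{[a,b]}=\hat\Phi^+_{[a,b]}\oplus\hat\Phi^-_{[a,b]}$, and the submodules $\hat\Phi^{\pm}_{[a,b]}$ are simple of type M. (iii) Let $0<a\le b$, $d=a+b+1$, and let $\kappa_1,\dots,\kappa_d\in\mathbb R$ satisfy $\kappa_i^2=q(-a+i-1)$. In $\hat\Phi_{[-a,b]}$ put $$w=-(1+\sqrt{-1}\,c_ac_{a+1})X_{\{a+1\}}.\hat{\mathbf 1},\quad \overline w=s_aw,\qquad w'=-(1-\sqrt{-1}\,c_ac_{a+1})X_{\{a+1\}}.\hat{\mathbf 1},\quad \overline w'=s_aw'.$$ Then $\hat\Phi^+_{[-a,b]}=\mathcal C\ell(d)w\oplus\mathcal C\ell(d)\overline w$ and $\hat\Phi^-_{[-a,b]}=\mathcal C\ell(d)w'\oplus\mathcal C\ell(d)\overline w'$ are $\mathcal H(d)$-submodules, $\hat\Phi_{[-a,b]}=\hat\Phi^+_{[-a,b]}\oplus\hat\Phi^-_{[-a,b]}$,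 and the submodules $\hat\Phi^\pm_{[-a,b]}$ are simple of type M.
   Context: Everything is over $\mathbb C$ and $\mathbb Z_2$-graded; modules are supermodules. A simple supermodule is of type M if it stays irreducible when the grading is forgotten, and of type Q otherwise. $q(t)=t(t+1)$. $\mathcal H(d)$ is the degenerate affine Hecke-Clifford algebra: even generators $s_1,\dots,s_{d-1},x_1,\dots,x_d$, odd generators $c_1,\dots,c_d$; as a vector space $\mathbb C[x_1,\dots,x_d]\otimes\mathcal C\ell(d)\otimes\mathbb CS_d$; the $x_i$ commute, the $s_i$ satisfy the Coxeter relations of $S_d$, $c_i^2=-1$, $c_ic_j=-c_jc_i$ ($i\neq j$; these generate the Clifford algebra $\mathcal C\ell(d)$), $s_ic_i=c_{i+1}s_i$, $s_ic_{i+1}=c_is_i$, $s_ic_j=c_js_i$ ($j\ne i,i+1$), $c_ix_i=-x_ic_i$, $c_jx_i=x_ic_j$ ($j\neq i$), $s_ix_i=x_{i+1}s_i-1+c_ic_{i+1}$, $s_ix_j=x_js_i$ ($j\ne i,i+1$). For integers $a\le b$ with $d=b-a+1$: $\Phi_a=\mathbb C\langle\varphi\rangle/(\varphi^2-a)$ if $a\neq0$ and $\Phi_0=\mathbb C\langle\varphi\rangle/(\varphi)$, with $\varphi$ odd. $\mathcal C\ell_d=\mathcal C\ell(d).\mathbf 1$ is the $2^d$-dimensional module over $\mathcal C\ell(d)\rtimes S_d$ induced from the trivial $S_d$-module $\mathbb C\mathbf 1$. $\epsilon_i$ acts on $\mathcal C\ell_d$ by the algebra involution of $\mathcal C\ell(d)$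 with $c_j\mapsto(-1)^{\delta_{ij}}c_j$ (and $\epsilon_i\mathbf 1=\mathbf 1$). $\hat\Phi_{[a,b]}=\Phi_a\boxtimes\mathcal C\ell_d$ (with the sign rule $(u\otimes v)(m\otimes n)=(-1)^{p(v)p(m)}um\otimes vn$) is the $\mathcal H(d)$-module with $s_i,c_i$ acting through $1\otimes s_i$, $1\otimes c_i$, and $x_i$ acting as $a\otimes\epsilon_i+\sum_{k<i}1\otimes(1-c_kc_i)s_{ki}-\varphi\otimes c_i$, where $s_{ki}$ is the transposition $(k\,i)$. Its cyclic vector is $\hat{\mathbf 1}=1\otimes\mathbf 1$. Given $\kappa_1,\dots,\kappa_d$ and $S\subseteq\{1,\dots,d\}$, $X_S=\prod_{i\notin S}(x_i+\kappa_i)\in\mathcal H(d)$. *)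

theory Defs
  imports
    Complex_Main
    "HOL-Library.Poly_Mapping"
    "HOL-Combinatorics.Transposition"
    "HOL-Algebra.QuotRing"
begin

section \<open>Complex vector spaces with a basis\<close>

text \<open>
  The type \<open>'i \<Rightarrow>\<^sub>0 complex\<close> is the complex vector space with basis \<open>'i\<close>.
\<close>

definition cscale :: "complex \<Rightarrow> ('i \<Rightarrow>\<^sub>0 complex) \<Rightarrow> ('i \<Rightarrow>\<^sub>0 complex)" where
  "cscale c = Poly_Mapping.map ((*) c)"

lemma lookup_cscale [simp]: "Poly_Mapping.lookup (cscale c v) i = c * Poly_Mapping.lookup v i"
  by (simp add: cscale_def Poly_Mapping.map.rep_eq when_def)

lemma vector_space_cscale: "vector_space cscale"
  by unfold_locales
    (auto intro!: poly_mapping_eqI simp: lookup_add algebra_simps)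

abbreviation csubspace :: "('i \<Rightarrow>\<^sub>0 complex) set \<Rightarrow> bool" where
  "csubspace \<equiv> module.subspace cscale"

definition bvec :: "'i \<Rightarrow> ('i \<Rightarrow>\<^sub>0 complex)" where
  "bvec i = Poly_Mapping.single i 1"

definition linext :: "('i \<Rightarrow> ('j \<Rightarrow>\<^sub>0 complex)) \<Rightarrow> ('i \<Rightarrow>\<^sub>0 complex) \<Rightarrow> ('j \<Rightarrow>\<^sub>0 complex)" where
  "linext B v = (\<Sum>i\<in>Poly_Mapping.keys v. cscale (Poly_Mapping.lookup v i) (B i))"

definition vtensor ::
  "('i \<Rightarrow>\<^sub>0 complex) \<Rightarrow> ('j \<Rightarrow>\<^sub>0 complex) \<Rightarrow> ('i \<times> 'j \<Rightarrow>\<^sub>0 complex)" where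
  "vtensor m n = (\<Sum>i\<in>Poly_Mapping.keys m. \<Sum>j\<in>Poly_Mapping.keys n.
     Poly_Mapping.single (i, j) (Poly_Mapping.lookup m i * Poly_Mapping.lookup n j))"

definition sumset :: "'v::plus set \<Rightarrow> 'v set \<Rightarrow> 'v set" where
  "sumset A B = {u + v | u v. u \<in> A \<and> v \<in> B}"

text \<open>\<open>W\<close> is the internal direct sum of the subspaces \<open>A\<close> and \<open>B\<close>.\<close>

definition direct_sum_of :: "('i \<Rightarrow>\<^sub>0 complex) set \<Rightarrow> ('i \<Rightarrow>\<^sub>0 complex) set \<Rightarrow> ('i \<Rightarrow>\<^sub>0 complex) set \<Rightarrow> bool" where
  "direct_sum_of W A B \<longleftrightarrow>
     csubspace A \<and> csubspace B \<and> sumset A B = W \<and> A \<inter> B = {0}"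


section \<open>The degenerate affine Hecke-Clifford algebra\<close>

text \<open>
  The algebra is the free associative algebra on the generators modulo the two-sided ideal
  generated by the defining relations. The free algebra is the monoid algebra of the free monoid
  of words; words are written additively because this is how the convolution
  product on \<open>\<Rightarrow>\<^sub>0\<close> is set up.
\<close>

datatype hc_gen = Sg nat | Xg nat | Cg nat

datatype hc_word = Word (letters: "hc_gen list")

instantiation hc_word :: monoid_add
begin
definition zero_hc_word :: hc_word where "0 = Word []"
definition plus_hc_word :: "hc_word \<Rightarrow> hc_word \<Rightarrow> hc_word" where
  "u + v = Word (letters u @ letters v)"
instance by standard (simp_all add: zero_hc_word_def plus_hc_word_def)
end

type_synonym hc_free = "hc_word \<Rightarrow>\<^sub>0 complex"

definition free_carrier :: "hc_gen set \<Rightarrow> hc_free set" where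
  "free_carrier G = {f. \<forall>w\<in>Poly_Mapping.keys f. set (letters w) \<subseteq> G}"

definition free_ring :: "hc_gen set \<Rightarrow> hc_free ring" where
  "free_ring G = \<lparr>carrier = free_carrier G, mult = (*), one = 1, zero = 0, add = (+)\<rparr>"

lemma free_carrier_add: "f \<in> free_carrier G \<Longrightarrow> g \<in> free_carrier G \<Longrightarrow> f + g \<in> free_carrier G"
  using keys_add[of f g] by (fastforce simp: free_carrier_def)

lemma free_carrier_uminus: "f \<in> free_carrier G \<Longrightarrow> - f \<in> free_carrier G"
  by (simp add: free_carrier_def in_keys_iff)

lemma free_carrier_mult: "f \<in> free_carrier G \<Longrightarrow> g \<in> free_carrier G \<Longrightarrow> f * g \<in> free_carrier G"
  using keys_mult[of f g] by (fastforce simp: free_carrier_def plus_hc_word_def)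

lemma ring_free_ring: "ring (free_ring G)"
proof (rule ringI)
  show "abelian_group (free_ring G)"
  proof (rule abelian_groupI)
    fix f assume "f \<in> carrier (free_ring G)"
    then show "\<exists>g\<in>carrier (free_ring G). g \<oplus>\<^bsub>free_ring G\<^esub> f = \<zero>\<^bsub>free_ring G\<^esub>"
      by (intro bexI[of _ "- f"]) (auto simp: free_ring_def free_carrier_uminus)
  qed (auto simp: free_ring_def free_carrier_add algebra_simps, simp add: free_carrier_def)
  show "monoid (free_ring G)"
    by (rule monoidI)
      (auto simp: free_ring_def free_carrier_mult algebra_simps,
        simp add: free_carrier_def zero_hc_word_def)
qed (auto simp: free_ring_def algebra_simps)

definition hc_gens :: "nat \<Rightarrow> hc_gen set" where
  "hc_gens d = Sg ` {1..<d} \<union> Xg ` {1..d} \<union> Cg ` {1..d}"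

abbreviation fs :: "nat \<Rightarrow> hc_free" where "fs i \<equiv> Poly_Mapping.single (Word [Sg i]) 1"
abbreviation fx :: "nat \<Rightarrow> hc_free" where "fx i \<equiv> Poly_Mapping.single (Word [Xg i]) 1"
abbreviation fc :: "nat \<Rightarrow> hc_free" where "fc i \<equiv> Poly_Mapping.single (Word [Cg i]) 1"

text \<open>Each defining relation \<open>l = r\<close> is recorded as the element \<open>l - r\<close>.\<close>

definition hc_relators :: "nat \<Rightarrow> hc_free set" where
  "hc_relators d =
     {fx i * fx j - fx j * fx i | i j. i \<in> {1..d} \<and> j \<in> {1..d}}
   \<union> {fs i * fs i - 1 | i. i \<in> {1..<d}}
   \<union> {fs i * fs (i+1) * fs i - fs (i+1) * fs i * fs (i+1) | i. i \<in> {1..<d} \<and> i + 1 \<in> {1..<d}}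
   \<union> {fs i * fs j - fs j * fs i | i j. i \<in> {1..<d} \<and> j \<in> {1..<d} \<and> i + 1 < j}
   \<union> {fc i * fc i + 1 | i. i \<in> {1..d}}
   \<union> {fc i * fc j + fc j * fc i | i j. i \<in> {1..d} \<and> j \<in> {1..d} \<and> i \<noteq> j}
   \<union> {fs i * fc i - fc (i+1) * fs i | i. i \<in> {1..<d}}
   \<union> {fs i * fc (i+1) - fc i * fs i | i. i \<in> {1..<d}}
   \<union> {fs i * fc j - fc j * fs i | i j. i \<in> {1..<d} \<and> j \<in> {1..d} \<and> j \<noteq> i \<and> j \<noteq> i + 1}
   \<union> {fc i * fx i + fx i * fc i | i. i \<in> {1..d}}
   \<union> {fc j * fx i - fx i * fc j | i j. i \<in> {1..d} \<and> j \<in> {1..d} \<and> j \<noteq> i}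
   \<union> {fs i * fx i - (fx (i+1) * fs i - 1 + fc i * fc (i+1)) | i. i \<in> {1..<d}}
   \<union> {fs i * fx j - fx j * fs i | i j. i \<in> {1..<d} \<and> j \<in> {1..d} \<and> j \<noteq> i \<and> j \<noteq> i + 1}"

definition hc_ideal :: "nat \<Rightarrow> hc_free set" where
  "hc_ideal d = Idl\<^bsub>free_ring (hc_gens d)\<^esub> (hc_relators d)"

definition hecke_clifford :: "nat \<Rightarrow> hc_free set ring" where
  "hecke_clifford d = free_ring (hc_gens d) Quot hc_ideal d"

text \<open>The class in the quotient of an element of the free algebra.\<close>

definition hc_class :: "nat \<Rightarrow> hc_free \<Rightarrow> hc_free set" where
  "hc_class d f = hc_ideal d +>\<^bsub>free_ring (hc_gens d)\<^esub> f"

lemma free_carrier_single_gen [simp]: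
  "Poly_Mapping.single (Word [g]) 1 \<in> free_carrier G \<longleftrightarrow> g \<in> G"
  by (simp add: free_carrier_def)

lemma one_in_free_carrier [simp]: "1 \<in> free_carrier G"
  by (simp add: free_carrier_def zero_hc_word_def)

lemma free_carrier_minus: "f \<in> free_carrier G \<Longrightarrow> g \<in> free_carrier G \<Longrightarrow> f - g \<in> free_carrier G"
  using free_carrier_add[of f G "- g"] free_carrier_uminus[of g G] by simp

lemma hc_relators_subset: "hc_relators d \<subseteq> carrier (free_ring (hc_gens d))"
  unfolding hc_relators_def free_ring_def
  by (auto intro!: free_carrier_add free_carrier_minus free_carrier_mult simp: hc_gens_def)

lemma ideal_hc_ideal: "ideal (hc_ideal d) (free_ring (hc_gens d))"
  unfolding hc_ideal_def by (rule ring.genideal_ideal[OF ring_free_ring hc_relators_subset])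

lemma ring_hecke_clifford: "ring (hecke_clifford d)"
  unfolding hecke_clifford_def by (rule ideal.quotient_is_ring[OF ideal_hc_ideal])

definition hs :: "nat \<Rightarrow> nat \<Rightarrow> hc_free set" where "hs d i = hc_class d (fs i)"
definition hx :: "nat \<Rightarrow> nat \<Rightarrow> hc_free set" where "hx d i = hc_class d (fx i)"
definition hc :: "nat \<Rightarrow> nat \<Rightarrow> hc_free set" where "hc d i = hc_class d (fc i)"
definition hscalar :: "nat \<Rightarrow> complex \<Rightarrow> hc_free set" where
  "hscalar d z = hc_class d (Poly_Mapping.single 0 z)"

text \<open>
  The grading, with \<open>True\<close> for the odd part. It descends to the quotient since every relator is
  even.
\<close>

definition word_odd :: "hc_word \<Rightarrow> bool" where
  "word_odd w = odd (length (filter (\<lambda>g. \<exists>i. g = Cg i) (letters w)))"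

definition hc_part :: "nat \<Rightarrow> bool \<Rightarrow> hc_free set set" where
  "hc_part d p = hc_class d `
     {f \<in> free_carrier (hc_gens d). \<forall>w\<in>Poly_Mapping.keys f. word_odd w = p}"

text \<open>The subalgebra generated by \<open>c\<^sub>1, \<dots>, c\<^sub>d\<close>.\<close>

definition hc_clifford :: "nat \<Rightarrow> hc_free set set" where
  "hc_clifford d = hc_class d ` free_carrier (Cg ` {1..d})"

text \<open>The product, over \<open>i \<in> {1..d} - S\<close> in increasing order, of \<open>x\<^sub>i + \<kappa>\<^sub>i\<close>.\<close>

definition X_prod :: "nat \<Rightarrow> (nat \<Rightarrow> real) \<Rightarrow> nat set \<Rightarrow> hc_free set" where
  "X_prod d \<kappa> S =
     foldr (\<lambda>i h. (hx d i \<oplus>\<^bsub>hecke_clifford d\<^esub> hscalar d (of_real (\<kappa> i))) \<otimes>\<^bsub>hecke_clifford d\<^esub> h)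
       (filter (\<lambda>i. i \<notin> S) [1..<Suc d]) \<one>\<^bsub>hecke_clifford d\<^esub>"


section \<open>Modules and supermodules\<close>

text \<open>
  \<open>hc_module d W \<rho>\<close>: the subspace \<open>W\<close> is a unital left module of the complex algebra
  \<open>hecke_clifford d\<close> with action \<open>\<rho>\<close>, the grading being ignored. Unitality and compatibility with
  scalars are together expressed by the condition on \<open>hscalar\<close>.
\<close>

definition hc_module ::
  "nat \<Rightarrow> ('i \<Rightarrow>\<^sub>0 complex) set \<Rightarrow> (hc_free set \<Rightarrow> ('i \<Rightarrow>\<^sub>0 complex) \<Rightarrow> ('i \<Rightarrow>\<^sub>0 complex)) \<Rightarrow> bool" where
  "hc_module d W \<rho> \<longleftrightarrow> csubspace W \<and>
     (\<forall>h\<in>carrier (hecke_clifford d). \<forall>v\<in>W. \<rho> h v \<in> W) \<and>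
     (\<forall>h\<in>carrier (hecke_clifford d). \<forall>u\<in>W. \<forall>v\<in>W. \<rho> h (u + v) = \<rho> h u + \<rho> h v) \<and>
     (\<forall>g\<in>carrier (hecke_clifford d). \<forall>h\<in>carrier (hecke_clifford d). \<forall>v\<in>W.
        \<rho> (g \<oplus>\<^bsub>hecke_clifford d\<^esub> h) v = \<rho> g v + \<rho> h v) \<and>
     (\<forall>g\<in>carrier (hecke_clifford d). \<forall>h\<in>carrier (hecke_clifford d). \<forall>v\<in>W.
        \<rho> (g \<otimes>\<^bsub>hecke_clifford d\<^esub> h) v = \<rho> g (\<rho> h v)) \<and>
     (\<forall>z. \<forall>v\<in>W. \<rho> (hscalar d z) v = cscale z v)"

definition hc_submodule ::
  "nat \<Rightarrow> ('i \<Rightarrow>\<^sub>0 complex) set \<Rightarrow> (hc_free set \<Rightarrow> ('i \<Rightarrow>\<^sub>0 complex) \<Rightarrow> ('i \<Rightarrow>\<^sub>0 complex))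
    \<Rightarrow> ('i \<Rightarrow>\<^sub>0 complex) set \<Rightarrow> bool" where
  "hc_submodule d W \<rho> U \<longleftrightarrow> hc_module d W \<rho> \<and> U \<subseteq> W \<and> csubspace U \<and>
     (\<forall>h\<in>carrier (hecke_clifford d). \<forall>v\<in>U. \<rho> h v \<in> U)"

definition hc_irreducible ::
  "nat \<Rightarrow> ('i \<Rightarrow>\<^sub>0 complex) set \<Rightarrow> (hc_free set \<Rightarrow> ('i \<Rightarrow>\<^sub>0 complex) \<Rightarrow> ('i \<Rightarrow>\<^sub>0 complex)) \<Rightarrow> bool" where
  "hc_irreducible d W \<rho> \<longleftrightarrow> hc_module d W \<rho> \<and> W \<noteq> {0} \<and>
     (\<forall>U. hc_submodule d W \<rho> U \<longrightarrow> U = {0} \<or> U = W)"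

text \<open>\<open>grade V False\<close> is the even and \<open>grade V True\<close> the odd part.\<close>

record 'i supermod =
  grade :: "bool \<Rightarrow> ('i \<Rightarrow>\<^sub>0 complex) set"
  act :: "hc_free set \<Rightarrow> ('i \<Rightarrow>\<^sub>0 complex) \<Rightarrow> ('i \<Rightarrow>\<^sub>0 complex)"

definition mspace :: "'i supermod \<Rightarrow> ('i \<Rightarrow>\<^sub>0 complex) set" where
  "mspace V = sumset (grade V False) (grade V True)"

definition hc_supermodule :: "nat \<Rightarrow> 'i supermod \<Rightarrow> bool" where
  "hc_supermodule d V \<longleftrightarrow>
     direct_sum_of (mspace V) (grade V False) (grade V True) \<and>
     hc_module d (mspace V) (act V) \<and>
     (\<forall>p q. \<forall>h\<in>hc_part d p. \<forall>v\<in>grade V q. act V h v \<in> grade V (p \<noteq> q))"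

definition hc_subsupermodule :: "nat \<Rightarrow> 'i supermod \<Rightarrow> ('i \<Rightarrow>\<^sub>0 complex) set \<Rightarrow> bool" where
  "hc_subsupermodule d V U \<longleftrightarrow> hc_supermodule d V \<and> hc_submodule d (mspace V) (act V) U \<and>
     U = sumset (U \<inter> grade V False) (U \<inter> grade V True)"

definition restrict_to :: "'i supermod \<Rightarrow> ('i \<Rightarrow>\<^sub>0 complex) set \<Rightarrow> 'i supermod" where
  "restrict_to V U = \<lparr>grade = (\<lambda>p. grade V p \<inter> U), act = act V\<rparr>"

definition simple_supermodule :: "nat \<Rightarrow> 'i supermod \<Rightarrow> bool" where
  "simple_supermodule d V \<longleftrightarrow> hc_supermodule d V \<and> mspace V \<noteq> {0} \<and>
     (\<forall>U. hc_subsupermodule d V U \<longrightarrow> U = {0} \<or> U = mspace V)"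

definition simple_type_M :: "nat \<Rightarrow> 'i supermod \<Rightarrow> bool" where
  "simple_type_M d V \<longleftrightarrow> simple_supermodule d V \<and> hc_irreducible d (mspace V) (act V)"

definition simple_type_Q :: "nat \<Rightarrow> 'i supermod \<Rightarrow> bool" where
  "simple_type_Q d V \<longleftrightarrow> simple_supermodule d V \<and> \<not> hc_irreducible d (mspace V) (act V)"

text \<open>The subspace obtained by applying the Clifford algebra to the vector \<open>v\<close>.\<close>

definition clifford_span :: "nat \<Rightarrow> 'i supermod \<Rightarrow> ('i \<Rightarrow>\<^sub>0 complex) \<Rightarrow> ('i \<Rightarrow>\<^sub>0 complex) set" where
  "clifford_span d V v = (\<lambda>h. act V h v) ` hc_clifford d"


section \<open>The segment modules\<close>

text \<open>
  \<open>\<Phi>\<^sub>a\<close> has basis vectors indexed by \<open>False\<close> (the unit, even) and, if \<open>a \<noteq> 0\<close>, by \<open>True\<close>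
  (the generator \<open>\<phi>\<close>, odd).
\<close>

definition phi_basis :: "int \<Rightarrow> bool set" where
  "phi_basis a = (if a = 0 then {False} else {False, True})"

definition phi_op :: "int \<Rightarrow> (bool \<Rightarrow>\<^sub>0 complex) \<Rightarrow> (bool \<Rightarrow>\<^sub>0 complex)" where
  "phi_op a = linext (\<lambda>e. if e then cscale (of_int a) (bvec False)
                         else if a = 0 then 0 else bvec True)"

text \<open>
  The Clifford module has basis vectors indexed by the subsets of \<open>{1..d}\<close>, the subset
  \<open>S = {i\<^sub>1 < \<dots> < i\<^sub>r}\<close> standing for \<open>c\<^bsub>i\<^sub>1\<^esub> \<cdots> c\<^bsub>i\<^sub>r\<^esub>\<close> applied to the cyclic vector. Left
  multiplication by \<open>c\<^sub>i\<close> moves past the smaller factors at the cost of one sign each and uses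
  \<open>c\<^sub>i\<^sup>2 = -1\<close> if \<open>c\<^sub>i\<close> is already present. A permutation \<open>\<sigma>\<close> fixes the cyclic vector and
  conjugates \<open>c\<^sub>i\<close> into \<open>c\<^bsub>\<sigma> i\<^esub>\<close>.
\<close>

definition cl_op :: "nat \<Rightarrow> (nat set \<Rightarrow>\<^sub>0 complex) \<Rightarrow> (nat set \<Rightarrow>\<^sub>0 complex)" where
  "cl_op i = linext (\<lambda>S. cscale ((- 1) ^ card {j \<in> S. j < i})
     (if i \<in> S then - bvec (S - {i}) else bvec (insert i S)))"

definition cl_perm :: "(nat \<Rightarrow> nat) \<Rightarrow> (nat set \<Rightarrow>\<^sub>0 complex) \<Rightarrow> (nat set \<Rightarrow>\<^sub>0 complex)" where
  "cl_perm \<sigma> = linext (\<lambda>S. foldr (\<lambda>j. cl_op (\<sigma> j)) (sorted_list_of_set S) (bvec {}))"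

definition cl_eps :: "nat \<Rightarrow> (nat set \<Rightarrow>\<^sub>0 complex) \<Rightarrow> (nat set \<Rightarrow>\<^sub>0 complex)" where
  "cl_eps i = linext (\<lambda>S. if i \<in> S then - bvec S else bvec S)"

text \<open>
  \<open>stensor q u v\<close> is the operator \<open>u \<otimes> v\<close> with the sign rule, where \<open>q\<close> says whether \<open>v\<close> is odd.
\<close>

definition stensor ::
  "bool \<Rightarrow> ((bool \<Rightarrow>\<^sub>0 complex) \<Rightarrow> (bool \<Rightarrow>\<^sub>0 complex))
    \<Rightarrow> ((nat set \<Rightarrow>\<^sub>0 complex) \<Rightarrow> (nat set \<Rightarrow>\<^sub>0 complex))
    \<Rightarrow> (bool \<times> nat set \<Rightarrow>\<^sub>0 complex) \<Rightarrow> (bool \<times> nat set \<Rightarrow>\<^sub>0 complex)" where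
  "stensor q u v = linext (\<lambda>(e, S).
     cscale (if q \<and> e then - 1 else 1) (vtensor (u (bvec e)) (v (bvec S))))"

fun gen_op :: "int \<Rightarrow> hc_gen \<Rightarrow> (bool \<times> nat set \<Rightarrow>\<^sub>0 complex) \<Rightarrow> (bool \<times> nat set \<Rightarrow>\<^sub>0 complex)" where
  "gen_op a (Sg i) = stensor False id (cl_perm (transpose i (i + 1)))"
| "gen_op a (Cg i) = stensor True id (cl_op i)"
| "gen_op a (Xg i) = (\<lambda>m.
     stensor False (cscale (of_int a)) (cl_eps i) m
     + (\<Sum>k\<in>{1..<i}. stensor False id
          (\<lambda>n. cl_perm (transpose k i) n - cl_op k (cl_op i (cl_perm (transpose k i) n))) m)
     - stensor True (phi_op a) (cl_op i) m)"

text \<open>The action of the free algebra determined by that of the generators.\<close>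

definition free_act ::
  "(hc_gen \<Rightarrow> ('i \<Rightarrow>\<^sub>0 complex) \<Rightarrow> ('i \<Rightarrow>\<^sub>0 complex)) \<Rightarrow> hc_free
    \<Rightarrow> ('i \<Rightarrow>\<^sub>0 complex) \<Rightarrow> ('i \<Rightarrow>\<^sub>0 complex)" where
  "free_act G f v =
     (\<Sum>w\<in>Poly_Mapping.keys f. cscale (Poly_Mapping.lookup f w) (foldr G (letters w) v))"

text \<open>
  A class acts as the common value of the actions of all its representatives; these agree on the
  underlying space because the operators \<open>gen_op a\<close> satisfy the defining relations there.
\<close>

definition hatPhi :: "int \<Rightarrow> int \<Rightarrow> (bool \<times> nat set) supermod" where
  "hatPhi a b =
     \<lparr>grade = (\<lambda>p. {v. \<forall>(e, S)\<in>Poly_Mapping.keys v.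
         e \<in> phi_basis a \<and> S \<subseteq> {1..nat (b - a + 1)} \<and> (e \<noteq> odd (card S)) = p}),
      act = (\<lambda>h v. the_elem ((\<lambda>f. free_act (gen_op a) f v) ` h))\<rparr>"

definition hat_one :: "bool \<times> nat set \<Rightarrow>\<^sub>0 complex" where
  "hat_one = vtensor (bvec False) (bvec {})"

definition qfun :: "real \<Rightarrow> real" where
  "qfun t = t * (t + 1)"

end

theory Submission
  imports Defs
begin

text \<open>
  Write \<open>M\<close> for the space of the segment module, \<open>c\<^sub>i\<close>, \<open>x\<^sub>i\<close>, \<open>s\<^sub>i\<close> for the operators of the generators,
  \<open>t\<^sub>i = a + i - 1\<close> and \<open>q(t) = t\<^sup>2 + t\<close>.

  The module is easy to compute in because of one extra operator: as a space it is the algebra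
  \<open>\<Phi>\<^sub>a \<otimes> Cl(d)\<close>, and right multiplication \<open>R\<close> by \<open>\<phi>\<close> commutes with all generators and satisfies
  \<open>R\<^sup>2 = a\<close>. The cyclic vector \<open>1\<close> generates \<open>M\<close> under the \<open>c\<^sub>i\<close> and \<open>R\<close>, and
  \<open>x\<^sub>i 1 = t\<^sub>i 1 + c\<^sub>i (D\<^sub>i + R) 1\<close> with \<open>D\<^sub>i\<close> the sum of the \<open>c\<^sub>k\<close> for \<open>k < i\<close>. An operator identity both
  sides of which pass \<open>c\<^sub>i\<close> and \<open>R\<close> in the same way therefore only has to be verified on \<open>1\<close>, where it
  is a computation with \<open>R\<close> and at most four anticommuting sums of Clifford generators. This yields the
  defining relations, and also that \<open>x\<^sub>i\<^sup>2\<close> is the scalar \<open>q(t\<^sub>i)\<close> on all of \<open>M\<close> (\<open>X_square\<close>).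

  Two consequences drive the rest. First, \<open>s\<^sub>i x\<^sub>i\<^sup>2 - x\<^sub>i\<^sub>+\<^sub>1\<^sup>2 s\<^sub>i\<close> is a polynomial in the \<open>c\<close> and \<open>x\<close>,
  so \<open>s\<^sub>i\<close> itself acts through them whenever \<open>q(t\<^sub>i) \<noteq> q(t\<^sub>i\<^sub>+\<^sub>1)\<close>, that is, unless \<open>t\<^sub>i = -1\<close>
  (\<open>S_in_CX_closed\<close>). Second, let \<open>\<kappa>\<^sub>i\<^sup>2 = q(t\<^sub>i)\<close> and let \<open>J\<close> be the set of \<open>j\<close> with \<open>\<kappa>\<^sub>j \<noteq> 0\<close>. For \<open>j\<close> in
  \<open>J\<close> the operator \<open>x\<^sub>j\<close> is diagonalisable with eigenvalues \<open>\<plusminus>\<kappa>\<^sub>j\<close>, and \<open>c\<^sub>j\<close> exchanges its eigenspaces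
  without touching those of the other \<open>x\<^sub>i\<close>. So a subspace stable under these operators is generated
  by its intersection with the weight space \<open>W\<close> where every \<open>x\<^sub>j\<close> is \<open>\<kappa>\<^sub>j\<close>
  (\<open>subset_if_weight_space_subset\<close>). Moreover \<open>2\<^sup>r dim W \<le> dim M\<close> for \<open>r = card J\<close>, so that as many
  independent weight vectors as this bound permits span \<open>W\<close> (\<open>weight_space_spanned\<close>). Simplicity is thus decided in \<open>W\<close>.

  If \<open>a = 0\<close>, then \<open>J = {2..d}\<close> and \<open>W\<close> has a basis \<open>w\<close>, \<open>c\<^sub>1 w\<close> with \<open>w\<close> even. A nonzero graded
  submodule contains an even or an odd vector of \<open>W\<close>, hence \<open>w\<close>, hence everything. Without the
  grading, \<open>c\<^sub>1\<close> preserves the line of \<open>w + \<i> c\<^sub>1 w\<close>, whose Clifford span is a proper submodule.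

  If \<open>a > 0\<close>, then \<open>J\<close> contains all indices and \<open>W\<close> has a basis \<open>w\<close>, \<open>c\<^sub>1 w'\<close>, one even and one odd. The
  Clifford span of \<open>w\<close> meets \<open>W\<close> in the line of \<open>w\<close> only, so it is simple even without the grading.
  Changing the sign of \<open>\<kappa>\<^sub>1\<close> turns \<open>w\<close> into \<open>w'\<close>, so the same holds there.

  If the segment starts at \<open>-p\<close> with \<open>p > 0\<close>, then \<open>J\<close> omits exactly \<open>p\<close> and \<open>p + 1\<close>, and \<open>W\<close> has
  dimension eight. The operator \<open>y = c\<^sub>p c\<^sub>p\<^sub>+\<^sub>1\<close> separates \<open>w\<close> and \<open>w'\<close>, having eigenvalues \<open>-\<i>\<close> and
  \<open>\<i>\<close> there. On their Clifford spans \<open>x\<^sub>p\<close> and \<open>x\<^sub>p\<^sub>+\<^sub>1\<close> vanish, while \<open>x\<^sub>p s\<^sub>p u = -(1 + y) u\<close> with \<open>1 + y\<close>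
  invertible: \<open>x\<^sub>p\<close> brings every submodule back to the Clifford span of \<open>w\<close>, and \<open>s\<^sub>p\<close> leads from there
  to the rest.

  Counting dimensions requires \<open>w \<noteq> 0\<close>. Multiplying by \<open>x\<^sub>i + \<kappa>\<^sub>i\<close> a vector that involves only \<open>c\<^sub>k\<close> with
  \<open>k < i\<close> changes its part free of \<open>c\<^sub>i\<close> by the factor \<open>t\<^sub>i + \<kappa>\<^sub>i\<close>, and this factor vanishes only if
  \<open>t\<^sub>i = 0\<close> (\<open>shift_nonzero\<close>).
\<close>

section \<open>Linear maps on spaces with a basis\<close>

global_interpretation vs: vector_space cscale
  by (rule vector_space_cscale)

global_interpretation vs2: vector_space_pair cscale cscale
  by unfold_locales

abbreviation clin :: "(('i \<Rightarrow>\<^sub>0 complex) \<Rightarrow> ('j \<Rightarrow>\<^sub>0 complex)) \<Rightarrow> bool" where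
  "clin \<equiv> Vector_Spaces.linear cscale cscale"

lemma clinI:
  assumes "\<And>u v. f (u + v) = f u + f v" "\<And>z v. f (cscale z v) = cscale z (f v)"
  shows "clin f"
  by unfold_locales (use assms in auto)

lemmas linear_simps = vs2.linear_add vs2.linear_scale vs2.linear_0 vs2.linear_neg vs2.linear_diff
  vs2.linear_sum

lemma clin_linext: "clin (linext B)"
proof (rule clinI)
  have ext: "linext B v = (\<Sum>i\<in>A. cscale (Poly_Mapping.lookup v i) (B i))"
    if "finite A" "Poly_Mapping.keys v \<subseteq> A" for v A
    unfolding linext_def using that
    by (intro sum.mono_neutral_left) (auto simp: in_keys_iff)
  fix u v :: "'a \<Rightarrow>\<^sub>0 complex" and z
  let ?A = "Poly_Mapping.keys u \<union> Poly_Mapping.keys v"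
  show "linext B (u + v) = linext B u + linext B v"
    using keys_add[of u v]
    by (simp add: ext[of ?A] lookup_add vs.scale_left_distrib sum.distrib)
  have "Poly_Mapping.keys (cscale z u) \<subseteq> Poly_Mapping.keys u"
    by (auto simp: in_keys_iff)
  then show "linext B (cscale z u) = cscale z (linext B u)"
    by (simp add: ext[of "Poly_Mapping.keys u"] vs.scale_sum_right)
qed

lemma linext_bvec [simp]: "linext B (bvec i) = B i"
  by (simp add: linext_def bvec_def)

lemma lookup_bvec: "Poly_Mapping.lookup (bvec i) j = (if i = j then 1 else 0)"
  by (simp add: bvec_def lookup_single when_def)

lemma bvec_expansion: "v = (\<Sum>i\<in>Poly_Mapping.keys v. cscale (Poly_Mapping.lookup v i) (bvec i))"
proof (rule poly_mapping_eqI)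
  fix j
  have "(\<Sum>i\<in>Poly_Mapping.keys v. Poly_Mapping.lookup v i * (if i = j then 1 else 0))
      = (\<Sum>i\<in>Poly_Mapping.keys v. if j = i then Poly_Mapping.lookup v i else 0)"
    by (rule sum.cong) auto
  then show "Poly_Mapping.lookup v j = Poly_Mapping.lookup
      (\<Sum>i\<in>Poly_Mapping.keys v. cscale (Poly_Mapping.lookup v i) (bvec i)) j"
    by (simp add: lookup_sum lookup_bvec sum.delta in_keys_iff)
qed

lemma span_bvec_iff: "v \<in> vs.span (bvec ` K) \<longleftrightarrow> Poly_Mapping.keys v \<subseteq> K"
proof
  have "vs.subspace {v :: 'a \<Rightarrow>\<^sub>0 complex. Poly_Mapping.keys v \<subseteq> K}" (is "vs.subspace ?S")
  proof (rule vs.subspaceI)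
    show "x + y \<in> ?S" if "x \<in> ?S" "y \<in> ?S" for x y
      using keys_add[of x y] that by blast
  qed (auto simp: in_keys_iff subset_iff)
  moreover have "bvec ` K \<subseteq> {v. Poly_Mapping.keys v \<subseteq> K}"
    by (auto simp: bvec_def)
  ultimately show "v \<in> vs.span (bvec ` K) \<Longrightarrow> Poly_Mapping.keys v \<subseteq> K"
    using vs.span_minimal by blast
next
  assume "Poly_Mapping.keys v \<subseteq> K"
  then have "(\<Sum>i\<in>Poly_Mapping.keys v. cscale (Poly_Mapping.lookup v i) (bvec i)) \<in> vs.span (bvec ` K)"
    by (intro vs.span_sum vs.span_scale vs.span_base) auto
  then show "v \<in> vs.span (bvec ` K)"
    using bvec_expansion[of v] by metis
qed

lemma span_bvec_UNIV: "v \<in> vs.span (range bvec)"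
  by (simp add: span_bvec_iff)

lemma cscale_single: "cscale z (Poly_Mapping.single i c) = Poly_Mapping.single i (z * c)"
  by (rule poly_mapping_eqI) (simp add: lookup_single when_def)

lemma vtensor_bvec_eq: "vtensor (bvec e) = linext (\<lambda>S. bvec (e, S))"
  by (rule ext) (simp add: vtensor_def linext_def bvec_def cscale_single)

lemma clin_vtensor: "clin (vtensor (bvec e))"
  unfolding vtensor_bvec_eq by (rule clin_linext)

lemma vtensor_bvec [simp]: "vtensor (bvec e) (bvec S) = bvec (e, S)"
  by (simp add: vtensor_def bvec_def)

lemma vtensor_cscale: "vtensor (cscale z m) n = cscale z (vtensor m n)"
proof (cases "z = 0")
  case True
  then show ?thesis by (simp add: vtensor_def)
next
  case False
  then have "Poly_Mapping.keys (cscale z m) = Poly_Mapping.keys m"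
    by (auto simp: in_keys_iff)
  then show ?thesis
    by (simp add: vtensor_def vs.scale_sum_right)
      (simp add: cscale_single mult.assoc)
qed

lemma vtensor_zero [simp]: "vtensor 0 n = 0"
  by (simp add: vtensor_def)

lemma clin_stensor: "clin (stensor q u v)"
  unfolding stensor_def by (rule clin_linext)

lemma clin_comp:
  assumes "clin f" "clin g"
  shows "clin (\<lambda>v. f (g v))"
proof -
  interpret f: Vector_Spaces.linear cscale cscale f by (rule assms)
  interpret g: Vector_Spaces.linear cscale cscale g by (rule assms)
  show ?thesis by (rule clinI) (simp_all only: f.add g.add f.scale g.scale)
qed

lemma clin_eq_on_span:
  assumes "clin f" "clin g" "\<And>b. b \<in> B \<Longrightarrow> f b = g b" "v \<in> vs.span B"
  shows "f v = g v"
  using vs2.linear_eq_on_span[OF assms(1,2,3,4)] .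

text \<open>With an operator \<open>v\<close> on the Clifford module, \<open>stensor\<close> is determined by its values on
  the two copies \<open>vtensor (bvec e)\<close> of that module.\<close>

lemma stensor_vtensor:
  assumes "clin v"
  shows "stensor q id v (vtensor (bvec e) n)
    = cscale (if q \<and> e then - 1 else 1) (vtensor (bvec e) (v n))"
proof -
  have "clin (\<lambda>n. stensor q id v (vtensor (bvec e) n))"
    by (rule clin_comp[OF clin_stensor clin_vtensor])
  moreover have "clin (\<lambda>n. cscale (if q \<and> e then - 1 else 1) (vtensor (bvec e) (v n)))"
    by (rule vs2.linear_compose_scale_right[OF clin_comp[OF clin_vtensor assms]])
  moreover have "stensor q id v (vtensor (bvec e) (bvec S))
      = cscale (if q \<and> e then - 1 else 1) (vtensor (bvec e) (v (bvec S)))" for S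
    by (simp add: stensor_def)
  ultimately show ?thesis
    using clin_eq_on_span[OF _ _ _ span_bvec_UNIV,
        of "\<lambda>n. stensor q id v (vtensor (bvec e) n)"
          "\<lambda>n. cscale (if q \<and> e then - 1 else 1) (vtensor (bvec e) (v n))" n]
    by blast
qed

section \<open>Clifford multiplication and permutations\<close>

definition toggle :: "nat \<Rightarrow> nat set \<Rightarrow> nat set" where
  "toggle i S = (if i \<in> S then S - {i} else insert i S)"

text \<open>
  The sign in the action of \<open>cl_op i\<close> on the basis vector of \<open>S\<close>, which it sends to the basis vector of
  \<open>toggle i S\<close>.
\<close>

definition cl_sign :: "nat \<Rightarrow> nat set \<Rightarrow> complex" where
  "cl_sign i S = (- 1) ^ card {j \<in> S. j < i} * (if i \<in> S then - 1 else 1)"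

lemma clin_cl_op: "clin (cl_op i)"
  unfolding cl_op_def by (rule clin_linext)

lemma cl_op_bvec: "cl_op i (bvec S) = cscale (cl_sign i S) (bvec (toggle i S))"
  by (simp add: cl_op_def cl_sign_def toggle_def)

lemma toggle_toggle: "toggle i (toggle j S) = toggle j (toggle i S)"
  by (auto simp: toggle_def)

lemma toggle_same [simp]: "toggle i (toggle i S) = S"
  by (auto simp: toggle_def)

lemma mem_toggle: "j \<in> toggle i S \<longleftrightarrow> (if j = i then i \<notin> S else j \<in> S)"
  by (auto simp: toggle_def)

lemma cl_sign_square: "cl_sign i S * cl_sign i S = 1"
  by (simp add: cl_sign_def flip: power_add)

lemma cl_sign_toggle_same: "cl_sign i (toggle i S) = - cl_sign i S"
proof -
  have "{j \<in> toggle i S. j < i} = {j \<in> S. j < i}"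
    by (auto simp: toggle_def)
  then show ?thesis
    by (simp add: cl_sign_def mem_toggle)
qed

lemma cl_sign_toggle_greater:
  assumes "i < j"
  shows "cl_sign i (toggle j S) = cl_sign i S"
proof -
  have "{k \<in> toggle j S. k < i} = {k \<in> S. k < i}"
    using assms by (auto simp: mem_toggle)
  then show ?thesis
    using assms by (simp add: cl_sign_def mem_toggle)
qed

lemma cl_sign_toggle_less:
  assumes "i < j"
  shows "cl_sign j (toggle i S) = - cl_sign j S"
proof -
  let ?F = "{k \<in> S. k < j}"
  have fin: "finite ?F" by simp
  have "(- 1 :: complex) ^ card {k \<in> toggle i S. k < j} = - ((- 1) ^ card ?F)"
  proof (cases "i \<in> S")
    case True
    have eq: "{k \<in> toggle i S. k < j} = ?F - {i}"
      using assms True by (auto simp: mem_toggle)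
    have card: "card ?F = Suc (card (?F - {i}))"
      using assms True fin by (intro card_Suc_Diff1[symmetric]) auto
    show ?thesis
      unfolding eq card by simp
  next
    case False
    have "{k \<in> toggle i S. k < j} = insert i ?F"
      using assms False by (auto simp: mem_toggle)
    then show ?thesis
      using False fin by simp
  qed
  then show ?thesis
    using assms by (simp add: cl_sign_def mem_toggle)
qed

lemma clin_eqI:
  assumes "clin f" "clin g" "\<And>b. f (bvec b) = g (bvec b)"
  shows "f v = g v"
  by (rule clin_eq_on_span[OF assms(1,2) _ span_bvec_UNIV]) (use assms(3) in auto)

lemmas cl_op_linear [simp] = linear_simps[OF clin_cl_op]

lemma cl_op_anticommute:
  assumes "i \<noteq> j"
  shows "cl_op i (cl_op j n) = - cl_op j (cl_op i n)"
proof -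
  have "cl_sign j S * cl_sign i (toggle j S) = - (cl_sign i S * cl_sign j (toggle i S))" for S
    using assms
    by (cases "i < j") (auto simp: cl_sign_toggle_greater cl_sign_toggle_less)
  then have *: "cl_op i (cl_op j (bvec S)) = - cl_op j (cl_op i (bvec S))" for S
    by (simp add: cl_op_bvec toggle_toggle[of i j])
  show ?thesis
    by (rule clin_eqI[where f = "\<lambda>n. cl_op i (cl_op j n)" and g = "\<lambda>n. - cl_op j (cl_op i n)"])
      ((rule clinI; simp)+, rule *)
qed

lemma cl_op_square: "cl_op i (cl_op i n) = - n"
proof -
  have *: "cl_op i (cl_op i (bvec S)) = - bvec S" for S
    by (simp add: cl_op_bvec cl_sign_toggle_same cl_sign_square)
  show ?thesis
    by (rule clin_eqI[where f = "\<lambda>n. cl_op i (cl_op i n)" and g = uminus])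
      ((rule clinI; simp)+, rule *)
qed

lemma clin_cl_perm: "clin (cl_perm \<sigma>)"
  unfolding cl_perm_def by (rule clin_linext)

lemmas cl_perm_linear [simp] = linear_simps[OF clin_cl_perm]

lemma cl_perm_empty [simp]: "cl_perm \<sigma> (bvec {}) = bvec {}"
  by (simp add: cl_perm_def)

lemma cl_op_below: "\<forall>j\<in>S. m < j \<Longrightarrow> cl_op m (bvec S) = bvec (insert m S)"
proof -
  assume S: "\<forall>j\<in>S. m < j"
  then have empty: "{j \<in> S. j < m} = {}" and "m \<notin> S" by fastforce+
  then have "cl_sign m S = 1" unfolding cl_sign_def empty by simp
  with \<open>m \<notin> S\<close> show ?thesis by (simp add: cl_op_bvec toggle_def)
qed

text \<open>
  The base case: a minimal index goes to the head of the sorted product, so the two operations commute by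
  definition.
\<close>

lemma cl_perm_cl_op_below:
  assumes "finite S" "\<forall>j\<in>S. m < j"
  shows "cl_perm \<sigma> (cl_op m (bvec S)) = cl_op (\<sigma> m) (cl_perm \<sigma> (bvec S))"
proof -
  have "m \<notin> S" using assms by blast
  then have "sorted_list_of_set (insert m S) = m # sorted_list_of_set S"
    using assms by (auto simp: sorted_list_of_set.sorted_key_list_of_set_insert less_imp_le
        intro!: insort_is_Cons)
  then show ?thesis
    using assms by (simp add: cl_op_below cl_perm_def)
qed

text \<open>Moving a generator into the sorted product that represents a basis vector produces the same
  signs before and after an injective relabelling, because only anticommutation is used.\<close>

lemma cl_perm_cl_op_bvec:
  assumes "inj \<sigma>" "finite S"
  shows "cl_perm \<sigma> (cl_op i (bvec S)) = cl_op (\<sigma> i) (cl_perm \<sigma> (bvec S))"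
  using assms(2)
proof (induction S arbitrary: i rule: finite_linorder_min_induct)
  case empty
  show ?case using cl_perm_cl_op_below[of "{}" i \<sigma>] by simp
next
  case (insert m S)
  have m: "bvec (insert m S) = cl_op m (bvec S)"
    using insert.hyps by (simp add: cl_op_below)
  have perm_m: "cl_perm \<sigma> (cl_op m (bvec S)) = cl_op (\<sigma> m) (cl_perm \<sigma> (bvec S))"
    using insert.hyps by (intro cl_perm_cl_op_below) auto
  consider "i < m" | "i = m" | "m < i" by linarith
  then show ?case
  proof cases
    case 1
    then show ?thesis
      using insert.hyps by (intro cl_perm_cl_op_below) auto
  next
    case 2
    then show ?thesis
      by (simp only: m perm_m cl_op_square cl_perm_linear)
  next
    case 3
    have "cl_perm \<sigma> (cl_op m (bvec (toggle i S))) = cl_op (\<sigma> m) (cl_perm \<sigma> (bvec (toggle i S)))"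
      using insert.hyps 3 by (intro cl_perm_cl_op_below) (auto simp: toggle_def)
    then have "cl_perm \<sigma> (cl_op m (cl_op i (bvec S))) = cl_op (\<sigma> m) (cl_perm \<sigma> (cl_op i (bvec S)))"
      by (simp only: cl_op_bvec[of i S] cl_op_linear cl_perm_linear)
    moreover have "i \<noteq> m" "\<sigma> i \<noteq> \<sigma> m"
      using 3 assms(1) by (auto dest: injD)
    ultimately show ?thesis
      by (simp only: m perm_m insert.IH cl_op_anticommute[OF \<open>i \<noteq> m\<close>]
          cl_op_anticommute[OF \<open>\<sigma> i \<noteq> \<sigma> m\<close>] cl_perm_linear)
  qed
qed

section \<open>The operators on a segment module\<close>

type_synonym segvec = "bool \<times> nat set \<Rightarrow>\<^sub>0 complex"

definition Cop :: "nat \<Rightarrow> segvec \<Rightarrow> segvec" where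
  "Cop i = stensor True id (cl_op i)"

definition Pop :: "(nat \<Rightarrow> nat) \<Rightarrow> segvec \<Rightarrow> segvec" where
  "Pop \<sigma> = stensor False id (cl_perm \<sigma>)"

definition Eop :: "nat \<Rightarrow> segvec \<Rightarrow> segvec" where
  "Eop i = stensor False id (cl_eps i)"

definition Lop :: "int \<Rightarrow> segvec \<Rightarrow> segvec" where
  "Lop a = stensor False (phi_op a) id"

text \<open>
  Right multiplication by \<open>\<phi>\<close> in \<open>\<Phi>\<^sub>a \<otimes> Cl(d)\<close>: as \<open>\<Phi>\<^sub>a\<close> is commutative, it differs from left
  multiplication only by the sign for moving the odd \<open>\<phi>\<close> past the Clifford factors. With this sign it
  commutes with the action of the whole algebra.
\<close>

definition Rop :: "int \<Rightarrow> segvec \<Rightarrow> segvec" where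
  "Rop a = linext (\<lambda>(e, S). cscale ((- 1) ^ card S) (Lop a (bvec (e, S))))"

definition Xop :: "int \<Rightarrow> nat \<Rightarrow> segvec \<Rightarrow> segvec" where
  "Xop a i v = cscale (of_int a) (Eop i v)
     + (\<Sum>k\<in>{1..<i}. Pop (transpose k i) v - Cop k (Cop i (Pop (transpose k i) v)))
     - Lop a (Cop i v)"

text \<open>
  The index set \<open>I\<close> is variable because the argument that the weight vectors are nonzero looks at
  vectors that involve only the first few Clifford generators.
\<close>

definition segspace :: "int \<Rightarrow> nat set \<Rightarrow> segvec set" where
  "segspace a I = vs.span (bvec ` (phi_basis a \<times> Pow I))"

lemma clin_Cop: "clin (Cop i)" and clin_Pop: "clin (Pop \<sigma>)" and clin_Eop: "clin (Eop i)"
  and clin_Lop: "clin (Lop a)" and clin_Rop: "clin (Rop a)"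
  unfolding Cop_def Pop_def Eop_def Lop_def Rop_def
  by (rule clin_stensor clin_linext)+

lemmas Cop_linear [simp] = linear_simps[OF clin_Cop]
lemmas Pop_linear [simp] = linear_simps[OF clin_Pop]
lemmas Eop_linear [simp] = linear_simps[OF clin_Eop]
lemmas Lop_linear [simp] = linear_simps[OF clin_Lop]
lemmas Rop_linear [simp] = linear_simps[OF clin_Rop]

lemma clin_Xop: "clin (Xop a i)"
  unfolding Xop_def
  by (intro vs2.linear_compose_add vs2.linear_compose_sub vs2.linear_compose_sum ballI
      vs2.linear_compose_scale_right clin_Eop clin_Pop clin_comp[OF clin_Lop clin_Cop]
      clin_comp[OF clin_Cop clin_comp[OF clin_Cop clin_Pop]])

lemmas Xop_linear [simp] = linear_simps[OF clin_Xop]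

lemma Cop_bvec: "Cop i (bvec (e, S)) = cscale ((if e then - 1 else 1) * cl_sign i S) (bvec (e, toggle i S))"
  by (simp add: Cop_def stensor_def cl_op_bvec vs2.linear_scale[OF clin_vtensor])

lemma Pop_vtensor: "Pop \<sigma> (vtensor (bvec e) n) = vtensor (bvec e) (cl_perm \<sigma> n)"
  using stensor_vtensor[OF clin_cl_perm, of False \<sigma> e n] by (simp add: Pop_def)

lemma Cop_vtensor: "Cop i (vtensor (bvec e) n) = cscale (if e then - 1 else 1) (vtensor (bvec e) (cl_op i n))"
  using stensor_vtensor[OF clin_cl_op, of True i e n] by (simp add: Cop_def)

lemma Eop_bvec: "Eop i (bvec (e, S)) = (if i \<in> S then - bvec (e, S) else bvec (e, S))"
  by (simp add: Eop_def stensor_def cl_eps_def vs2.linear_neg[OF clin_vtensor])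

lemma Lop_bvec: "Lop a (bvec (e, S)) = (if a = 0 \<and> \<not> e then 0 else
    cscale (if e then of_int a else 1) (bvec (\<not> e, S)))"
  by (auto simp: Lop_def stensor_def phi_op_def vtensor_cscale)

lemma Rop_bvec: "Rop a (bvec (e, S)) = cscale ((- 1) ^ card S) (Lop a (bvec (e, S)))"
  by (simp add: Rop_def)

lemma hat_one_bvec: "hat_one = bvec (False, {})"
  by (simp add: hat_one_def)

lemma Cop_square: "Cop i (Cop i v) = - v"
proof -
  have *: "Cop i (Cop i (bvec b)) = - bvec b" for b
    by (cases b) (simp add: Cop_bvec cl_sign_toggle_same cl_sign_square algebra_simps)
  show ?thesis
    by (rule clin_eqI[where f = "\<lambda>n. Cop i (Cop i n)" and g = uminus])
      ((rule clinI; simp)+, rule *)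
qed

lemma Cop_anticommute:
  assumes "i \<noteq> j"
  shows "Cop i (Cop j v) = - Cop j (Cop i v)"
proof -
  have *: "Cop i (Cop j (vtensor (bvec e) n)) = - Cop j (Cop i (vtensor (bvec e) n))" for e n
    by (simp add: Cop_vtensor cl_op_anticommute[OF assms, of n] vs2.linear_neg[OF clin_vtensor])
  then have *: "Cop i (Cop j (bvec b)) = - Cop j (Cop i (bvec b))" for b
    using *[of "fst b" "bvec (snd b)"] by simp
  show ?thesis
    by (rule clin_eqI[where f = "\<lambda>n. Cop i (Cop j n)" and g = "\<lambda>n. - Cop j (Cop i n)"])
      ((rule clinI; simp)+, rule *)
qed

lemma Eop_Cop_same: "Eop i (Cop i v) = - Cop i (Eop i v)"
proof -
  have *: "Eop i (Cop i (bvec b)) = - Cop i (Eop i (bvec b))" for b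
    by (cases b) (simp add: Cop_bvec Eop_bvec mem_toggle)
  show ?thesis
    by (rule clin_eqI[where f = "\<lambda>n. Eop i (Cop i n)" and g = "\<lambda>n. - Cop i (Eop i n)"])
      ((rule clinI; simp)+, rule *)
qed

lemma Eop_Cop_other:
  assumes "j \<noteq> i"
  shows "Eop i (Cop j v) = Cop j (Eop i v)"
proof -
  have *: "Eop i (Cop j (bvec b)) = Cop j (Eop i (bvec b))" for b
    using assms by (cases b) (simp add: Cop_bvec Eop_bvec mem_toggle)
  show ?thesis
    by (rule clin_eqI[where f = "\<lambda>n. Eop i (Cop j n)" and g = "\<lambda>n. Cop j (Eop i n)"])
      ((rule clinI; simp)+, rule *)
qed

lemma Eop_Rop: "Eop i (Rop a v) = Rop a (Eop i v)"
proof -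
  have *: "Eop i (Rop a (bvec b)) = Rop a (Eop i (bvec b))" for b
    by (cases b) (simp add: Rop_bvec Lop_bvec Eop_bvec)
  show ?thesis
    by (rule clin_eqI[where f = "\<lambda>n. Eop i (Rop a n)" and g = "\<lambda>n. Rop a (Eop i n)"])
      ((rule clinI; simp)+, rule *)
qed

lemma Lop_Rop: "Lop a (Rop a v) = Rop a (Lop a v)"
proof -
  have *: "Lop a (Rop a (bvec b)) = Rop a (Lop a (bvec b))" for b
    by (cases b) (simp add: Rop_bvec Lop_bvec)
  show ?thesis
    by (rule clin_eqI[where f = "\<lambda>n. Lop a (Rop a n)" and g = "\<lambda>n. Rop a (Lop a n)"])
      ((rule clinI; simp)+, rule *)
qed

lemma Lop_Cop: "Lop a (Cop i v) = - Cop i (Lop a v)"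
proof -
  have *: "Lop a (Cop i (bvec b)) = - Cop i (Lop a (bvec b))" for b
    by (cases b) (auto simp: Cop_bvec Lop_bvec)
  show ?thesis
    by (rule clin_eqI[where f = "\<lambda>n. Lop a (Cop i n)" and g = "\<lambda>n. - Cop i (Lop a n)"])
      ((rule clinI; simp)+, rule *)
qed

lemma Rop_Rop: "Rop a (Rop a v) = cscale (of_int a) v"
proof -
  have *: "Rop a (Rop a (bvec b)) = cscale (of_int a) (bvec b)" for b
    by (cases b) (auto simp: Rop_bvec Lop_bvec simp flip: power_add)
  show ?thesis
    by (rule clin_eqI[where f = "\<lambda>n. Rop a (Rop a n)" and g = "cscale (of_int a)"])
      ((rule clinI; simp add: vs.scale_right_distrib mult.commute)+, rule *)
qed

lemma Lop_one: "Lop a hat_one = Rop a hat_one"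
  by (simp add: hat_one_bvec Rop_bvec)

lemma Eop_one [simp]: "Eop i hat_one = hat_one"
  by (simp add: hat_one_bvec Eop_bvec)

lemma Pop_one [simp]: "Pop \<sigma> hat_one = hat_one"
  by (simp add: hat_one_def Pop_vtensor del: vtensor_bvec)

lemma Pop_Rop_one [simp]: "Pop \<sigma> (Rop a hat_one) = Rop a hat_one"
  using Pop_vtensor[of \<sigma> True "bvec {}"] by (simp add: hat_one_bvec Rop_bvec Lop_bvec)

lemma minus_one_power_card_toggle:
  assumes "finite S"
  shows "(- 1 :: complex) ^ card (toggle i S) = - ((- 1) ^ card S)"
proof (cases "i \<in> S")
  case True
  have card: "card S = Suc (card (S - {i}))"
    by (rule card.remove[OF assms True])
  show ?thesis
    unfolding card using True by (simp add: toggle_def)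
qed (use assms in \<open>simp add: toggle_def\<close>)

subsection \<open>The underlying spaces\<close>

lemma subspace_segspace: "vs.subspace (segspace a I)"
  by (simp add: segspace_def)

lemmas segspace_closed_linear [intro] = vs.subspace_add[OF subspace_segspace]
  vs.subspace_scale[OF subspace_segspace] vs.subspace_neg[OF subspace_segspace]
  vs.subspace_diff[OF subspace_segspace] vs.subspace_sum[OF subspace_segspace]
  vs.subspace_0[OF subspace_segspace]

lemma bvec_in_segspace: "bvec (e, S) \<in> segspace a I \<longleftrightarrow> e \<in> phi_basis a \<and> S \<subseteq> I"
  unfolding segspace_def span_bvec_iff by (auto simp: bvec_def)

lemma segspace_map:
  assumes "clin f" "\<And>e S. e \<in> phi_basis a \<Longrightarrow> S \<subseteq> I \<Longrightarrow> f (bvec (e, S)) \<in> segspace b J"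
    "v \<in> segspace a I"
  shows "f v \<in> segspace b J"
proof -
  have "f ` vs.span (bvec ` (phi_basis a \<times> Pow I)) \<subseteq> segspace b J"
    unfolding vs2.linear_span_image[OF assms(1), symmetric]
    by (rule vs.span_minimal) (use assms(2) subspace_segspace in auto)
  then show ?thesis
    using assms(3) by (auto simp: segspace_def)
qed

lemma hat_one_segspace [intro]: "hat_one \<in> segspace a I"
  by (simp add: hat_one_bvec bvec_in_segspace phi_basis_def)

lemma Cop_segspace [intro]: "i \<in> I \<Longrightarrow> v \<in> segspace a I \<Longrightarrow> Cop i v \<in> segspace a I"
  by (erule segspace_map[OF clin_Cop, rotated])
    (auto simp: Cop_bvec toggle_def bvec_in_segspace intro!: segspace_closed_linear)

lemma Eop_segspace [intro]: "v \<in> segspace a I \<Longrightarrow> Eop i v \<in> segspace a I"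
  by (erule segspace_map[OF clin_Eop, rotated])
    (auto simp: Eop_bvec bvec_in_segspace intro!: segspace_closed_linear)

lemma Lop_segspace [intro]: "v \<in> segspace a I \<Longrightarrow> Lop a v \<in> segspace a I"
  by (erule segspace_map[OF clin_Lop, rotated])
    (auto simp: Lop_bvec bvec_in_segspace phi_basis_def intro!: segspace_closed_linear)

lemma Rop_segspace [intro]: "v \<in> segspace a I \<Longrightarrow> Rop a v \<in> segspace a I"
  by (erule segspace_map[OF clin_Rop, rotated])
    (auto simp: Rop_bvec bvec_in_segspace intro!: segspace_closed_linear)

lemma Rop_Cop:
  assumes "finite I" "v \<in> segspace a I"
  shows "Rop a (Cop i v) = Cop i (Rop a v)"
proof (rule clin_eq_on_span[where f = "\<lambda>v. Rop a (Cop i v)" and g = "\<lambda>v. Cop i (Rop a v)"])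
  show "v \<in> vs.span (bvec ` (phi_basis a \<times> Pow I))"
    using assms(2) by (simp add: segspace_def)
  fix b assume "b \<in> bvec ` (phi_basis a \<times> Pow I)"
  then obtain e S where b: "b = bvec (e, S)" and "finite S"
    using assms(1) finite_subset by blast
  then show "Rop a (Cop i b) = Cop i (Rop a b)"
    by (auto simp: Cop_bvec Rop_bvec Lop_bvec minus_one_power_card_toggle)
qed (rule clinI; simp)+

text \<open>
  A basis vector is, up to sign, a product of Clifford generators applied to the cyclic vector, or to
  its image under \<open>Rop\<close> if it contains \<open>\<phi>\<close>.
\<close>

lemma segspace_induct [consumes 2, case_names one C R add scale]:
  assumes "v \<in> segspace a I" "finite I"
    and one: "P hat_one"
    and C: "\<And>j v. j \<in> I \<Longrightarrow> v \<in> segspace a I \<Longrightarrow> P v \<Longrightarrow> P (Cop j v)"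
    and R: "\<And>v. v \<in> segspace a I \<Longrightarrow> P v \<Longrightarrow> P (Rop a v)"
    and add: "\<And>u v. P u \<Longrightarrow> P v \<Longrightarrow> P (u + v)"
    and scale: "\<And>z v. P v \<Longrightarrow> P (cscale z v)"
  shows "P v"
proof -
  have basis: "P (bvec (e, S))" if e: "e \<in> phi_basis a" and S: "S \<subseteq> I" for e S
    using finite_subset[OF S assms(2)] S
  proof (induction S rule: finite_induct)
    case empty
    show ?case
    proof (cases e)
      case True
      with e have "a \<noteq> 0" by (auto simp: phi_basis_def)
      then have "Rop a hat_one = bvec (True, {})"
        by (simp add: hat_one_bvec Rop_bvec Lop_bvec)
      then show ?thesis
        using R[OF hat_one_segspace one] True by simp
    qed (use one in \<open>simp add: hat_one_bvec\<close>)
  next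
    case (insert i S)
    let ?z = "(if e then - 1 else 1) * cl_sign i S"
    have z: "?z * ?z = 1" using cl_sign_square[of i S] by auto
    have "Cop i (bvec (e, S)) = cscale ?z (bvec (e, insert i S))"
      using insert.hyps by (simp add: Cop_bvec toggle_def)
    then have "bvec (e, insert i S) = cscale ?z (Cop i (bvec (e, S)))"
      using z by simp
    moreover have "P (cscale ?z (Cop i (bvec (e, S))))"
      using insert e by (intro scale C) (auto simp: bvec_in_segspace)
    ultimately show ?case by simp
  qed
  have zero: "P 0" using scale[OF one, of 0] by simp
  show ?thesis
    using assms(1) unfolding segspace_def
    by (induction rule: vs.span_induct_alt) (auto intro: zero add scale basis)
qed

text \<open>
  The tool for all relations: two operators that pass the generators in the same way agree as soon as
  they agree on the cyclic vector.
\<close>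

lemma segspace_eq:
  assumes "v \<in> segspace a I" "finite I" "clin f" "clin g"
    and "f hat_one = g hat_one"
    and "\<And>j v. j \<in> I \<Longrightarrow> v \<in> segspace a I \<Longrightarrow> f v = g v \<Longrightarrow> f (Cop j v) = g (Cop j v)"
    and "\<And>v. v \<in> segspace a I \<Longrightarrow> f v = g v \<Longrightarrow> f (Rop a v) = g (Rop a v)"
  shows "f v = g v"
  using assms(1,2)
  by (induction rule: segspace_induct)
    (use assms(5-7) in \<open>auto simp: vs2.linear_add[OF assms(3)] vs2.linear_add[OF assms(4)]
      vs2.linear_scale[OF assms(3)] vs2.linear_scale[OF assms(4)]\<close>)

lemma Pop_Cop:
  assumes "inj \<sigma>" "finite I" "v \<in> segspace a I"
  shows "Pop \<sigma> (Cop i v) = Cop (\<sigma> i) (Pop \<sigma> v)"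
proof (rule clin_eq_on_span[where f = "\<lambda>v. Pop \<sigma> (Cop i v)" and g = "\<lambda>v. Cop (\<sigma> i) (Pop \<sigma> v)"])
  show "v \<in> vs.span (bvec ` (phi_basis a \<times> Pow I))"
    using assms(3) by (simp add: segspace_def)
  fix b assume "b \<in> bvec ` (phi_basis a \<times> Pow I)"
  then obtain e S where b: "b = vtensor (bvec e) (bvec S)" and "finite S"
    using assms(2) finite_subset by fastforce
  then show "Pop \<sigma> (Cop i b) = Cop (\<sigma> i) (Pop \<sigma> b)"
    using assms(1)
    by (simp add: Cop_vtensor Pop_vtensor cl_perm_cl_op_bvec del: vtensor_bvec)
qed (rule clinI; simp)+

lemma Pop_segspace:
  assumes "inj \<sigma>" "\<sigma> ` I \<subseteq> I" "finite I" "v \<in> segspace a I"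
  shows "Pop \<sigma> v \<in> segspace a I \<and> Pop \<sigma> (Rop a v) = Rop a (Pop \<sigma> v)"
  using assms(4,3)
proof (induction rule: segspace_induct)
  case (C j v)
  note Pop_Cop' = Pop_Cop[OF assms(1,3)] and Rop_Cop' = Rop_Cop[OF assms(3)]
  have "\<sigma> j \<in> I" using C(1) assms(2) by blast
  with C show ?case
    by (auto simp: Pop_Cop'[of v a] Pop_Cop'[of "Rop a v" a] Rop_Cop' Rop_segspace)
next
  case (R v)
  then show ?case
    by (auto simp: Rop_Rop)
qed (auto simp: vs.scale_right_distrib)

lemma Pop_comp:
  assumes "inj \<sigma>" "inj \<tau>" "\<tau> ` I \<subseteq> I" "\<sigma> ` I \<subseteq> I" "finite I" "v \<in> segspace a I"
  shows "Pop \<sigma> (Pop \<tau> v) = Pop (\<lambda>i. \<sigma> (\<tau> i)) v"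
proof (rule segspace_eq[where f = "\<lambda>v. Pop \<sigma> (Pop \<tau> v)" and g = "Pop (\<lambda>i. \<sigma> (\<tau> i))", OF assms(6,5)])
  have inj: "inj (\<lambda>i. \<sigma> (\<tau> i))"
    using inj_compose[OF assms(1,2)] by (simp add: comp_def)
  fix j v assume v: "v \<in> segspace a I" and eq: "Pop \<sigma> (Pop \<tau> v) = Pop (\<lambda>i. \<sigma> (\<tau> i)) v"
  show "Pop \<sigma> (Pop \<tau> (Cop j v)) = Pop (\<lambda>i. \<sigma> (\<tau> i)) (Cop j v)"
    using Pop_segspace[of \<tau>, OF assms(2,3,5) v] eq v assms
    by (simp add: Pop_Cop[OF assms(2,5) v] Pop_Cop[OF assms(1,5), of "Pop \<tau> v" a]
        Pop_Cop[OF inj assms(5) v])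
  show "Pop \<sigma> (Pop \<tau> (Rop a v)) = Pop (\<lambda>i. \<sigma> (\<tau> i)) (Rop a v)"
    using Pop_segspace[of \<tau>, OF assms(2,3,5) v] Pop_segspace[of \<sigma> I, OF assms(1,4,5)]
      Pop_segspace[OF inj _ assms(5) v] eq assms(3,4)
    by (auto simp: image_subset_iff)
qed (simp_all add: clin_Pop clin_comp[OF clin_Pop clin_Pop])

(* Index ranges keep the form {1..d}. *)
declare One_nat_def [simp del]

section \<open>The defining relations\<close>

definition Csum :: "nat set \<Rightarrow> segvec \<Rightarrow> segvec" where
  "Csum A v = (\<Sum>k\<in>A. Cop k v)"

text \<open>
  The number that labels the \<open>i\<close>-th place of the segment; \<open>x\<^sub>i\<^sup>2\<close> acts by \<open>t\<^sup>2 + t\<close> at \<open>t = tval a i\<close>.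
\<close>

definition tval :: "int \<Rightarrow> nat \<Rightarrow> complex" where
  "tval a i = of_int a + of_nat i - 1"

lemma clin_Csum: "clin (Csum A)"
  unfolding Csum_def by (intro vs2.linear_compose_sum ballI clin_Cop)

lemmas Csum_linear [simp] = linear_simps[OF clin_Csum]

lemma Csum_Cop: "i \<notin> A \<Longrightarrow> Csum A (Cop i v) = - Cop i (Csum A v)"
  unfolding Csum_def Cop_linear sum_negf[symmetric]
  by (intro sum.cong refl Cop_anticommute) auto

lemma Csum_disjoint:
  assumes "A \<inter> B = {}"
  shows "Csum A (Csum B v) = - Csum B (Csum A v)"
proof -
  have "Csum A (Csum B v) = (\<Sum>k\<in>B. Csum A (Cop k v))"
    by (simp add: Csum_def[of B])
  also have "\<dots> = (\<Sum>k\<in>B. - Cop k (Csum A v))"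
    using assms by (intro sum.cong refl Csum_Cop) auto
  finally show ?thesis
    by (simp add: Csum_def[of B] sum_negf)
qed

lemma Csum_insert: "finite A \<Longrightarrow> i \<notin> A \<Longrightarrow> Csum (insert i A) v = Cop i v + Csum A v"
  by (simp add: Csum_def)

text \<open>
  The square of a sum of anticommuting elements is the sum of their squares.
\<close>

lemma Csum_square:
  assumes "finite A"
  shows "Csum A (Csum A v) = cscale (- of_nat (card A)) v"
  using assms
proof (induction A arbitrary: v rule: finite_induct)
  case empty
  then show ?case by (simp add: Csum_def)
next
  case (insert i A)
  then show ?case
    by (simp add: Csum_insert Csum_Cop Cop_square vs.scale_left_diff_distrib vs.scale_left_distrib)
qed

locale segment =
  fixes a :: int and d :: nat
begin

abbreviation "M \<equiv> segspace a {1..d}"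
abbreviation "C \<equiv> Cop"
abbreviation "X \<equiv> Xop a"
abbreviation "R \<equiv> Rop a"
abbreviation "D i \<equiv> Csum {1..<i}"
abbreviation "t \<equiv> tval a"

definition S :: "nat \<Rightarrow> segvec \<Rightarrow> segvec" where
  "S i = Pop (transpose i (i + 1))"

lemma clin_S: "clin (S i)"
  by (simp add: S_def clin_Pop)

lemma S_linear [simp]: "S i (u + v) = S i u + S i v" "S i (cscale z v) = cscale z (S i v)"
  "S i 0 = 0" "S i (- v) = - S i v" "S i (u - v) = S i u - S i v"
  by (simp_all add: S_def)

lemma R_C: "v \<in> M \<Longrightarrow> R (C i v) = C i (R v)"
  by (rule Rop_Cop) auto

lemma transpose_maps:
  "i \<in> {1..d} \<Longrightarrow> k \<in> {1..d} \<Longrightarrow> transpose i k ` {1..d} \<subseteq> {1..d}"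
  by (auto simp: transpose_def)

lemma Pop_transpose:
  assumes "v \<in> M" "i \<in> {1..d}" "k \<in> {1..d}"
  shows "Pop (transpose i k) v \<in> M" "Pop (transpose i k) (R v) = R (Pop (transpose i k) v)"
    "Pop (transpose i k) (C j v) = C (transpose i k j) (Pop (transpose i k) v)"
proof -
  have inj: "inj (transpose i k)"
    by (rule inj_transpose)
  show "Pop (transpose i k) v \<in> M" "Pop (transpose i k) (R v) = R (Pop (transpose i k) v)"
    using Pop_segspace[OF inj transpose_maps[OF assms(2,3)] _ assms(1)] by auto
  show "Pop (transpose i k) (C j v) = C (transpose i k j) (Pop (transpose i k) v)"
    by (rule Pop_Cop[OF inj _ assms(1)]) simp
qed

lemma S_props:
  assumes "v \<in> M" "i \<in> {1..<d}"
  shows S_M: "S i v \<in> M" and S_R: "S i (R v) = R (S i v)"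
    and S_C: "S i (C j v) = C (transpose i (i + 1) j) (S i v)"
  using Pop_transpose[OF assms(1), of i "i + 1"] assms(2) by (auto simp: S_def)

lemma X_M:
  assumes "v \<in> M" "i \<in> {1..d}"
  shows "X i v \<in> M"
proof -
  have "Pop (transpose k i) v \<in> M" if "k \<in> {1..<i}" for k
    using that assms by (intro Pop_transpose) auto
  then show ?thesis
    unfolding Xop_def using assms
    by (intro vs.subspace_add[OF subspace_segspace] vs.subspace_diff[OF subspace_segspace]
        vs.subspace_sum[OF subspace_segspace] vs.subspace_scale[OF subspace_segspace]
        Cop_segspace Lop_segspace Eop_segspace) auto
qed

lemma X_R:
  assumes "v \<in> M" "i \<in> {1..d}"
  shows "X i (R v) = R (X i v)"
proof -
  have "Pop (transpose k i) (R v) - C k (C i (Pop (transpose k i) (R v)))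
      = R (Pop (transpose k i) v - C k (C i (Pop (transpose k i) v)))" if "k \<in> {1..<i}" for k
  proof -
    have k: "k \<in> {1..d}" using that assms(2) by auto
    note P = Pop_transpose[OF assms(1) k assms(2)]
    have "C i (Pop (transpose k i) v) \<in> M"
      using P(1) assms(2) by auto
    then show ?thesis
      using P by (simp add: R_C)
  qed
  then show ?thesis
    using assms
    by (simp add: Xop_def Eop_Rop Lop_Rop R_C flip: R_C)
qed

text \<open>
  In the summand for \<open>k\<close> the permutation turns \<open>c\<^sub>i\<close> into \<open>c\<^sub>k\<close>, and
  \<open>(1 - c\<^sub>k c\<^sub>i) c\<^sub>k = - c\<^sub>i (1 - c\<^sub>k c\<^sub>i)\<close>.
\<close>

lemma X_C_same:
  assumes "v \<in> M" "i \<in> {1..d}"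
  shows "X i (C i v) = - C i (X i v)"
proof -
  have "Pop (transpose k i) (C i v) - C k (C i (Pop (transpose k i) (C i v)))
      = - C i (Pop (transpose k i) v - C k (C i (Pop (transpose k i) v)))" if "k \<in> {1..<i}" for k
  proof -
    have k: "k \<in> {1..d}" and ik: "i \<noteq> k" using that assms(2) by auto
    show ?thesis
      using ik by (simp add: Pop_transpose[OF assms(1) k assms(2)] Cop_anticommute[OF ik] Cop_square)
  qed
  then have "(\<Sum>k\<in>{1..<i}. Pop (transpose k i) (C i v) - C k (C i (Pop (transpose k i) (C i v))))
    = - C i (\<Sum>k\<in>{1..<i}. Pop (transpose k i) v - C k (C i (Pop (transpose k i) v)))"
    by (simp only: Cop_linear sum_negf cong: sum.cong)
  then show ?thesis
    unfolding Xop_def by (simp add: Eop_Cop_same Cop_square Lop_Cop)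
qed

lemma X_C_other:
  assumes "v \<in> M" "i \<in> {1..d}" "j \<noteq> i"
  shows "X i (C j v) = C j (X i v)"
proof -
  have "Pop (transpose k i) (C j v) - C k (C i (Pop (transpose k i) (C j v)))
      = C j (Pop (transpose k i) v - C k (C i (Pop (transpose k i) v)))" if "k \<in> {1..<i}" for k
  proof -
    have k: "k \<in> {1..d}" and ik: "i \<noteq> k" using that assms(2) by auto
    show ?thesis
    proof (cases "j = k")
      case True
      then show ?thesis
        using ik by (simp add: Pop_transpose[OF assms(1) k assms(2)] Cop_square)
    next
      case False
      then show ?thesis
        using assms(3)
        by (simp add: Pop_transpose[OF assms(1) k assms(2)] Cop_anticommute[OF False]
            Cop_anticommute[OF assms(3)])
    qed
  qed
  then have "(\<Sum>k\<in>{1..<i}. Pop (transpose k i) (C j v) - C k (C i (Pop (transpose k i) (C j v))))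
    = C j (\<Sum>k\<in>{1..<i}. Pop (transpose k i) v - C k (C i (Pop (transpose k i) v)))"
    by simp
  then show ?thesis
    unfolding Xop_def using assms(3)
    by (simp add: Eop_Cop_other Cop_anticommute[OF assms(3)] Lop_Cop)
qed

text \<open>
  On the cyclic vector every transposition is trivial, so only Clifford generators remain, and left
  multiplication by \<open>\<phi>\<close> may be replaced by right multiplication.
\<close>

lemma X_one:
  assumes "i \<in> {1..d}"
  shows "X i hat_one = cscale (t i) hat_one + C i (D i hat_one + R hat_one)"
proof -
  have "(\<Sum>k\<in>{1..<i}. Pop (transpose k i) hat_one - C k (C i (Pop (transpose k i) hat_one)))
      = (\<Sum>k\<in>{1..<i}. hat_one + C i (C k hat_one))"
    by (intro sum.cong refl) (auto simp: Cop_anticommute[of i])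
  also have "\<dots> = cscale (of_nat i - 1) hat_one + C i (D i hat_one)"
    using assms by (simp add: sum.distrib Csum_def vs.sum_constant_scale of_nat_diff)
  finally show ?thesis
    by (simp add: Xop_def Lop_Cop Lop_one tval_def vs.scale_left_distrib vs.scale_left_diff_distrib)
qed


lemmas M_eq = segspace_eq[OF _ finite_atLeastAtMost, of _ a 1 d]

lemma S_square: "v \<in> M \<Longrightarrow> i \<in> {1..<d} \<Longrightarrow> S i (S i v) = v"
proof -
  assume v: "v \<in> M" and i: "i \<in> {1..<d}"
  have "Pop (\<lambda>j. j) v = v"
    by (rule M_eq[OF v, where f = "Pop (\<lambda>j. j)" and g = "\<lambda>v. v"])
      (use Pop_Cop[where \<sigma> = "\<lambda>j. j" and a = a and I = "{1..d}"] Pop_segspace[of "\<lambda>j. j" "{1..d}" _ a] in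
        \<open>auto simp: clin_Pop vs.linear_ident\<close>)
  moreover have "S i (S i v) = Pop (\<lambda>j. transpose i (i + 1) (transpose i (i + 1) j)) v"
    unfolding S_def using i v transpose_maps[of i "i + 1"]
    by (intro Pop_comp[of _ _ "{1..d}" _ a]) (auto simp: inj_transpose)
  ultimately show ?thesis by simp
qed

lemma S_S_Pop:
  assumes "v \<in> M" "inj \<sigma>" "\<sigma> ` {1..d} \<subseteq> {1..d}" "i \<in> {1..<d}"
  shows "S i (Pop \<sigma> v) = Pop (\<lambda>j. transpose i (i + 1) (\<sigma> j)) v"
  unfolding S_def using assms transpose_maps[of i "i + 1"]
  by (intro Pop_comp[of _ _ "{1..d}" _ a]) (auto simp: inj_transpose)

lemma S_commute:
  assumes "v \<in> M" "i \<in> {1..<d}" "j \<in> {1..<d}" "i + 1 < j"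
  shows "S i (S j v) = S j (S i v)"
proof -
  have "S i (S j v) = Pop (\<lambda>k. transpose i (i + 1) (transpose j (j + 1) k)) v"
    unfolding S_def[of j] using assms transpose_maps[of j "j + 1"]
    by (intro S_S_Pop) (auto simp: inj_transpose)
  moreover have "S j (S i v) = Pop (\<lambda>k. transpose j (j + 1) (transpose i (i + 1) k)) v"
    unfolding S_def[of i] using assms transpose_maps[of i "i + 1"]
    by (intro S_S_Pop) (auto simp: inj_transpose)
  moreover have "(\<lambda>k. transpose i (i + 1) (transpose j (j + 1) k))
      = (\<lambda>k. transpose j (j + 1) (transpose i (i + 1) k))"
    using assms(4) by (auto simp: transpose_def fun_eq_iff)
  ultimately show ?thesis by simp
qed

lemma S_braid:
  assumes "v \<in> M" "i \<in> {1..<d}" "i + 1 \<in> {1..<d}"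
  shows "S i (S (i + 1) (S i v)) = S (i + 1) (S i (S (i + 1) v))"
proof -
  let ?s = "transpose i (i + 1)" and ?r = "transpose (i + 1) (i + 1 + 1)"
  have maps: "?s ` {1..d} \<subseteq> {1..d}" "?r ` {1..d} \<subseteq> {1..d}"
    using assms by (intro transpose_maps; force)+
  have inj: "inj ?s" "inj ?r" "inj (\<lambda>j. ?r (?s j))" "inj (\<lambda>j. ?s (?r j))"
    using inj_compose[of ?r ?s] inj_compose[of ?s ?r]
    by (simp_all add: inj_transpose comp_def)
  have "S i (S (i + 1) (S i v)) = Pop (\<lambda>j. ?s (?r (?s j))) v"
    using S_S_Pop[OF assms(1) inj(1) maps(1) assms(3)]
      S_S_Pop[OF assms(1) inj(3) _ assms(2)] maps
    by (simp add: S_def[of i] image_subset_iff)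
  moreover have "S (i + 1) (S i (S (i + 1) v)) = Pop (\<lambda>j. ?r (?s (?r j))) v"
    using S_S_Pop[OF assms(1) inj(2) maps(2) assms(2)]
      S_S_Pop[OF assms(1) inj(4) _ assms(3)] maps
    by (simp add: S_def[of "i + 1"] image_subset_iff)
  moreover have "(\<lambda>j. ?s (?r (?s j))) = (\<lambda>j. ?r (?s (?r j)))"
    by (auto simp: transpose_def fun_eq_iff)
  ultimately show ?thesis by simp
qed

lemma X_Csum:
  assumes "v \<in> M" "i \<in> {1..d}" "i \<notin> A"
  shows "X i (Csum A v) = Csum A (X i v)"
  unfolding Csum_def Xop_linear using assms by (intro sum.cong refl X_C_other) auto

lemma Csum_M: "v \<in> M \<Longrightarrow> A \<subseteq> {1..d} \<Longrightarrow> Csum A v \<in> M"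
  unfolding Csum_def by (intro vs.subspace_sum[OF subspace_segspace] Cop_segspace) auto

lemma R_Csum: "v \<in> M \<Longrightarrow> R (Csum A v) = Csum A (R v)"
  by (simp add: Csum_def R_C)

lemma X_R_one:
  assumes "i \<in> {1..d}"
  shows "X i (R hat_one) = cscale (t i) (R hat_one) + C i (D i (R hat_one) + cscale (of_int a) hat_one)"
proof -
  have D: "D i hat_one \<in> M" "R hat_one \<in> M"
    using assms by (auto intro!: Csum_M)
  show ?thesis
    using assms by (simp add: X_R[OF hat_one_segspace assms] X_one[OF assms] R_C[OF D(1)]
        R_C[OF D(2)] R_Csum[OF hat_one_segspace] Rop_Rop)
qed

lemma D_square: "D i (D i v) = cscale (of_int a - t i) v" if "i \<ge> 1"
  using that by (simp add: Csum_square tval_def of_nat_diff)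

text \<open>
  With \<open>D = D i\<close>, the factors \<open>t \<plusminus> C i (D + R)\<close> multiply to \<open>t\<^sup>2 - (D\<^sup>2 - R\<^sup>2)\<close>, because moving \<open>C i\<close> past
  \<open>D\<close> changes a sign and moving it past \<open>R\<close> does not. Finally \<open>D\<^sup>2 - a = - t\<close>.
\<close>

lemma X_square_one:
  assumes "i \<in> {1..d}"
  shows "X i (X i hat_one) = cscale (t i * t i + t i) hat_one"
proof -
  have D: "D i hat_one + R hat_one \<in> M"
    using assms by (auto intro!: Csum_M vs.subspace_add[OF subspace_segspace])
  have "X i (X i hat_one)
      = cscale (t i) (X i hat_one) + X i (C i (D i hat_one + R hat_one))"
    using arg_cong[OF X_one[OF assms], of "X i"] by (simp only: Xop_linear)
  also have "X i (C i (D i hat_one + R hat_one)) = - C i (D i (X i hat_one) + X i (R hat_one))"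
    unfolding X_C_same[OF D assms] using X_Csum[OF hat_one_segspace assms, of "{1..<i}"] by simp
  finally have "X i (X i hat_one)
      = cscale (t i) (X i hat_one) - C i (D i (X i hat_one) + X i (R hat_one))"
    by simp
  also have "\<dots> = cscale (t i * t i + t i) hat_one"
    using assms unfolding X_one[OF assms] X_R_one[OF assms]
    by (simp add: Csum_Cop Cop_square D_square vs.scale_left_distrib vs.scale_left_diff_distrib
        vs.scale_right_distrib)
  finally show ?thesis .
qed

lemma X_square:
  assumes "v \<in> M" "i \<in> {1..d}"
  shows "X i (X i v) = cscale (t i * t i + t i) v"
proof (rule M_eq[OF assms(1), where f = "\<lambda>v. X i (X i v)" and g = "cscale (t i * t i + t i)"])
  show "X i (X i hat_one) = cscale (t i * t i + t i) hat_one"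
    by (rule X_square_one[OF assms(2)])
  fix j v assume j: "j \<in> {1..d}" and v: "v \<in> M" and IH: "X i (X i v) = cscale (t i * t i + t i) v"
  show "X i (X i (C j v)) = cscale (t i * t i + t i) (C j v)"
    using IH v X_M[OF v assms(2)] assms(2) X_C_same[of _ i] X_C_other[of _ i j]
    by (cases "j = i") simp_all
qed (use assms(2) in \<open>auto simp: X_R X_M clin_comp[OF clin_Xop clin_Xop] vs.linear_scale_self\<close>)

text \<open>
  Both products expand into Clifford words in \<open>C i\<close>, \<open>C j\<close>, the sum \<open>D i\<close> below \<open>i\<close>, the sum \<open>E\<close> strictly
  between \<open>i\<close> and \<open>j\<close>, and \<open>R\<close>. The explicit value is kept because its vanishing in a special case is
  what makes \<open>x\<^sub>p\<^sub>+\<^sub>1\<close> act by zero on the generators of segments through zero.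
\<close>

lemma X_X_one:
  assumes ij: "i \<in> {1..d}" "j \<in> {1..d}" "i < j"
  defines "E \<equiv> Csum {i+1..<j}"
  shows "X j (X i hat_one) = cscale (t i * t j) hat_one + cscale (t j) (C i (D i hat_one + R hat_one))
     + cscale (t i) (C j (D i hat_one + C i hat_one + E hat_one + R hat_one))
     + C j (C i (- cscale (t i) hat_one + D i (C i hat_one + E hat_one)
          - (C i (R hat_one) + E (R hat_one))))"
    and "X i (X j hat_one) = X j (X i hat_one)"
proof -
  have "{1..<j} = {1..<i} \<union> insert i {i+1..<j}"
    using ij by auto
  then have Dj: "D j v = D i v + C i v + E v" for v
    by (simp add: E_def Csum_def sum.union_disjoint add.assoc ivl_disj_int)
  have E_C: "E (C i v) = - C i (E v)" "E (C j v) = - C j (E v)" for v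
    by (simp_all add: E_def Csum_Cop)
  have E_D: "E (D i v) = - D i (E v)" for v
    unfolding E_def by (rule Csum_disjoint) auto
  have D_C: "D i (C i v) = - C i (D i v)" "D i (C j v) = - C j (D i v)" for v
    using ij by (simp_all add: Csum_Cop)
  have C_C: "C i (C j v) = - C j (C i v)" for v
    using ij by (intro Cop_anticommute) simp
  have D_D: "D i (D i v) = cscale (of_int a - t i) v" for v
    using ij by (intro D_square) simp
  have E_lin: "E (u + v) = E u + E v" "E (u - v) = E u - E v" "E (- v) = - E v"
    "E (cscale z v) = cscale z (E v)" for u v z
    by (simp_all add: E_def)
  have DM: "D i hat_one + R hat_one \<in> M" "D j hat_one + R hat_one \<in> M"
    using ij by (auto intro!: Csum_M vs.subspace_add[OF subspace_segspace])
  note normalise = E_C E_D D_C C_C D_D E_lin Cop_square vs.scale_left_distrib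
    vs.scale_left_diff_distrib vs.scale_right_distrib vs.scale_right_diff_distrib
  have "X j (C i (D i hat_one + R hat_one)) = C i (D i (X j hat_one) + X j (R hat_one))"
    using ij X_C_other[OF DM(1) ij(2), of i] X_Csum[OF hat_one_segspace ij(2), of "{1..<i}"] by simp
  then have "X j (X i hat_one) = cscale (t i) (X j hat_one) + C i (D i (X j hat_one) + X j (R hat_one))"
    by (simp only: X_one[OF ij(1)] Xop_linear)
  then show ji: "X j (X i hat_one) = cscale (t i * t j) hat_one + cscale (t j) (C i (D i hat_one + R hat_one))
     + cscale (t i) (C j (D i hat_one + C i hat_one + E hat_one + R hat_one))
     + C j (C i (- cscale (t i) hat_one + D i (C i hat_one + E hat_one)
          - (C i (R hat_one) + E (R hat_one))))"
    unfolding X_one[OF ij(2)] X_R_one[OF ij(2)] Dj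
    by (simp add: normalise algebra_simps)
  have "X i (D j hat_one) = D j (X i hat_one) - C i (X i hat_one) - C i (X i hat_one)"
    using X_C_same[OF hat_one_segspace ij(1)] X_Csum[OF hat_one_segspace ij(1), of "{1..<i}"]
      X_Csum[OF hat_one_segspace ij(1), of "{i+1..<j}"]
    by (simp add: Dj E_def)
  then have "X i (C j (D j hat_one + R hat_one))
      = C j (D j (X i hat_one) - C i (X i hat_one) - C i (X i hat_one) + X i (R hat_one))"
    using ij X_C_other[OF DM(2) ij(1), of j] by simp
  then have ij': "X i (X j hat_one) = cscale (t j) (X i hat_one)
      + C j (D j (X i hat_one) - C i (X i hat_one) - C i (X i hat_one) + X i (R hat_one))"
    by (simp only: X_one[OF ij(2)] Xop_linear)
  show "X i (X j hat_one) = X j (X i hat_one)"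
    unfolding ji ij' unfolding X_one[OF ij(1)] X_R_one[OF ij(1)] Dj
    by (simp add: normalise algebra_simps)
qed


lemma X_X_one_zero:
  assumes "i \<in> {1..d}" "i + 1 \<in> {1..d}" "t i = - 1"
  shows "X (i + 1) (X i hat_one) = 0"
proof -
  have "t (i + 1) = 0"
    using assms(3) by (simp add: tval_def)
  then show ?thesis
    using X_X_one(1)[OF assms(1,2)] assms(3)
    by (simp add: Csum_Cop Cop_square Csum_def[of "{}"])
qed

lemma X_commute:
  assumes "v \<in> M" "i \<in> {1..d}" "j \<in> {1..d}"
  shows "X i (X j v) = X j (X i v)"
proof -
  have *: "X i (X j v) = X j (X i v)" if ij: "i \<in> {1..d}" "j \<in> {1..d}" "i < j" for i j
  proof (rule M_eq[OF assms(1), where f = "\<lambda>v. X i (X j v)" and g = "\<lambda>v. X j (X i v)"])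
    show "X i (X j hat_one) = X j (X i hat_one)"
      by (rule X_X_one(2)[OF ij])
    fix k v assume v: "v \<in> M" and IH: "X i (X j v) = X j (X i v)"
    note [simp] = X_C_same[OF v ij(1)] X_C_same[OF v ij(2)]
      X_C_same[OF X_M[OF v ij(1)] ij(2)] X_C_same[OF X_M[OF v ij(2)] ij(1)]
      X_C_other[OF v ij(1)] X_C_other[OF v ij(2)]
      X_C_other[OF X_M[OF v ij(1)] ij(2)] X_C_other[OF X_M[OF v ij(2)] ij(1)]
    consider "k = i" | "k = j" | "k \<noteq> i" "k \<noteq> j" by blast
    then show "X i (X j (C k v)) = X j (X i (C k v))"
      by cases (use ij(3) IH in simp_all)
  qed (use ij(1,2) in \<open>simp_all add: X_R X_M clin_comp[OF clin_Xop clin_Xop]\<close>)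
  show ?thesis
    using *[of i j] *[of j i] assms by (cases i j rule: linorder_cases) auto
qed

text \<open>Both sides of each cross relation obey the same rule for passing a Clifford generator, so it is
  enough to compare them on the cyclic vector.\<close>

lemma S_X:
  assumes "v \<in> M" "i \<in> {1..<d}"
  shows "S i (X i v) = X (i + 1) (S i v) - v + C i (C (i + 1) v)"
proof (rule M_eq[OF assms(1), where f = "\<lambda>v. S i (X i v)"
      and g = "\<lambda>v. X (i + 1) (S i v) - v + C i (C (i + 1) v)"])
  have i: "i \<in> {1..d}" and i': "i + 1 \<in> {1..d}" and "i \<noteq> i + 1"
    using assms(2) by auto
  show "clin (\<lambda>v. S i (X i v))"
    by (rule clinI) simp_all
  show "clin (\<lambda>v. X (i + 1) (S i v) - v + C i (C (i + 1) v))"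
    by (rule clinI) (simp_all add: algebra_simps vs.scale_right_distrib)
  note SC = S_C[OF _ assms(2)]
  have S_D: "S i (D i hat_one) = D i hat_one"
    unfolding Csum_def S_linear
    using assms(2) SC[OF hat_one_segspace] by (simp add: S_def transpose_def)
  have D: "D i hat_one \<in> M" "R hat_one \<in> M"
    using i by (auto intro!: Csum_M)
  have "{1..<i + 1} = insert i {1..<i}"
    using i by auto
  then have D': "D (i + 1) v = C i v + D i v" for v
    by (simp add: Csum_insert)
  have t: "t (i + 1) = t i + 1"
    by (simp add: tval_def)
  have S1: "S i hat_one = hat_one" "S i (R hat_one) = R hat_one"
    by (simp_all add: S_def)
  show "S i (X i hat_one) = X (i + 1) (S i hat_one) - hat_one + C i (C (i + 1) hat_one)"
    unfolding S1 X_one[OF i] X_one[OF i'] D' t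
    by (simp add: SC[OF D(1)] SC[OF D(2)] S_D S1 vs.scale_left_distrib Cop_anticommute[of i "i + 1"])
  fix v assume v: "v \<in> M" and IH: "S i (X i v) = X (i + 1) (S i v) - v + C i (C (i + 1) v)"
  have M: "X i v \<in> M" "S i v \<in> M" "C (i + 1) v \<in> M"
    using v i i' assms(2) by (auto intro: X_M S_M)
  show "S i (X i (R v)) = X (i + 1) (S i (R v)) - R v + C i (C (i + 1) (R v))"
    using IH by (simp add: X_R[OF v i] X_R[OF M(2) i'] S_R[OF v assms(2)] S_R[OF M(1) assms(2)]
        R_C[OF v] R_C[OF M(3)])
  fix j
  note [simp] = X_C_same[OF v i] X_C_other[OF v i] X_C_same[OF M(2) i'] X_C_other[OF M(2) i']
    SC[OF v] SC[OF M(1)]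
  have anti: "C i (C (i + 1) v) = - C (i + 1) (C i v)" for v
    by (intro Cop_anticommute) simp
  consider "j = i" | "j = i + 1" | "j \<noteq> i" "j \<noteq> i + 1" by blast
  then show "S i (X i (C j v)) = X (i + 1) (S i (C j v)) - C j v + C i (C (i + 1) (C j v))"
  proof cases
    case 3
    then have "C i (C (i + 1) (C j v)) = C j (C i (C (i + 1) v))"
      by (simp add: Cop_anticommute[of i j] Cop_anticommute[of "i + 1" j])
    then show ?thesis
      using 3 IH by simp
  qed (use IH in \<open>simp_all add: anti Cop_square\<close>)
qed

lemma S_X_other:
  assumes "v \<in> M" "i \<in> {1..<d}" "j \<in> {1..d}" "j \<noteq> i" "j \<noteq> i + 1"
  shows "S i (X j v) = X j (S i v)"
proof (rule M_eq[OF assms(1), where f = "\<lambda>v. S i (X j v)" and g = "\<lambda>v. X j (S i v)"])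
  note SC = S_C[OF _ assms(2)]
  show "clin (\<lambda>v. S i (X j v))" "clin (\<lambda>v. X j (S i v))"
    by (rule clinI; simp)+
  have S1: "S i hat_one = hat_one" "S i (R hat_one) = R hat_one"
    by (simp_all add: S_def)
  have maps: "transpose i (i + 1) ` {1..<j} = {1..<j}"
  proof -
    have "transpose i (i + 1) ` {1..<j} \<subseteq> {1..<j}"
      using assms(2-5) by (auto simp: transpose_def)
    then show ?thesis
      by (intro card_subset_eq) (auto simp: card_image inj_on_subset[OF inj_transpose])
  qed
  have "S i (D j hat_one) = (\<Sum>k\<in>{1..<j}. C (transpose i (i + 1) k) hat_one)"
    unfolding Csum_def S_def Pop_linear
    using SC[OF hat_one_segspace] by (simp add: S_def)
  also have "\<dots> = (\<Sum>k\<in>transpose i (i + 1) ` {1..<j}. C k hat_one)"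
    by (simp add: sum.reindex[OF inj_on_subset[OF inj_transpose]])
  finally have S_D: "S i (D j hat_one) = D j hat_one"
    by (simp only: maps Csum_def)
  have D: "D j hat_one \<in> M" "R hat_one \<in> M"
    using assms(3) by (auto intro!: Csum_M)
  show "S i (X j hat_one) = X j (S i hat_one)"
    using assms(4,5) unfolding S1 X_one[OF assms(3)]
    by (simp add: SC[OF D(1)] SC[OF D(2)] S_D S1)
  fix v assume v: "v \<in> M" and IH: "S i (X j v) = X j (S i v)"
  have M: "X j v \<in> M" "S i v \<in> M"
    using v assms by (auto intro: X_M S_M)
  show "S i (X j (R v)) = X j (S i (R v))"
    using IH by (simp add: X_R[OF v assms(3)] X_R[OF M(2) assms(3)] S_R[OF v assms(2)]
        S_R[OF M(1) assms(2)])
  fix k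
  have "transpose i (i + 1) k = j \<longleftrightarrow> k = j"
    using assms(4,5) by (auto simp: transpose_def)
  then show "S i (X j (C k v)) = X j (S i (C k v))"
    using IH assms(4,5) X_C_same[OF v assms(3)] X_C_other[OF v assms(3), of k]
      X_C_same[OF M(2) assms(3)] X_C_other[OF M(2) assms(3)]
    by (cases "k = j") (simp_all add: SC[OF v] SC[OF M(1)])
qed

text \<open>Applying twice the cross relation between \<open>S i\<close> and \<open>X i\<close> gives
  \<open>S i (X i)\<^sup>2 - (X (i + 1))\<^sup>2 S i\<close> in terms of Clifford generators and \<open>X\<close>'s alone. As the squares
  are scalars on the module, distinct scalars express \<open>S i\<close> through the other generators.\<close>

lemma S_in_CX_closed:
  assumes "v \<in> M" "i \<in> {1..<d}" "t i * t i + t i \<noteq> t (i + 1) * t (i + 1) + t (i + 1)"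
    and N: "vs.subspace N" "v \<in> N"
    and C_N: "\<And>u. u \<in> N \<Longrightarrow> C i u \<in> N" "\<And>u. u \<in> N \<Longrightarrow> C (i + 1) u \<in> N"
    and X_N: "\<And>u. u \<in> N \<Longrightarrow> X i u \<in> N" "\<And>u. u \<in> N \<Longrightarrow> X (i + 1) u \<in> N"
  shows "S i v \<in> N"
proof -
  have i: "i \<in> {1..d}" and i': "i + 1 \<in> {1..d}"
    using assms(2) by auto
  let ?q = "\<lambda>i. t i * t i + t i"
  let ?r = "X (i + 1) (- v + C i (C (i + 1) v)) - X i v + C i (C (i + 1) (X i v))"
  have "cscale (?q i) (S i v) = S i (X i (X i v))"
    using X_square[OF assms(1) i] by simp
  also have "\<dots> = X (i + 1) (S i (X i v)) - X i v + C i (C (i + 1) (X i v))"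
    using S_X[OF X_M[OF assms(1) i] assms(2)] .
  also have "\<dots> = X (i + 1) (X (i + 1) (S i v)) + ?r"
    by (simp add: S_X[OF assms(1,2)])
  also have "X (i + 1) (X (i + 1) (S i v)) = cscale (?q (i + 1)) (S i v)"
    using X_square[OF S_M[OF assms(1,2)] i'] .
  finally have "cscale (?q i - ?q (i + 1)) (S i v) = ?r"
    by (simp add: vs.scale_left_diff_distrib)
  moreover have "S i v = cscale (1 / (?q i - ?q (i + 1))) (cscale (?q i - ?q (i + 1)) (S i v))"
    using assms(3) by simp
  ultimately have "S i v = cscale (1 / (?q i - ?q (i + 1))) ?r"
    by simp
  moreover have "?r \<in> N"
    using N C_N X_N
    by (intro vs.subspace_add[OF N(1)] vs.subspace_diff[OF N(1)] C_N X_N vs.subspace_neg[OF N(1)])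
  ultimately show ?thesis
    using vs.subspace_scale[OF N(1)] by metis
qed

end

section \<open>The action of the algebra\<close>

lemma free_act_linext: "free_act G f v = linext (\<lambda>w. foldr G (letters w) v) f"
  by (simp add: free_act_def linext_def)

lemma free_act_single [simp]: "free_act G (Poly_Mapping.single w z) v = cscale z (foldr G (letters w) v)"
  by (cases "z = 0") (simp_all add: free_act_def)

lemma clin_free_act_left: "clin (\<lambda>f. free_act G f v)"
  unfolding free_act_linext by (rule clin_linext)

lemmas free_act_linear = vs2.linear_add[OF clin_free_act_left] vs2.linear_neg[OF clin_free_act_left]
  vs2.linear_diff[OF clin_free_act_left] vs2.linear_scale[OF clin_free_act_left]
  vs2.linear_0[OF clin_free_act_left]

lemma clin_foldr: "(\<And>g. clin (G g)) \<Longrightarrow> clin (foldr G gs)"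
  by (induction gs) (simp_all add: vs.linear_id Vector_Spaces.linear_compose)

lemma clin_free_act: "(\<And>g. clin (G g)) \<Longrightarrow> clin (free_act G f)"
  unfolding free_act_def
  by (intro vs2.linear_compose_sum vs2.linear_compose_scale_right ballI clin_foldr)

lemma cscale_mult: "cscale z (f :: hc_free) = Poly_Mapping.single 0 z * f"
  by (simp add: cscale_def mult_map_scale_conv_mult)

lemma cscale_mult_left: "cscale z (f :: hc_free) * g = cscale z (f * g)"
  by (simp add: cscale_mult mult.assoc)

lemma bvec_mult_cscale: "bvec u * cscale z (g :: hc_free) = cscale z (bvec u * g)"
  by (simp add: cscale_mult bvec_def mult_single flip: mult.assoc)

text \<open>
  The action is bilinear in the two factors, and on words multiplication is concatenation.
\<close>

lemma free_act_mult:
  assumes "\<And>g. clin (G g)"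
  shows "free_act G (f * g) v = free_act G f (free_act G g v)"
proof -
  have *: "free_act G (bvec u * g) v = free_act G (bvec u) (free_act G g v)" for u
  proof (rule clin_eqI[where f = "\<lambda>g. free_act G (bvec u * g) v"
        and g = "\<lambda>g. free_act G (bvec u) (free_act G g v)"])
    show "clin (\<lambda>g. free_act G (bvec u * g) v)"
      by (rule clinI) (simp_all add: free_act_linear algebra_simps bvec_mult_cscale)
    show "clin (\<lambda>g. free_act G (bvec u) (free_act G g v))"
      using clin_comp[OF clin_free_act[OF assms] clin_free_act_left] .
    show "free_act G (bvec u * bvec w) v = free_act G (bvec u) (free_act G (bvec w) v)" for w
      by (simp add: bvec_def mult_single plus_hc_word_def)
  qed
  show ?thesis
  proof (rule clin_eqI[where f = "\<lambda>f. free_act G (f * g) v" and g = "\<lambda>f. free_act G f (free_act G g v)"])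
    show "clin (\<lambda>f. free_act G (f * g) v)"
      by (rule clinI) (simp_all add: free_act_linear algebra_simps cscale_mult_left)
  qed (rule clin_free_act_left *)+
qed

lemma letters_zero [simp]: "letters 0 = []"
  by (simp add: zero_hc_word_def)

lemma free_act_one [simp]: "free_act G 1 v = v"
  using free_act_single[of G 0 1 v] by simp

lemma gen_op_Xg: "gen_op a (Xg i) = Xop a i"
proof
  fix v
  have "stensor False (cscale (of_int a)) (cl_eps i) v = cscale (of_int a) (Eop i v)"
  proof (rule clin_eqI[OF clin_stensor])
    show "stensor False (cscale (of_int a)) (cl_eps i) (bvec b) = cscale (of_int a) (Eop i (bvec b))" for b
      by (cases b) (simp add: Eop_def stensor_def vtensor_cscale)
  qed (rule vs2.linear_compose_scale_right[OF clin_Eop])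
  moreover have "stensor False id (\<lambda>n. cl_perm \<sigma> n - cl_op k (cl_op i (cl_perm \<sigma> n))) v
      = Pop \<sigma> v - Cop k (Cop i (Pop \<sigma> v))" for \<sigma> k
  proof (rule clin_eqI[OF clin_stensor])
    show "clin (\<lambda>v. Pop \<sigma> v - Cop k (Cop i (Pop \<sigma> v)))"
      by (rule clinI) (simp_all add: vs.scale_right_diff_distrib)
    have "Pop \<sigma> (vtensor (bvec e) n) - Cop k (Cop i (Pop \<sigma> (vtensor (bvec e) n)))
      = vtensor (bvec e) (cl_perm \<sigma> n - cl_op k (cl_op i (cl_perm \<sigma> n)))" for e n
      by (simp add: Pop_vtensor Cop_vtensor vs2.linear_diff[OF clin_vtensor])
    from this[of "fst b" "bvec (snd b)" for b]
    show "stensor False id (\<lambda>n. cl_perm \<sigma> n - cl_op k (cl_op i (cl_perm \<sigma> n))) (bvec b)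
        = Pop \<sigma> (bvec b) - Cop k (Cop i (Pop \<sigma> (bvec b)))" for b
      by (cases b) (simp add: stensor_def)
  qed
  moreover have "stensor True (phi_op a) (cl_op i) v = Lop a (Cop i v)"
  proof (rule clin_eqI[OF clin_stensor])
    show "stensor True (phi_op a) (cl_op i) (bvec b) = Lop a (Cop i (bvec b))" for b
      by (cases b) (simp add: stensor_def phi_op_def Cop_bvec cl_op_bvec Lop_bvec vtensor_cscale
          vs2.linear_scale[OF clin_vtensor])
  qed (rule clin_comp[OF clin_Lop clin_Cop])
  ultimately show "gen_op a (Xg i) v = Xop a i v"
    by (simp add: Xop_def)
qed

lemma clin_gen_op: "clin (gen_op a g)"
  by (cases g) (simp_all add: clin_stensor gen_op_Xg clin_Xop del: gen_op.simps(3))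

lemma hc_class_hom: "ring_hom_ring (free_ring (hc_gens d)) (hecke_clifford d) (hc_class d)"
proof -
  interpret ideal "hc_ideal d" "free_ring (hc_gens d)" by (rule ideal_hc_ideal)
  have "hc_class d = (+>\<^bsub>free_ring (hc_gens d)\<^esub>) (hc_ideal d)"
    by (rule ext) (simp add: hc_class_def)
  then show ?thesis
    using rcos_ring_hom_ring by (simp add: hecke_clifford_def)
qed

lemma carrier_hecke_clifford: "carrier (hecke_clifford d) = hc_class d ` free_carrier (hc_gens d)"
  by (auto simp: hecke_clifford_def FactRing_def A_RCOSETS_def' hc_class_def free_ring_def)

context
  fixes d :: nat and f g :: hc_free
  assumes f: "f \<in> free_carrier (hc_gens d)" and g: "g \<in> free_carrier (hc_gens d)"
begin

lemma hc_class_add: "hc_class d f \<oplus>\<^bsub>hecke_clifford d\<^esub> hc_class d g = hc_class d (f + g)"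
proof -
  interpret ring_hom_ring "free_ring (hc_gens d)" "hecke_clifford d" "hc_class d"
    by (rule hc_class_hom)
  show ?thesis using hom_add[of f g] f g by (simp add: free_ring_def)
qed

lemma hc_class_mult: "hc_class d f \<otimes>\<^bsub>hecke_clifford d\<^esub> hc_class d g = hc_class d (f * g)"
proof -
  interpret ring_hom_ring "free_ring (hc_gens d)" "hecke_clifford d" "hc_class d"
    by (rule hc_class_hom)
  show ?thesis using hom_mult[of f g] f g by (simp add: free_ring_def)
qed

end

lemma hc_class_one: "\<one>\<^bsub>hecke_clifford d\<^esub> = hc_class d 1"
proof -
  interpret ring_hom_ring "free_ring (hc_gens d)" "hecke_clifford d" "hc_class d"
    by (rule hc_class_hom)
  show ?thesis using hom_one by (simp add: free_ring_def)
qed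

lemma single_zero_free_carrier [simp]: "Poly_Mapping.single 0 z \<in> free_carrier G"
  by (simp add: free_carrier_def zero_hc_word_def)

lemma free_carrier_mono: "G \<subseteq> H \<Longrightarrow> free_carrier G \<subseteq> free_carrier H"
  by (auto simp: free_carrier_def)

text \<open>
  The operator that is 1 on even and -1 on odd vectors. A homogeneous vector is an eigenvector, and
  graded subspaces are the ones it preserves.
\<close>

definition parity_op :: "segvec \<Rightarrow> segvec" where
  "parity_op = linext (\<lambda>(e, S). if e \<noteq> odd (card S) then - bvec (e, S) else bvec (e, S))"

lemma clin_parity_op: "clin parity_op"
  unfolding parity_op_def by (rule clin_linext)

lemmas parity_op_linear [simp] = linear_simps[OF clin_parity_op]

lemma parity_op_bvec:
  "parity_op (bvec (e, S)) = cscale (if e \<noteq> odd (card S) then - 1 else 1) (bvec (e, S))"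
  by (simp add: parity_op_def)

lemma lookup_parity_op:
  "Poly_Mapping.lookup (parity_op v) (e, S) = (if e \<noteq> odd (card S) then - 1 else 1) * Poly_Mapping.lookup v (e, S)"
proof -
  have "parity_op v = (\<Sum>i\<in>Poly_Mapping.keys v. cscale (Poly_Mapping.lookup v i) (parity_op (bvec i)))"
    by (subst bvec_expansion[of v]) (simp only: parity_op_linear)
  then have "Poly_Mapping.lookup (parity_op v) (e, S)
    = (\<Sum>i\<in>Poly_Mapping.keys v. Poly_Mapping.lookup v i * Poly_Mapping.lookup (parity_op (bvec i)) (e, S))"
    by (simp add: lookup_sum)
  also have "\<dots> = (\<Sum>i\<in>Poly_Mapping.keys v. if (e, S) = i
      then (if e \<noteq> odd (card S) then - 1 else 1) * Poly_Mapping.lookup v (e, S) else 0)"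
    by (intro sum.cong refl) (auto simp: parity_op_bvec lookup_bvec split: if_splits)
  also have "\<dots> = (if e \<noteq> odd (card S) then - 1 else 1) * Poly_Mapping.lookup v (e, S)"
    by (simp add: sum.delta' in_keys_iff)
  finally show ?thesis .
qed

lemma parity_op_parity_op [simp]: "parity_op (parity_op v) = v"
  by (rule poly_mapping_eqI) (auto simp: lookup_parity_op)

lemma parity_op_one [simp]: "parity_op hat_one = hat_one"
  by (simp add: hat_one_bvec parity_op_bvec)

lemma parity_op_segspace: "v \<in> segspace a I \<Longrightarrow> parity_op v \<in> segspace a I"
  by (erule segspace_map[OF clin_parity_op, rotated])
    (auto simp: parity_op_bvec bvec_in_segspace intro!: segspace_closed_linear)

lemma parity_op_Cop:
  assumes "finite I" "v \<in> segspace a I"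
  shows "parity_op (Cop i v) = - Cop i (parity_op v)"
proof (rule clin_eq_on_span[where f = "\<lambda>v. parity_op (Cop i v)" and g = "\<lambda>v. - Cop i (parity_op v)"])
  show "v \<in> vs.span (bvec ` (phi_basis a \<times> Pow I))"
    using assms(2) by (simp add: segspace_def)
  fix b assume "b \<in> bvec ` (phi_basis a \<times> Pow I)"
  then obtain e S where b: "b = bvec (e, S)" and S: "finite S"
    using assms(1) finite_subset by blast
  have "even (card (toggle i S)) \<longleftrightarrow> odd (card S)"
    using S card_Suc_Diff1[of S i] by (auto simp: toggle_def card_insert_if)
  then show "parity_op (Cop i b) = - Cop i (parity_op b)"
    unfolding b by (auto simp: Cop_bvec parity_op_bvec)
qed (rule clinI; simp)+

lemma parity_op_Rop: "parity_op (Rop a v) = - Rop a (parity_op v)"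
proof -
  have *: "parity_op (Rop a (bvec b)) = - Rop a (parity_op (bvec b))" for b
    by (cases b) (auto simp: Rop_bvec Lop_bvec parity_op_bvec)
  show ?thesis
    by (rule clin_eqI[where f = "\<lambda>n. parity_op (Rop a n)" and g = "\<lambda>n. - Rop a (parity_op n)"])
      ((rule clinI; simp)+, rule *)
qed


declare gen_op.simps [simp del]

lemma parity_op_eq_iff:
  "parity_op v = (if p then - v else v) \<longleftrightarrow>
     (\<forall>(e, S)\<in>Poly_Mapping.keys v. (e \<noteq> odd (card S)) = p)"
proof
  assume eq: "parity_op v = (if p then - v else v)"
  show "\<forall>(e, S)\<in>Poly_Mapping.keys v. (e \<noteq> odd (card S)) = p"
  proof
    fix k assume k: "k \<in> Poly_Mapping.keys v"
    obtain e S where eS: "k = (e, S)" by (cases k)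
    with k have "Poly_Mapping.lookup v (e, S) \<noteq> 0" by (simp add: in_keys_iff)
    moreover have "Poly_Mapping.lookup (parity_op v) (e, S) = Poly_Mapping.lookup (if p then - v else v) (e, S)"
      by (simp only: eq)
    ultimately have "(e \<noteq> odd (card S)) = p"
      by (auto simp: lookup_parity_op split: if_splits)
    then show "case k of (e, S) \<Rightarrow> (e \<noteq> odd (card S)) = p"
      by (simp add: eS)
  qed
next
  assume keys: "\<forall>(e, S)\<in>Poly_Mapping.keys v. (e \<noteq> odd (card S)) = p"
  show "parity_op v = (if p then - v else v)"
  proof (rule poly_mapping_eqI)
    fix k :: "bool \<times> nat set"
    obtain e S where k: "k = (e, S)" by (cases k)
    show "Poly_Mapping.lookup (parity_op v) k = Poly_Mapping.lookup (if p then - v else v) k"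
    proof (cases "k \<in> Poly_Mapping.keys v")
      case True
      have "(e \<noteq> odd (card S)) = p"
        using bspec[OF keys True] unfolding k prod.case .
      then show ?thesis
        unfolding k lookup_parity_op by (cases p) simp_all
    qed (simp add: k lookup_parity_op in_keys_iff)
  qed
qed

context segment
begin

definition V :: "(bool \<times> nat set) supermod" where
  "V = hatPhi a (a + int d - 1)"

lemma grade_V: "grade V p = {v \<in> M. parity_op v = (if p then - v else v)}"
  unfolding parity_op_eq_iff
  by (auto simp: V_def hatPhi_def segspace_def span_bvec_iff subset_iff)

lemma gen_op_simps [simp]: "gen_op a (Cg i) = C i" "gen_op a (Xg i) = X i" "gen_op a (Sg i) = S i"
  by (simp_all add: gen_op.simps(1,2) gen_op_Xg Cop_def S_def Pop_def)

abbreviation "F \<equiv> free_carrier (hc_gens d)"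
abbreviation "act_free \<equiv> free_act (gen_op a)"

lemmas act_free_mult = free_act_mult[of "gen_op a", OF clin_gen_op]
lemmas act_free_linear = free_act_linear[where G = "gen_op a"]
  vs2.linear_add[OF clin_free_act[of "gen_op a", OF clin_gen_op]] vs2.linear_scale[OF clin_free_act[of "gen_op a", OF clin_gen_op]]
  vs2.linear_0[OF clin_free_act[of "gen_op a", OF clin_gen_op]]

lemma act_free_closed:
  assumes "f \<in> free_carrier G" "vs.subspace U" "v \<in> U"
    and "\<And>g u. g \<in> G \<Longrightarrow> u \<in> U \<Longrightarrow> gen_op a g u \<in> U"
  shows "act_free f v \<in> U"
  unfolding free_act_def
proof (intro vs.subspace_sum[OF assms(2)] vs.subspace_scale[OF assms(2)])
  have words: "set gs \<subseteq> G \<Longrightarrow> foldr (gen_op a) gs v \<in> U" for gs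
    by (induction gs) (use assms(3,4) in auto)
  fix w assume "w \<in> Poly_Mapping.keys f"
  with assms(1) show "foldr (gen_op a) (letters w) v \<in> U"
    by (intro words) (auto simp: free_carrier_def)
qed

text \<open>
  The submodules, described by the generators alone.
\<close>

definition H_closed :: "segvec set \<Rightarrow> bool" where
  "H_closed U \<longleftrightarrow> vs.subspace U \<and> U \<subseteq> M \<and> (\<forall>v\<in>U. \<forall>i\<in>{1..d}. C i v \<in> U \<and> X i v \<in> U)
     \<and> (\<forall>v\<in>U. \<forall>i\<in>{1..<d}. S i v \<in> U)"

lemma closed_gen_op: "H_closed U \<Longrightarrow> g \<in> hc_gens d \<Longrightarrow> u \<in> U \<Longrightarrow> gen_op a g u \<in> U"
  by (auto simp: H_closed_def hc_gens_def gen_op_simps)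

lemma closed_M: "H_closed M"
  by (auto simp: H_closed_def subspace_segspace X_M S_M)

lemma act_free_M: "f \<in> F \<Longrightarrow> v \<in> M \<Longrightarrow> act_free f v \<in> M"
  by (rule act_free_closed[OF _ subspace_segspace]) (use closed_gen_op[OF closed_M] in auto)

lemma act_gen [simp]:
  "act_free (fc i) v = C i v" "act_free (fx i) v = X i v" "act_free (fs i) v = S i v"
  by simp_all

lemma act_relator:
  assumes "r \<in> hc_relators d" "v \<in> M"
  shows "act_free r v = 0"
proof -
  note acts = act_free_linear(1,2,3) act_free_mult
  note v = assms(2)
  show ?thesis
    using assms(1) unfolding hc_relators_def
  proof (elim UnE, goal_cases)
    case 1
    then obtain i j where r: "r = fx i * fx j - fx j * fx i"
      and ij: "i \<in> {1..d}" "j \<in> {1..d}" by blast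
    show ?case unfolding r using X_commute[OF v ij] by (simp add: acts)
  next
    case 2
    then obtain i where r: "r = fs i * fs i - 1"
      and ij: "i \<in> {1..<d}" by blast
    show ?case unfolding r using S_square[OF v ij] by (simp add: acts)
  next
    case 3
    then obtain i where r: "r = fs i * fs (i+1) * fs i - fs (i+1) * fs i * fs (i+1)"
      and ij: "i \<in> {1..<d}" "i + 1 \<in> {1..<d}" by blast
    show ?case unfolding r using S_braid[OF v ij] by (simp add: acts)
  next
    case 4
    then obtain i j where r: "r = fs i * fs j - fs j * fs i"
      and ij: "i \<in> {1..<d}" "j \<in> {1..<d}" "i + 1 < j" by blast
    show ?case unfolding r using S_commute[OF v ij] by (simp add: acts)
  next
    case 5
    then obtain i where r: "r = fc i * fc i + 1"
      and ij: "i \<in> {1..d}" by blast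
    show ?case unfolding r using Cop_square[of i v] by (simp add: acts)
  next
    case 6
    then obtain i j where r: "r = fc i * fc j + fc j * fc i"
      and ij: "i \<noteq> j" by blast
    show ?case unfolding r using Cop_anticommute[OF ij, of v] by (simp add: acts)
  next
    case 7
    then obtain i where r: "r = fs i * fc i - fc (i+1) * fs i"
      and ij: "i \<in> {1..<d}" by blast
    show ?case unfolding r using S_C[OF v ij, of i] by (simp add: acts)
  next
    case 8
    then obtain i where r: "r = fs i * fc (i+1) - fc i * fs i"
      and ij: "i \<in> {1..<d}" by blast
    show ?case unfolding r using S_C[OF v ij, of "i + 1"] by (simp add: acts)
  next
    case 9
    then obtain i j where r: "r = fs i * fc j - fc j * fs i"
      and ij: "i \<in> {1..<d}" "j \<noteq> i" "j \<noteq> i + 1" by blast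
    show ?case unfolding r using S_C[OF v ij(1), of j] ij(2,3) by (simp add: acts)
  next
    case 10
    then obtain i where r: "r = fc i * fx i + fx i * fc i"
      and ij: "i \<in> {1..d}" by blast
    show ?case unfolding r using X_C_same[OF v ij] by (simp add: acts)
  next
    case 11
    then obtain i j where r: "r = fc j * fx i - fx i * fc j"
      and ij: "i \<in> {1..d}" "j \<noteq> i" by blast
    show ?case unfolding r using X_C_other[OF v ij] by (simp add: acts)
  next
    case 12
    then obtain i where r: "r = fs i * fx i - (fx (i+1) * fs i - 1 + fc i * fc (i+1))"
      and ij: "i \<in> {1..<d}" by blast
    show ?case unfolding r using S_X[OF v ij] by (simp add: acts)
  next
    case 13
    then obtain i j where r: "r = fs i * fx j - fx j * fs i"
      and ij: "i \<in> {1..<d}" "j \<in> {1..d}" "j \<noteq> i" "j \<noteq> i + 1" by blast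
    show ?case unfolding r using S_X_other[OF v ij] by (simp add: acts)
  qed
qed

text \<open>
  The elements of the free algebra that act by zero form an ideal which contains the relators.
\<close>

lemma act_ideal:
  assumes "f \<in> hc_ideal d" "v \<in> M"
  shows "f \<in> F" "act_free f v = 0"
proof -
  interpret free: ring "free_ring (hc_gens d)" by (rule ring_free_ring)
  let ?K = "{f \<in> F. \<forall>v\<in>M. act_free f v = 0}"
  have neg: "\<ominus>\<^bsub>free_ring (hc_gens d)\<^esub> f = - f" if "f \<in> F" for f
    using that free_carrier_uminus[OF that] by (intro free.minus_equality) (auto simp: free_ring_def)
  have "ideal ?K (free_ring (hc_gens d))"
  proof (rule idealI[OF ring_free_ring])
    show "subgroup ?K (add_monoid (free_ring (hc_gens d)))"
    proof (rule subgroup.intro)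
      show "inv\<^bsub>add_monoid (free_ring (hc_gens d))\<^esub> f \<in> ?K" if "f \<in> ?K" for f
        using that neg[of f] by (auto simp: a_inv_def free_carrier_uminus act_free_linear)
      show "\<one>\<^bsub>add_monoid (free_ring (hc_gens d))\<^esub> \<in> ?K"
        using single_zero_free_carrier[of 0] by (auto simp: act_free_linear free_ring_def)
    qed (auto simp: free_ring_def free_carrier_add act_free_linear)
  qed (auto simp: free_ring_def free_carrier_mult act_free_mult act_free_M act_free_linear)
  moreover have "hc_relators d \<subseteq> ?K"
    using hc_relators_subset[of d] by (auto simp: act_relator free_ring_def)
  ultimately have "hc_ideal d \<subseteq> ?K"
    unfolding hc_ideal_def by (rule free.genideal_minimal)
  then show "f \<in> F" "act_free f v = 0"
    using assms by auto
qed

text \<open>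
  As the ideal acts by zero, all representatives of a class act alike, so the value picked out in the
  definition of the action is well defined.
\<close>

lemma act_class:
  assumes "f \<in> F" "v \<in> M"
  shows "act V (hc_class d f) v = act_free f v"
proof -
  have "0 \<in> hc_ideal d"
    using additive_subgroup.zero_closed[OF ideal.axioms(1)[OF ideal_hc_ideal[of d]]]
    by (simp add: free_ring_def)
  then have "f \<in> hc_class d f"
    by (force simp: hc_class_def a_r_coset_def' free_ring_def)
  moreover have "act_free g v = act_free f v" if "g \<in> hc_class d f" for g
  proof -
    obtain h where "h \<in> hc_ideal d" "g = h + f"
      using \<open>g \<in> hc_class d f\<close> by (auto simp: hc_class_def a_r_coset_def' free_ring_def)
    then show ?thesis
      using act_ideal(2)[OF _ assms(2)] by (simp add: act_free_linear)
  qed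
  ultimately have "(\<lambda>g. act_free g v) ` hc_class d f = {act_free f v}"
    by blast
  then show ?thesis
    by (simp add: V_def hatPhi_def)
qed

end

section \<open>Submodules and the grading\<close>

context segment
begin

lemma gen_in_F: "i \<in> {1..d} \<Longrightarrow> fc i \<in> F" "i \<in> {1..d} \<Longrightarrow> fx i \<in> F"
  "i \<in> {1..<d} \<Longrightarrow> fs i \<in> F"
  by (auto simp: hc_gens_def)

lemma act_gens:
  assumes "v \<in> M"
  shows "i \<in> {1..d} \<Longrightarrow> act V (hc d i) v = C i v" "i \<in> {1..d} \<Longrightarrow> act V (hx d i) v = X i v"
    "i \<in> {1..<d} \<Longrightarrow> act V (hs d i) v = S i v" "act V (hscalar d z) v = cscale z v"
  using assms act_class[OF gen_in_F(1) assms] act_class[OF gen_in_F(2) assms]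
    act_class[OF gen_in_F(3) assms] act_class[OF single_zero_free_carrier assms, of z]
  by (simp_all add: hc_def hx_def hs_def hscalar_def)

lemma parity_S: "v \<in> M \<Longrightarrow> i \<in> {1..<d} \<Longrightarrow> parity_op (S i v) = S i (parity_op v)"
proof -
  assume v: "v \<in> M" and i: "i \<in> {1..<d}"
  show ?thesis
  proof (rule M_eq[OF v, where f = "\<lambda>v. parity_op (S i v)" and g = "\<lambda>v. S i (parity_op v)"])
    show "clin (\<lambda>v. parity_op (S i v))" "clin (\<lambda>v. S i (parity_op v))"
      by (rule clinI; simp)+
    show "parity_op (S i hat_one) = S i (parity_op hat_one)"
      by (simp add: S_def)
    fix j v assume v: "v \<in> M" and IH: "parity_op (S i v) = S i (parity_op v)"
    note P = parity_op_Cop[OF finite_atLeastAtMost, of _ a 1 d]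
    show "parity_op (S i (C j v)) = S i (parity_op (C j v))"
      using IH by (simp add: S_C[OF v i] P[OF v] P[OF S_M[OF v i]] S_C[OF parity_op_segspace[OF v] i])
    show "parity_op (S i (R v)) = S i (parity_op (R v))"
      using IH by (simp add: S_R[OF v i] parity_op_Rop S_R[OF parity_op_segspace[OF v] i])
  qed
qed

lemma parity_C: "v \<in> M \<Longrightarrow> parity_op (C i v) = - C i (parity_op v)"
  by (rule parity_op_Cop) auto

lemma parity_X: "v \<in> M \<Longrightarrow> i \<in> {1..d} \<Longrightarrow> parity_op (X i v) = X i (parity_op v)"
proof -
  assume v: "v \<in> M" and i: "i \<in> {1..d}"
  show ?thesis
  proof (rule M_eq[OF v, where f = "\<lambda>v. parity_op (X i v)" and g = "\<lambda>v. X i (parity_op v)"])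
    show "clin (\<lambda>v. parity_op (X i v))" "clin (\<lambda>v. X i (parity_op v))"
      by (rule clinI; simp)+
    have "D i hat_one \<in> M" "R hat_one \<in> M"
      using i by (auto intro!: Csum_M)
    moreover have "parity_op (D i hat_one) = - D i hat_one"
      by (simp add: Csum_def parity_C[OF hat_one_segspace] sum_negf)
    ultimately show "parity_op (X i hat_one) = X i (parity_op hat_one)"
      by (simp add: X_one[OF i] parity_C parity_op_Rop)
    fix j v assume v: "v \<in> M" and IH: "parity_op (X i v) = X i (parity_op v)"
    note pv = parity_op_segspace[OF v]
    show "parity_op (X i (C j v)) = X i (parity_op (C j v))"
      using IH by (cases "j = i") (simp_all add: X_C_same[OF v i] X_C_other[OF v i] parity_C[OF v]
        parity_C[OF X_M[OF v i]] X_C_same[OF pv i] X_C_other[OF pv i])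
    show "parity_op (X i (R v)) = X i (parity_op (R v))"
      using IH by (simp add: X_R[OF v i] parity_op_Rop X_R[OF pv i])
  qed
qed

text \<open>
  Of the generators only the \<open>c\<^sub>i\<close> anticommute with the parity operator.
\<close>

lemma parity_word:
  assumes "set gs \<subseteq> hc_gens d" "v \<in> M"
  shows "parity_op (foldr (gen_op a) gs v)
    = (if word_odd (Word gs) then - foldr (gen_op a) gs (parity_op v) else foldr (gen_op a) gs (parity_op v))"
  using assms(1)
proof (induction gs)
  case Nil
  then show ?case by (simp add: word_odd_def)
next
  case (Cons g gs)
  have M: "foldr (gen_op a) gs v \<in> M"
    using act_free_M[of "Poly_Mapping.single (Word gs) 1" v] Cons.prems assms(2)
    by (auto simp: free_carrier_def)
  have odd: "word_odd (Word (Cg i # gs)) = (\<not> word_odd (Word gs))"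
    "word_odd (Word (Xg i # gs)) = word_odd (Word gs)"
    "word_odd (Word (Sg i # gs)) = word_odd (Word gs)" for i
    by (simp_all add: word_odd_def)
  have IH: "parity_op (foldr (gen_op a) gs v)
    = (if word_odd (Word gs) then - foldr (gen_op a) gs (parity_op v) else foldr (gen_op a) gs (parity_op v))"
    using Cons by simp
  show ?case
    using Cons.prems
    by (cases g) (auto simp: odd IH parity_C[OF M] parity_X[OF M] parity_S[OF M] hc_gens_def)
qed

lemma act_homogeneous:
  assumes "h \<in> hc_part d p" "v \<in> grade V q"
  shows "act V h v \<in> grade V (p \<noteq> q)"
proof -
  from assms(1) obtain f where f: "f \<in> F" "\<forall>w\<in>Poly_Mapping.keys f. word_odd w = p" and h: "h = hc_class d f"
    by (auto simp: hc_part_def)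
  have v: "v \<in> M" and pv: "parity_op v = (if q then - v else v)"
    using assms(2) by (auto simp: grade_V)
  have word: "parity_op (foldr (gen_op a) (letters w) v)
      = (if p \<noteq> q then - foldr (gen_op a) (letters w) v else foldr (gen_op a) (letters w) v)"
    if w: "w \<in> Poly_Mapping.keys f" for w
  proof -
    have "set (letters w) \<subseteq> hc_gens d"
      using f(1) w by (auto simp: free_carrier_def)
    moreover have "foldr (gen_op a) (letters w) (- v) = - foldr (gen_op a) (letters w) v"
      using vs2.linear_neg[OF clin_foldr[of "gen_op a", OF clin_gen_op]] .
    ultimately show ?thesis
      using f(2) w pv parity_word[of "letters w" v] v by auto
  qed
  have "parity_op (act_free f v) = (if p \<noteq> q then - act_free f v else act_free f v)"
    by (simp add: free_act_def word sum_negf cong: sum.cong)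
  then show ?thesis
    using f v by (simp add: h act_class grade_V act_free_M)
qed

lemma even_odd_parts:
  fixes v :: segvec
  shows "v = cscale (1/2) (v + parity_op v) + cscale (1/2) (v - parity_op v)"
  by (simp add: vs.scale_right_distrib vs.scale_right_diff_distrib flip: vs.scale_left_distrib)

text \<open>The homogeneous parts of \<open>v\<close> are half the sum and half the difference of \<open>v\<close> and \<open>parity_op v\<close>.\<close>

lemma graded_parts:
  assumes "vs.subspace U" "U \<subseteq> M" "\<And>v. v \<in> U \<Longrightarrow> parity_op v \<in> U"
  shows "sumset (grade V False \<inter> U) (grade V True \<inter> U) = U"
proof (intro subset_antisym subsetI)
  fix v assume "v \<in> sumset (grade V False \<inter> U) (grade V True \<inter> U)"
  then show "v \<in> U"
    using vs.subspace_add[OF assms(1)] by (auto simp: sumset_def)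
next
  fix v assume v: "v \<in> U"
  let ?x = "cscale (1/2) (v + parity_op v)" and ?y = "cscale (1/2) (v - parity_op v)"
  have "?x \<in> U" "?y \<in> U"
    using v assms(3)
    by (auto intro!: vs.subspace_scale[OF assms(1)] vs.subspace_add[OF assms(1)] vs.subspace_diff[OF assms(1)])
  moreover have "parity_op ?x = ?x" "parity_op ?y = - ?y"
    by (simp_all add: algebra_simps)
  ultimately have "?x \<in> grade V False \<inter> U" "?y \<in> grade V True \<inter> U"
    using assms(2) by (auto simp: grade_V)
  then show "v \<in> sumset (grade V False \<inter> U) (grade V True \<inter> U)"
    unfolding sumset_def using even_odd_parts[of v] by blast
qed

lemma subspace_grade: "vs.subspace (grade V p)"
proof -
  have eq: "grade V p = M \<inter> {v. parity_op v - (if p then - v else v) = 0}"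
    by (auto simp: grade_V)
  have "clin (\<lambda>v. parity_op v - (if p then - v else v))"
    by (rule clinI) (simp_all add: algebra_simps)
  then show ?thesis
    unfolding eq by (intro vs.subspace_inter subspace_segspace vs2.linear_subspace_kernel)
qed

lemma grade_disjoint: "grade V False \<inter> grade V True \<subseteq> {0}"
proof
  fix v assume "v \<in> grade V False \<inter> grade V True"
  then have "v = - v" by (auto simp: grade_V)
  then have "Poly_Mapping.lookup v k = - Poly_Mapping.lookup v k" for k
    by (metis lookup_uminus)
  then have "v = 0" by (intro poly_mapping_eqI) (simp add: equation_minus_iff)
  then show "v \<in> {0}" by simp
qed

lemma direct_sum_grades:
  assumes "vs.subspace U" "U \<subseteq> M" "\<And>v. v \<in> U \<Longrightarrow> parity_op v \<in> U"
  shows "direct_sum_of U (grade V False \<inter> U) (grade V True \<inter> U)"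
  using graded_parts[OF assms] grade_disjoint vs.subspace_0[OF subspace_grade]
    vs.subspace_0[OF assms(1)]
  by (auto simp: direct_sum_of_def intro!: vs.subspace_inter subspace_grade assms(1))

lemma mspace_V: "mspace V = M"
proof -
  have "grade V p \<inter> M = grade V p" for p by (auto simp: grade_V)
  then show ?thesis
    using graded_parts[OF subspace_segspace order.refl parity_op_segspace] by (simp add: mspace_def)
qed

lemma module_closed:
  assumes "H_closed U"
  shows "hc_module d U (act V)"
proof -
  have U: "vs.subspace U" "U \<subseteq> M"
    using assms by (simp_all add: H_closed_def)
  have "act_free f v \<in> U" if "f \<in> F" "v \<in> U" for f v
    using that closed_gen_op[OF assms] by (intro act_free_closed[OF _ U(1)]) auto
  moreover have "act V (hc_class d f) v = act_free f v" if "f \<in> F" "v \<in> U" for f v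
    using that U(2) by (intro act_class) auto
  moreover have "act V (hscalar d z) v = cscale z v" if "v \<in> U" for v z
    using that U(2) act_gens(4) by auto
  ultimately show ?thesis
    unfolding hc_module_def carrier_hecke_clifford using U(1)
    by (auto simp: hc_class_add hc_class_mult free_carrier_add free_carrier_mult act_free_linear
        act_free_mult vs.subspace_add[OF U(1)])
qed

lemma submodule_iff:
  assumes "H_closed W"
  shows "hc_submodule d W (act V) U \<longleftrightarrow> H_closed U \<and> U \<subseteq> W"
proof
  assume "H_closed U \<and> U \<subseteq> W"
  then show "hc_submodule d W (act V) U"
    using module_closed[of U] module_closed[OF assms] by (auto simp: hc_submodule_def hc_module_def)
next
  assume U: "hc_submodule d W (act V) U"
  have "U \<subseteq> W" "W \<subseteq> M" "vs.subspace U"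
    using U assms by (auto simp: hc_submodule_def H_closed_def)
  moreover have "act_free f v \<in> U" if "f \<in> F" "v \<in> U" for f v
  proof -
    have "act V (hc_class d f) v \<in> U"
      using that U by (auto simp: hc_submodule_def carrier_hecke_clifford)
    then show ?thesis
      using that \<open>U \<subseteq> W\<close> \<open>W \<subseteq> M\<close> act_class[of f v] by auto
  qed
  from this[OF gen_in_F(1)] this[OF gen_in_F(2)] this[OF gen_in_F(3)]
  have "v \<in> U \<Longrightarrow> i \<in> {1..d} \<Longrightarrow> C i v \<in> U" "v \<in> U \<Longrightarrow> i \<in> {1..d} \<Longrightarrow> X i v \<in> U"
    "v \<in> U \<Longrightarrow> i \<in> {1..<d} \<Longrightarrow> S i v \<in> U" for i v
    by simp_all
  ultimately show "H_closed U \<and> U \<subseteq> W"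
    by (auto simp: H_closed_def)
qed

lemma mspace_restrict:
  assumes "H_closed U" "\<And>v. v \<in> U \<Longrightarrow> parity_op v \<in> U"
  shows "mspace (restrict_to V U) = U"
  using assms graded_parts[of U] by (simp add: mspace_def restrict_to_def H_closed_def)

lemma supermodule_restrict:
  assumes "H_closed U" "\<And>v. v \<in> U \<Longrightarrow> parity_op v \<in> U"
  shows "hc_supermodule d (restrict_to V U)"
proof -
  have mspace: "mspace (restrict_to V U) = U"
    by (rule mspace_restrict[OF assms])
  have "direct_sum_of U (grade (restrict_to V U) False) (grade (restrict_to V U) True)"
    using assms direct_sum_grades[of U] by (simp add: restrict_to_def H_closed_def)
  moreover have "hc_module d U (act (restrict_to V U))"
    using module_closed[OF assms(1)] by (simp add: restrict_to_def)
  moreover have "act (restrict_to V U) h v \<in> grade (restrict_to V U) (p \<noteq> q)"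
    if h: "h \<in> hc_part d p" and v: "v \<in> grade (restrict_to V U) q" for p q h v
  proof -
    have "h \<in> carrier (hecke_clifford d)"
      using h by (auto simp: hc_part_def carrier_hecke_clifford)
    then show ?thesis
      using v act_homogeneous[OF h, of v q] module_closed[OF assms(1)]
      by (auto simp: restrict_to_def hc_module_def)
  qed
  ultimately show ?thesis
    unfolding hc_supermodule_def mspace by blast
qed

lemma restrict_M: "restrict_to V M = V"
proof -
  have "(\<lambda>p. grade V p \<inter> M) = grade V" by (auto simp: grade_V)
  then show ?thesis by (simp add: restrict_to_def)
qed

lemma supermodule_V: "hc_supermodule d V"
  using supermodule_restrict[OF closed_M parity_op_segspace] by (simp add: restrict_M)

lemma subsupermodule_iff:
  "hc_subsupermodule d V U \<longleftrightarrow> H_closed U \<and> (\<forall>v\<in>U. parity_op v \<in> U)"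
proof
  assume U: "hc_subsupermodule d V U"
  have "H_closed U"
    using U submodule_iff[OF closed_M] by (simp add: hc_subsupermodule_def mspace_V)
  moreover have "parity_op v \<in> U" if v: "v \<in> U" for v
  proof -
    have "v \<in> sumset (U \<inter> grade V False) (U \<inter> grade V True)"
      using U v by (simp add: hc_subsupermodule_def)
    then obtain x y where "x \<in> U" "y \<in> U" "parity_op v = x - y"
      by (auto simp: sumset_def grade_V)
    then show ?thesis
      using vs.subspace_diff[of U] \<open>H_closed U\<close> by (simp add: H_closed_def)
  qed
  ultimately show "H_closed U \<and> (\<forall>v\<in>U. parity_op v \<in> U)" by blast
next
  assume U: "H_closed U \<and> (\<forall>v\<in>U. parity_op v \<in> U)"
  then show "hc_subsupermodule d V U"
    using graded_parts[of U] submodule_iff[OF closed_M, of U] supermodule_V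
    by (simp add: hc_subsupermodule_def mspace_V H_closed_def Int_commute)
qed

text \<open>
  Irreducibility without the grading implies simplicity with it, so only plain submodules matter.
\<close>

lemma simple_type_M_restrict:
  assumes U: "H_closed U" "\<And>v. v \<in> U \<Longrightarrow> parity_op v \<in> U" "U \<noteq> {0}"
    and simple: "\<And>U'. H_closed U' \<Longrightarrow> U' \<subseteq> U \<Longrightarrow> U' = {0} \<or> U' = U"
  shows "simple_type_M d (restrict_to V U)"
proof -
  have act: "act (restrict_to V U) = act V" by (simp add: restrict_to_def)
  have "hc_irreducible d U (act V)"
    using simple submodule_iff[OF U(1)] module_closed[OF U(1)] U(3) by (auto simp: hc_irreducible_def)
  then show ?thesis
    using supermodule_restrict[OF U(1,2)] U(3)
    by (auto simp: simple_type_M_def simple_supermodule_def hc_irreducible_def hc_subsupermodule_def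
        mspace_restrict[OF U(1,2)] act)
qed

lemma simple_type_Q_V:
  assumes graded: "\<And>U. H_closed U \<Longrightarrow> (\<And>v. v \<in> U \<Longrightarrow> parity_op v \<in> U) \<Longrightarrow> U = {0} \<or> U = M"
    and U: "H_closed U" "U \<noteq> {0}" "U \<noteq> M"
  shows "simple_type_Q d V"
proof -
  have "M \<noteq> {0}"
    using U vs.subspace_0[of U] by (auto simp: H_closed_def)
  then show ?thesis
    using graded subsupermodule_iff submodule_iff[OF closed_M, of U] U supermodule_V
    by (auto simp: simple_type_Q_def simple_supermodule_def hc_irreducible_def mspace_V H_closed_def)
qed

end

section \<open>Doubling an independent set\<close>

text \<open>
  The hypothesis says that \<open>f\<close> is injective on the span of \<open>B\<close> and that its image meets this span in 0.
\<close>

lemma independent_Un_image: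
  assumes "clin f" "finite B" "vs.independent B"
    and f: "\<And>u. u \<in> vs.span B \<Longrightarrow> f u \<in> vs.span B \<Longrightarrow> u = 0"
  shows "vs.independent (B \<union> f ` B)" "card (B \<union> f ` B) = 2 * card B"
proof -
  note lin = vs2.linear_diff[OF assms(1)]
  have "vs.independent (B \<union> f ` A)" if "A \<subseteq> B" for A
    using finite_subset[OF that assms(2)] that
  proof (induction A rule: finite_induct)
    case empty
    then show ?case using assms(3) by simp
  next
    case (insert b A)
    have "f b \<notin> vs.span (B \<union> f ` A)"
    proof
      assume "f b \<in> vs.span (B \<union> f ` A)"
      then obtain u u' where u: "u \<in> vs.span B" "u' \<in> vs.span A" and fb: "f b = u + f u'"
        by (auto simp: vs.span_Un vs2.linear_span_image[OF assms(1)])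
      have "A \<subseteq> B - {b}" using insert by auto
      then have "u' \<in> vs.span (B - {b})" using u(2) vs.span_mono by blast
      moreover from this have "b - u' \<in> vs.span B"
        using insert.prems vs.span_mono[of "B - {b}" B] by (intro vs.span_diff) (auto intro: vs.span_base)
      moreover have "f (b - u') = u" using fb by (simp add: lin)
      ultimately have "b \<in> vs.span (B - {b})" using f[of "b - u'"] u(1) by simp
      then show False using assms(3) insert.prems by (auto simp: vs.dependent_def)
    qed
    then show ?case
      using insert vs.independent_insertI[of "f b" "B \<union> f ` A"] by simp
  qed
  then show "vs.independent (B \<union> f ` B)" by simp
  have "inj_on f B"
  proof (rule inj_onI)
    fix x y assume xy: "x \<in> B" "y \<in> B" "f x = f y"
    then have "x - y = 0"
      by (intro f) (auto simp: lin vs.span_zero intro!: vs.span_diff intro: vs.span_base)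
    then show "x = y" by simp
  qed
  moreover have "B \<inter> f ` B = {}"
  proof -
    have "b = 0" if "b \<in> B" "f b \<in> B" for b
      using that by (intro f vs.span_base)
    moreover have "0 \<notin> B" using assms(3) vs.dependent_zero by blast
    ultimately show ?thesis by blast
  qed
  ultimately show "card (B \<union> f ` B) = 2 * card B"
    using assms(2) by (simp add: card_Un_disjoint card_image)
qed

context segment
begin

section \<open>Weight spaces\<close>

abbreviation "Cl \<equiv> clifford_span d V"

definition C_closed :: "nat set \<Rightarrow> segvec set \<Rightarrow> bool" where
  "C_closed J N \<longleftrightarrow> vs.subspace N \<and> (\<forall>i\<in>J. \<forall>v\<in>N. C i v \<in> N)"

definition weight_space :: "(nat \<Rightarrow> complex) \<Rightarrow> nat set \<Rightarrow> segvec set" where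
  "weight_space \<kappa> J = {v \<in> M. \<forall>j\<in>J. X j v = cscale (\<kappa> j) v}"

lemma subspace_weight_space: "vs.subspace (weight_space \<kappa> J)"
  by (rule vs.subspaceI)
    (auto simp: weight_space_def vs.scale_right_distrib mult.commute intro!: segspace_closed_linear)

text \<open>
  A vector is the difference of its images under \<open>x\<^sub>i + \<kappa>\<^sub>i\<close> and \<open>x\<^sub>i - \<kappa>\<^sub>i\<close> up to the factor \<open>2 \<kappa>\<^sub>i\<close>. The
  first image has eigenvalue \<open>\<kappa>\<^sub>i\<close>, and so has \<open>c\<^sub>i\<close> applied to the second. Hence the condition for
  one index after the other can be dropped from the weight space.
\<close>

lemma subset_if_weight_space_subset:
  assumes J: "J \<subseteq> {1..d}" "\<And>j. j \<in> J \<Longrightarrow> \<kappa> j \<noteq> 0 \<and> \<kappa> j * \<kappa> j = t j * t j + t j"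
    and N: "C_closed J N" "N \<subseteq> M" "\<And>i v. i \<in> J \<Longrightarrow> v \<in> N \<Longrightarrow> X i v \<in> N"
    and N': "C_closed J N'"
    and W: "N \<inter> weight_space \<kappa> J \<subseteq> N'"
  shows "N \<subseteq> N'"
proof -
  have sub: "vs.subspace N" "vs.subspace N'"
    using N(1) N' by (simp_all add: C_closed_def)
  have "N \<inter> weight_space \<kappa> (J - K) \<subseteq> N'" if "K \<subseteq> J" for K
    using finite_subset[OF that finite_subset[OF J(1) finite_atLeastAtMost]] that
  proof (induction K rule: finite_induct)
    case empty
    then show ?case using W by simp
  next
    case (insert i K)
    then have i: "i \<in> J" "i \<in> {1..d}" using J(1) by auto
    have IH: "N \<inter> weight_space \<kappa> (J - K) \<subseteq> N'" using insert by simp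
    show ?case
    proof
      fix v assume v: "v \<in> N \<inter> weight_space \<kappa> (J - insert i K)"
      then have vM: "v \<in> M" and vN: "v \<in> N" using N(2) by auto
      have v_weight: "X j v = cscale (\<kappa> j) v" if "j \<in> J - insert i K" for j
        using v that by (simp add: weight_space_def)
      let ?p = "X i v + cscale (\<kappa> i) v" and ?m = "X i v - cscale (\<kappa> i) v"
      have pm: "?p \<in> N" "C i ?m \<in> N"
        using N(1,3) i vN
        by (auto simp: C_closed_def intro!: vs.subspace_add[OF sub(1)] vs.subspace_diff[OF sub(1)]
            vs.subspace_scale[OF sub(1)] simp del: Cop_linear)
      have mM: "?m \<in> M" using X_M[OF vM i(2)] vM by auto
      have weights: "X j ?p = cscale (\<kappa> j) ?p" "X j (C i ?m) = cscale (\<kappa> j) (C i ?m)"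
        if j: "j \<in> J - K" for j
      proof -
        have jd: "j \<in> {1..d}" using j J(1) by auto
        have sq: "cscale (t i * t i + t i) v = cscale (\<kappa> i) (cscale (\<kappa> i) v)"
          using J(2)[OF i(1)] by simp
        consider "j = i" | "j \<noteq> i" "j \<in> J - insert i K" using j by auto
        then show "X j ?p = cscale (\<kappa> j) ?p" "X j (C i ?m) = cscale (\<kappa> j) (C i ?m)"
        proof (atomize (full), cases)
          case 1
          then show "X j ?p = cscale (\<kappa> j) ?p \<and> X j (C i ?m) = cscale (\<kappa> j) (C i ?m)"
            using X_C_same[OF mM i(2)]
            by (simp add: X_square[OF vM i(2)] sq vs.scale_right_distrib vs.scale_right_diff_distrib
                del: vs.scale_scale)
        next
          case 2
          have "X j (X i v) = cscale (\<kappa> j) (X i v)"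
            using X_commute[OF vM jd i(2)] v_weight[OF 2(2)] by simp
          then show "X j ?p = cscale (\<kappa> j) ?p \<and> X j (C i ?m) = cscale (\<kappa> j) (C i ?m)"
            using X_C_other[OF mM jd 2(1)[symmetric]] v_weight[OF 2(2)]
            by (simp add: vs.scale_right_distrib vs.scale_right_diff_distrib mult.commute)
        qed
      qed
      have "?p \<in> N'" "C i ?m \<in> N'"
        using IH pm N(2) weights by (auto simp: weight_space_def simp del: Cop_linear Xop_linear)
      then have "?p \<in> N'" "C i (C i ?m) \<in> N'"
        using N' i by (auto simp: C_closed_def simp del: Cop_linear)
      then have "?p + C i (C i ?m) \<in> N'"
        by (rule vs.subspace_add[OF sub(2)])
      moreover have "?p + C i (C i ?m) = cscale (\<kappa> i) v + cscale (\<kappa> i) v"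
        by (simp only: Cop_square) simp
      ultimately have "cscale (1 / (2 * \<kappa> i)) (cscale (\<kappa> i) v + cscale (\<kappa> i) v) \<in> N'"
        using vs.subspace_scale[OF sub(2)] by metis
      also have "cscale (1 / (2 * \<kappa> i)) (cscale (\<kappa> i) v + cscale (\<kappa> i) v) = v"
        using J(2)[OF i(1)] by (simp add: vs.scale_right_distrib flip: vs.scale_left_distrib)
      finally show "v \<in> N'" .
    qed
  qed
  from this[of J] show ?thesis
    using N(2) by (auto simp: weight_space_def)
qed

text \<open>
  For \<open>i\<close> in \<open>K\<close>, multiplication by \<open>c\<^sub>i\<close> maps the eigenspace of \<open>x\<^sub>i\<close> for \<open>\<kappa>\<^sub>i\<close> to the one for \<open>- \<kappa>\<^sub>i\<close>, so
  each new index doubles the independent set, adds nothing to the weight space, and adds only what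
  stability under \<open>c\<^sub>i\<close> forces.
\<close>

lemma clifford_extension_basis:
  assumes J: "J \<subseteq> {1..d}" "\<And>j. j \<in> J \<Longrightarrow> \<kappa> j \<noteq> 0"
    and B: "finite B" "vs.independent B" "B \<subseteq> weight_space \<kappa> J"
    and "K \<subseteq> J"
  shows "\<exists>B'. finite B' \<and> vs.independent B' \<and> card B' = 2 ^ card K * card B
    \<and> B \<subseteq> B' \<and> B' \<subseteq> weight_space \<kappa> (J - K) \<and> C_closed K (vs.span B')
    \<and> vs.span B' \<inter> weight_space \<kappa> J \<subseteq> vs.span B
    \<and> (\<forall>N. C_closed K N \<and> B \<subseteq> N \<longrightarrow> B' \<subseteq> N)"
  using finite_subset[OF assms(6) finite_subset[OF J(1) finite_atLeastAtMost]] assms(6)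
proof (induction K rule: finite_induct)
  case empty
  then show ?case using B by (intro exI[of _ B]) (auto simp: C_closed_def)
next
  case (insert i K)
  then have i: "i \<in> J - K" "i \<in> {1..d}" using J(1) by auto
  from insert obtain B' where B': "finite B'" "vs.independent B'" "card B' = 2 ^ card K * card B"
    "B \<subseteq> B'" "B' \<subseteq> weight_space \<kappa> (J - K)" "C_closed K (vs.span B')"
    "vs.span B' \<inter> weight_space \<kappa> J \<subseteq> vs.span B" "\<And>N. C_closed K N \<Longrightarrow> B \<subseteq> N \<Longrightarrow> B' \<subseteq> N"
    by (auto simp del: One_nat_def)
  have span_W: "vs.span B' \<subseteq> weight_space \<kappa> (J - K)"
    using B'(5) subspace_weight_space by (rule vs.span_minimal)
  have XC: "u \<in> M" "X i u = cscale (\<kappa> i) u" "X i (C i u) = - cscale (\<kappa> i) (C i u)"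
    if "u \<in> vs.span B'" for u
  proof -
    show "u \<in> M" "X i u = cscale (\<kappa> i) u"
      using that span_W i by (auto simp: weight_space_def)
    then show "X i (C i u) = - cscale (\<kappa> i) (C i u)"
      using X_C_same[OF _ i(2)] by simp
  qed
  have C_zero: "u = 0" if "C i u = 0" for u
    using Cop_square[of i u] that by simp
  have two: "x = 0" if "cscale (\<kappa> i) x = - cscale (\<kappa> i) x" for x :: segvec
  proof -
    have "cscale (\<kappa> i + \<kappa> i) x = 0" using that unfolding vs.scale_left_distrib eq_neg_iff_add_eq_0 .
    then show ?thesis using J(2)[of i] i(1) by simp
  qed
  have "u = 0" if "u \<in> vs.span B'" "C i u \<in> vs.span B'" for u
    using XC(3)[OF that(1)] XC(2)[OF that(2)] two C_zero by metis
  \<comment> \<open>An element common to both spans would have both eigenvalues of \<open>X i\<close>.\<close>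
  note ext = independent_Un_image[OF clin_Cop B'(1,2) this]
  let ?B = "B' \<union> C i ` B'"
  have span: "v \<in> vs.span ?B \<longleftrightarrow> (\<exists>x y. x \<in> vs.span B' \<and> y \<in> vs.span B' \<and> v = x + C i y)" for v
    by (auto simp: vs.span_Un vs2.linear_span_image[OF clin_Cop])
  show ?case
  proof (intro exI[of _ ?B] conjI allI impI)
    show "finite ?B" using B'(1) by simp
    show "vs.independent ?B" by (rule ext(1))
    show "card ?B = 2 ^ card (insert i K) * card B"
      using ext(2) B'(3) insert.hyps by simp
    show "B \<subseteq> ?B" using B'(4) by auto
    show "?B \<subseteq> weight_space \<kappa> (J - insert i K)"
    proof
      fix b assume "b \<in> ?B"
      then consider "b \<in> B'" | c where "c \<in> B'" "b = C i c" by auto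
      then show "b \<in> weight_space \<kappa> (J - insert i K)"
      proof cases
        case 1
        then show ?thesis using B'(5) by (auto simp: weight_space_def)
      next
        case 2
        then have c: "c \<in> M" "\<And>j. j \<in> J - K \<Longrightarrow> X j c = cscale (\<kappa> j) c"
          using B'(5) by (auto simp: weight_space_def)
        have "X j (C i c) = cscale (\<kappa> j) (C i c)" if j: "j \<in> J - insert i K" for j
        proof -
          have "j \<in> {1..d}" "i \<noteq> j" using j J(1) by auto
          then show ?thesis using X_C_other[OF c(1)] c(2)[of j] j by simp
        qed
        then show ?thesis
          using Cop_segspace[OF i(2) c(1)] by (simp add: weight_space_def 2)
      qed
    qed
    show "C_closed (insert i K) (vs.span ?B)"
      unfolding C_closed_def
    proof (intro conjI ballI)
      fix j v assume j: "j \<in> insert i K" and "v \<in> vs.span ?B"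
      then obtain x y where xy: "x \<in> vs.span B'" "y \<in> vs.span B'" "v = x + C i y"
        using span by blast
      show "C j v \<in> vs.span ?B"
      proof (cases "j = i")
        case True
        then have "C j v = - y + C i x" by (simp add: xy(3) Cop_square)
        then show ?thesis using span xy vs.span_neg by blast
      next
        case False
        then have "C j v = C j x + C i (- C j y)"
          by (simp add: xy(3) Cop_anticommute[of j i])
        moreover have "C j x \<in> vs.span B'" "- C j y \<in> vs.span B'"
          using j False xy B'(6) by (auto simp: C_closed_def intro: vs.span_neg)
        ultimately show ?thesis using span by blast
      qed
    qed simp
    show "vs.span ?B \<inter> weight_space \<kappa> J \<subseteq> vs.span B"
    proof
      fix v assume v: "v \<in> vs.span ?B \<inter> weight_space \<kappa> J"
      then obtain x y where xy: "x \<in> vs.span B'" "y \<in> vs.span B'" "v = x + C i y"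
        using span by blast
      have "X i v = cscale (\<kappa> i) v" using v i by (simp add: weight_space_def)
      then have "cscale (\<kappa> i) (C i y) = - cscale (\<kappa> i) (C i y)"
        using XC(2)[OF xy(1)] XC(3)[OF xy(2)] by (simp add: xy(3) vs.scale_right_distrib)
      then have "v = x" using two xy(3) by simp
      then show "v \<in> vs.span B" using v xy(1) B'(7) by auto
    qed
    fix N assume N: "C_closed (insert i K) N \<and> B \<subseteq> N"
    then have "B' \<subseteq> N" by (intro B'(8)) (auto simp: C_closed_def)
    then show "?B \<subseteq> N" using N by (auto simp: C_closed_def)
  qed
qed

text \<open>
  Otherwise an additional independent weight vector would extend to more independent vectors than the
  dimension of the module allows.
\<close>

lemma weight_space_spanned:
  assumes J: "J \<subseteq> {1..d}" "\<And>j. j \<in> J \<Longrightarrow> \<kappa> j \<noteq> 0"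
    and B: "finite B" "vs.independent B" "B \<subseteq> weight_space \<kappa> J"
    and card: "2 ^ card J * card B = card (phi_basis a) * 2 ^ d"
  shows "weight_space \<kappa> J \<subseteq> vs.span B"
proof (rule ccontr)
  assume "\<not> weight_space \<kappa> J \<subseteq> vs.span B"
  then obtain v where v: "v \<in> weight_space \<kappa> J" "v \<notin> vs.span B" by auto
  then have "v \<notin> B" using vs.span_base by blast
  have "vs.independent (insert v B)" using v(2) B(2) by (rule vs.independent_insertI)
  then have "\<exists>B'. finite B' \<and> vs.independent B' \<and> card B' = 2 ^ card J * card (insert v B)
    \<and> insert v B \<subseteq> B' \<and> B' \<subseteq> weight_space \<kappa> (J - J) \<and> C_closed J (vs.span B')
    \<and> vs.span B' \<inter> weight_space \<kappa> J \<subseteq> vs.span (insert v B)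
    \<and> (\<forall>N. C_closed J N \<and> insert v B \<subseteq> N \<longrightarrow> B' \<subseteq> N)"
    using J B v(1) by (intro clifford_extension_basis) auto
  then obtain B' where B': "vs.independent B'" "card B' = 2 ^ card J * card (insert v B)"
    "B' \<subseteq> weight_space \<kappa> (J - J)"
    by blast
  let ?E = "bvec ` (phi_basis a \<times> Pow {1..d})"
  have "B' \<subseteq> vs.span ?E"
    using B'(3) by (auto simp: weight_space_def segspace_def)
  moreover have fin: "finite (phi_basis a \<times> Pow {1..d})" by (simp add: phi_basis_def)
  ultimately have "card B' \<le> card ?E"
    using vs.independent_span_bound[OF _ B'(1)] by blast
  also have "\<dots> \<le> card (phi_basis a) * 2 ^ d"
    using card_image_le[OF fin, of bvec] by (simp add: card_cartesian_product card_Pow)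
  finally show False
    using B'(2) card B(1) \<open>v \<notin> B\<close> by (simp add: algebra_simps)
qed

lemma C_closed_contains_M:
  assumes J: "J \<subseteq> {1..d}" "\<And>j. j \<in> J \<Longrightarrow> \<kappa> j \<noteq> 0 \<and> \<kappa> j * \<kappa> j = t j * t j + t j"
    and N: "C_closed J N" "weight_space \<kappa> J \<subseteq> N"
  shows "M \<subseteq> N"
proof -
  have "C_closed J M" "\<And>i v. i \<in> J \<Longrightarrow> v \<in> M \<Longrightarrow> X i v \<in> M"
    using J(1) by (auto simp: C_closed_def subspace_segspace intro: X_M)
  then show ?thesis
    using subset_if_weight_space_subset[of J \<kappa> M N] J N by blast
qed

section \<open>Clifford spans\<close>

lemma clifford_span_eq:
  assumes "w \<in> M"
  shows "Cl w = (\<lambda>f. act_free f w) ` free_carrier (Cg ` {1..d})"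
proof -
  have "free_carrier (Cg ` {1..d}) \<subseteq> F"
    by (rule free_carrier_mono) (auto simp: hc_gens_def)
  then have "act V (hc_class d f) w = act_free f w" if "f \<in> free_carrier (Cg ` {1..d})" for f
    using that assms by (intro act_class) auto
  then show ?thesis
    by (simp add: clifford_span_def hc_clifford_def image_image)
qed

lemma clifford_span_minimal:
  assumes "w \<in> N" "w \<in> M" "C_closed {1..d} N"
  shows "Cl w \<subseteq> N"
  unfolding clifford_span_eq[OF assms(2)]
  using assms(1,3) by (auto simp: C_closed_def intro!: act_free_closed[of _ "Cg ` {1..d}"])

lemma clifford_span_M: "w \<in> M \<Longrightarrow> Cl w \<subseteq> M"
  by (rule clifford_span_minimal) (auto simp: C_closed_def subspace_segspace)

lemma clifford_span_self:
  assumes "w \<in> M"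
  shows "w \<in> Cl w"
  unfolding clifford_span_eq[OF assms] by (rule image_eqI[of _ _ 1]) simp_all

lemma clifford_span_C_closed:
  assumes "w \<in> M"
  shows "C_closed {1..d} (Cl w)"
  unfolding C_closed_def
proof (intro conjI ballI vs.subspaceI)
  note eq = clifford_span_eq[OF assms]
  show "0 \<in> Cl w"
    unfolding eq using single_zero_free_carrier[of 0] by (intro image_eqI[of _ _ 0]) (auto simp: act_free_linear)
  show "x + y \<in> Cl w" if "x \<in> Cl w" "y \<in> Cl w" for x y
    using that unfolding eq by (auto simp flip: act_free_linear intro!: free_carrier_add)
  show "cscale z x \<in> Cl w" if "x \<in> Cl w" for x z
    using that unfolding eq
    by (auto simp flip: act_free_linear(4) simp: cscale_mult intro!: free_carrier_mult)
  show "C i v \<in> Cl w" if i: "i \<in> {1..d}" and v: "v \<in> Cl w" for i v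
  proof -
    obtain f where f: "f \<in> free_carrier (Cg ` {1..d})" "v = act_free f w"
      using v unfolding eq by auto
    have "C i v = act_free (fc i * f) w" by (simp add: act_free_mult f(2))
    moreover have "fc i * f \<in> free_carrier (Cg ` {1..d})"
      using f(1) i by (intro free_carrier_mult) auto
    ultimately show ?thesis unfolding eq by auto
  qed
qed

lemma clifford_span_subspace: "w \<in> M \<Longrightarrow> vs.subspace (Cl w)"
  using clifford_span_C_closed by (simp add: C_closed_def)

text \<open>The vectors that \<open>f\<close> maps into \<open>N\<close> form a Clifford-stable subspace, so it suffices to look at the
  generating vector. The index may change on the way because permutations permute the generators.\<close>

lemma clifford_span_map:
  assumes w: "w \<in> M" and f: "clin f" "f w \<in> N" and N: "C_closed {1..d} N"
    and C: "\<And>i v. i \<in> {1..d} \<Longrightarrow> v \<in> M \<Longrightarrow> \<exists>j\<in>{1..d}. f (C i v) = C j (f v) \<or> f (C i v) = - C j (f v)"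
    and v: "v \<in> Cl w"
  shows "f v \<in> N"
proof -
  have sub: "vs.subspace N" using N by (simp add: C_closed_def)
  have "C_closed {1..d} {v \<in> M. f v \<in> N}"
    unfolding C_closed_def
  proof (intro conjI ballI)
    show "vs.subspace {v \<in> M. f v \<in> N}"
      using vs.subspace_inter[OF subspace_segspace vs2.linear_subspace_linear_preimage[OF f(1) sub]]
      by (simp add: Collect_conj_eq)
    fix i v assume i: "i \<in> {1..d}" and "v \<in> {v \<in> M. f v \<in> N}"
    then have v: "v \<in> M" "f v \<in> N" by auto
    obtain j where "j \<in> {1..d}" "f (C i v) = C j (f v) \<or> f (C i v) = - C j (f v)"
      using C[OF i v(1)] by blast
    then have "f (C i v) \<in> N"
      using N v(2) vs.subspace_neg[OF sub] by (auto simp: C_closed_def)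
    then show "C i v \<in> {v \<in> M. f v \<in> N}" using v(1) i by auto
  qed
  then show ?thesis
    using clifford_span_minimal[of w "{v \<in> M. f v \<in> N}"] w f(2) v by auto
qed

lemma clifford_span_X:
  assumes "w \<in> M" "j \<in> {1..d}" "X j w \<in> N" "C_closed {1..d} N" "v \<in> Cl w"
  shows "X j v \<in> N"
proof (rule clifford_span_map[OF assms(1) clin_Xop assms(3,4) _ assms(5)])
  fix i v assume "i \<in> {1..d}" "v \<in> M"
  then show "\<exists>k\<in>{1..d}. X j (C i v) = C k (X j v) \<or> X j (C i v) = - C k (X j v)"
    using X_C_same[of v j] X_C_other[of v j i] assms(2) by (cases "i = j") auto
qed

lemma clifford_span_S:
  assumes "w \<in> M" "j \<in> {1..<d}" "S j w \<in> N" "C_closed {1..d} N" "v \<in> Cl w"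
  shows "S j v \<in> N"
proof (rule clifford_span_map[OF assms(1) clin_S assms(3,4) _ assms(5)])
  fix i v assume i: "i \<in> {1..d}" and v: "v \<in> M"
  have "transpose j (j + 1) i \<in> {1..d}"
    using i assms(2) by (auto simp: transpose_def)
  then show "\<exists>k\<in>{1..d}. S j (C i v) = C k (S j v) \<or> S j (C i v) = - C k (S j v)"
    using S_C[OF v assms(2)] by blast
qed

lemma clifford_span_parity:
  assumes "w \<in> M" "parity_op w \<in> N" "C_closed {1..d} N" "v \<in> Cl w"
  shows "parity_op v \<in> N"
proof (rule clifford_span_map[OF assms(1) clin_parity_op assms(2,3) _ assms(4)])
  fix i v assume "i \<in> {1..d}" "v \<in> M"
  then show "\<exists>k\<in>{1..d}. parity_op (C i v) = C k (parity_op v) \<or> parity_op (C i v) = - C k (parity_op v)"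
    using parity_C[of v i] by auto
qed

text \<open>
  The Clifford span of a weight vector only returns to the weight space through the generators \<open>c\<^sub>k\<close>
  with \<open>k\<close> outside \<open>J\<close>; if these preserve the span of \<open>B\<close>, nothing else comes back.
\<close>

lemma clifford_span_weight:
  assumes J: "J \<subseteq> {1..d}" "\<And>j. j \<in> J \<Longrightarrow> \<kappa> j \<noteq> 0"
    and B: "finite B" "vs.independent B" "B \<subseteq> weight_space \<kappa> J"
    and C: "\<And>k b. k \<in> {1..d} - J \<Longrightarrow> b \<in> B \<Longrightarrow> C k b \<in> vs.span B"
    and w: "w \<in> vs.span B"
  shows "Cl w \<inter> weight_space \<kappa> J \<subseteq> vs.span B"
proof -
  obtain B' where B': "B \<subseteq> B'" "C_closed J (vs.span B')"
    "vs.span B' \<inter> weight_space \<kappa> J \<subseteq> vs.span B"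
    "\<forall>N. C_closed J N \<and> B \<subseteq> N \<longrightarrow> B' \<subseteq> N"
    using clifford_extension_basis[of J \<kappa> B J, OF J(1) _ B order.refl] J(2) by meson
  have BB': "vs.span B \<subseteq> vs.span B'" using B'(1) by (rule vs.span_mono)
  have "C_closed {1..d} (vs.span B')"
    unfolding C_closed_def
  proof (intro conjI ballI)
    fix k v assume k: "k \<in> {1..d}" and v: "v \<in> vs.span B'"
    show "C k v \<in> vs.span B'"
    proof (cases "k \<in> J")
      case True
      then show ?thesis using B'(2) v by (simp add: C_closed_def)
    next
      case False
      let ?N = "{v \<in> vs.span B'. C k v \<in> vs.span B'}"
      have sub: "vs.subspace ?N"
        using vs.subspace_inter[OF vs.subspace_span vs2.linear_subspace_linear_preimage[OF clin_Cop vs.subspace_span]]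
        by (simp add: Collect_conj_eq)
      have "C k (C j v) = - C j (C k v)" if "j \<in> J" for j v
        using False that by (intro Cop_anticommute) auto
      then have "C_closed J ?N"
        using sub B'(2) by (auto simp: C_closed_def intro: vs.span_neg)
      moreover have "B \<subseteq> ?N"
        using C[of k] k False BB' B'(1) by (auto intro: vs.span_base)
      ultimately have "vs.span B' \<subseteq> ?N"
        using B'(4) sub by (intro vs.span_minimal) auto
      then show ?thesis using v by auto
    qed
  qed simp
  moreover have "w \<in> M"
    using w vs.span_minimal[OF B(3) subspace_weight_space] by (auto simp: weight_space_def)
  ultimately have "Cl w \<subseteq> vs.span B'"
    using w BB' by (intro clifford_span_minimal) auto
  then show ?thesis using B'(3) by auto
qed

end

section \<open>Products of shifted polynomial generators\<close>

lemma segspace_mono: "I \<subseteq> J \<Longrightarrow> segspace a I \<subseteq> segspace a J"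
  unfolding segspace_def by (rule vs.span_mono) auto

lemma hat_one_nonzero: "hat_one \<noteq> 0"
proof
  assume "hat_one = 0"
  then have "Poly_Mapping.lookup hat_one (False, {}) = 0" by simp
  then show False by (simp add: hat_one_bvec lookup_bvec)
qed

context segment
begin

definition Xprod :: "(nat \<Rightarrow> complex) \<Rightarrow> nat list \<Rightarrow> segvec \<Rightarrow> segvec" where
  "Xprod \<kappa> L = foldr (\<lambda>i u. X i u + cscale (\<kappa> i) u) L"

lemma Xprod_simps [simp]: "Xprod \<kappa> [] v = v"
  "Xprod \<kappa> (i # L) v = X i (Xprod \<kappa> L v) + cscale (\<kappa> i) (Xprod \<kappa> L v)"
  by (simp_all add: Xprod_def)

lemma Xprod_append: "Xprod \<kappa> (K @ L) v = Xprod \<kappa> K (Xprod \<kappa> L v)"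
  by (simp add: Xprod_def)

lemma Xprod_M: "set L \<subseteq> {1..d} \<Longrightarrow> v \<in> M \<Longrightarrow> Xprod \<kappa> L v \<in> M"
  by (induction L) (auto intro!: X_M segspace_closed_linear)

lemma Xprod_X: "set L \<subseteq> {1..d} \<Longrightarrow> v \<in> M \<Longrightarrow> i \<in> {1..d} \<Longrightarrow> Xprod \<kappa> L (X i v) = X i (Xprod \<kappa> L v)"
  by (induction L) (simp_all add: Xprod_M X_commute[of _ i] del: atLeastAtMost_iff)

lemma Xprod_linear:
  "Xprod \<kappa> L (u + v) = Xprod \<kappa> L u + Xprod \<kappa> L v" "Xprod \<kappa> L (cscale z v) = cscale z (Xprod \<kappa> L v)"
  "Xprod \<kappa> L 0 = 0"
  by (induction L) (simp_all add: vs.scale_right_distrib mult.commute)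

lemma Xprod_commute:
  assumes "set K \<subseteq> {1..d}" "set L \<subseteq> {1..d}" "v \<in> M"
  shows "Xprod \<kappa> K (Xprod \<kappa> L v) = Xprod \<kappa> L (Xprod \<kappa> K v)"
  using assms(1)
  by (induction K) (use assms(2,3) in \<open>simp_all add: Xprod_linear Xprod_X Xprod_M del: atLeastAtMost_iff\<close>)

text \<open>
  The factor \<open>x\<^sub>i + \<kappa>\<^sub>i\<close> can be moved to the front, and \<open>(x\<^sub>i - \<kappa>\<^sub>i) (x\<^sub>i + \<kappa>\<^sub>i) = 0\<close>.
\<close>

lemma Xprod_weight:
  assumes "set L \<subseteq> {1..d}" "v \<in> M" "i \<in> set L" "\<kappa> i * \<kappa> i = t i * t i + t i"
  shows "X i (Xprod \<kappa> L v) = cscale (\<kappa> i) (Xprod \<kappa> L v)"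
  using assms(1,3)
proof (induction L)
  case (Cons j L)
  let ?u = "Xprod \<kappa> L v"
  have u: "?u \<in> M" using Cons.prems assms(2) by (intro Xprod_M) auto
  have i: "i \<in> {1..d}" and j: "j \<in> {1..d}" using Cons.prems by auto
  show ?case
  proof (cases "j = i")
    case True
    have "X i (X i ?u) = cscale (\<kappa> i) (cscale (\<kappa> i) ?u)"
      using X_square[OF u i] assms(4) by simp
    then show ?thesis
      by (simp add: True vs.scale_right_distrib del: vs.scale_scale)
  next
    case False
    then have "X i ?u = cscale (\<kappa> i) ?u" using Cons by auto
    then show ?thesis
      by (simp add: X_commute[OF u i j] vs.scale_right_distrib mult.commute)
  qed
qed simp

lemma Xprod_parity: "set L \<subseteq> {1..d} \<Longrightarrow> v \<in> M \<Longrightarrow> parity_op (Xprod \<kappa> L v) = Xprod \<kappa> L (parity_op v)"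
  by (induction L) (auto simp: Xprod_M parity_X)

lemma Xprod_C:
  "set L \<subseteq> {1..d} \<Longrightarrow> v \<in> M \<Longrightarrow> k \<in> {1..d} \<Longrightarrow> k \<notin> set L \<Longrightarrow> Xprod \<kappa> L (C k v) = C k (Xprod \<kappa> L v)"
  by (induction L) (auto simp: Xprod_M X_C_other)

text \<open>
  Only the indices up to \<open>i\<close> occur in \<open>X i\<close>, so \<open>X_M\<close> applies with \<open>i\<close> in the place of \<open>d\<close>.
\<close>

lemma X_segspace_smaller:
  assumes "u \<in> segspace a {1..<i}" "i \<in> {1..d}"
  shows "X i u \<in> segspace a {1..i}"
proof -
  have "segspace a {1..<i} \<subseteq> segspace a {1..i}"
    by (rule segspace_mono) auto
  then show ?thesis
    using segment.X_M[of u a i i] assms by auto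
qed

text \<open>On vectors that do not involve the \<open>i\<close>-th Clifford generator, the part of \<open>X i\<close> that does not
  involve this generator either is multiplication by \<open>t i\<close>; \<open>Eop i\<close> separates the two parts.\<close>

lemma X_Eop:
  assumes "u \<in> segspace a {1..<i}" "i \<in> {1..d}"
  shows "X i u + Eop i (X i u) = cscale (2 * t i) u" "Eop i u = u"
proof -
  have "segspace a {1..<i} \<subseteq> M"
    by (rule segspace_mono) (use assms(2) in auto)
  then have sub: "v \<in> M" if "v \<in> segspace a {1..<i}" for v using that by auto
  note eq = segspace_eq[OF assms(1) finite_atLeastLessThan]
  show "Eop i u = u"
  proof (rule eq[where f = "Eop i" and g = "\<lambda>u. u"])
    show "Eop i (C j v) = C j v" if "j \<in> {1..<i}" "Eop i v = v" for j v
      using that by (simp add: Eop_Cop_other)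
  qed (simp_all add: clin_Eop vs.linear_ident Eop_Rop)
  show "X i u + Eop i (X i u) = cscale (2 * t i) u"
  proof (rule eq[where f = "\<lambda>u. X i u + Eop i (X i u)" and g = "cscale (2 * t i)"])
    show "clin (\<lambda>u. X i u + Eop i (X i u))"
      by (rule clinI) (simp_all add: vs.scale_right_distrib)
    have D: "Eop i (D i hat_one) = D i hat_one"
      unfolding Csum_def Eop_linear by (rule sum.cong) (simp_all add: Eop_Cop_other)
    have "X i hat_one + Eop i (X i hat_one) = cscale (t i) hat_one + cscale (t i) hat_one"
      by (simp add: X_one[OF assms(2)] Eop_Cop_same D Eop_Rop)
    then show "X i hat_one + Eop i (X i hat_one) = cscale (2 * t i) hat_one"
      by (simp only: mult_2 vs.scale_left_distrib)
    show "X i (C j v) + Eop i (X i (C j v)) = cscale (2 * t i) (C j v)"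
      if "j \<in> {1..<i}" "v \<in> segspace a {1..<i}" "X i v + Eop i (X i v) = cscale (2 * t i) v" for j v
      using that(1) arg_cong[OF that(3), of "C j"] X_C_other[OF sub[OF that(2)] assms(2)]
      by (simp add: Eop_Cop_other)
    show "X i (R v) + Eop i (X i (R v)) = cscale (2 * t i) (R v)"
      if "v \<in> segspace a {1..<i}" "X i v + Eop i (X i v) = cscale (2 * t i) v" for v
      using arg_cong[OF that(2), of R] X_R[OF sub[OF that(1)] assms(2)]
      by (simp add: Eop_Rop)
  qed (rule vs.linear_scale_self)
qed

text \<open>
  Adding the image under \<open>Eop i\<close> doubles the part free of the generator \<open>i\<close> and removes the rest; what is left
  of \<open>X i u + z u\<close> is \<open>2 (t i + z) u\<close>.
\<close>

lemma shift_nonzero: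
  assumes "u \<in> segspace a {1..<i}" "i \<in> {1..d}" "u \<noteq> 0" "t i + z \<noteq> 0"
  shows "X i u + cscale z u \<noteq> 0"
proof
  assume eq: "X i u + cscale z u = 0"
  have "cscale (2 * (t i + z)) u = (X i u + Eop i (X i u)) + (cscale z u + cscale z (Eop i u))"
    unfolding X_Eop[OF assms(1,2)] by (simp only: mult_2 vs.scale_left_distrib ac_simps)
  also have "\<dots> = (X i u + cscale z u) + Eop i (X i u + cscale z u)"
    by (simp only: Eop_linear ac_simps)
  finally have "cscale (2 * (t i + z)) u = 0"
    by (simp only: eq Eop_linear add_0_right)
  moreover have "cscale (2 * (t i + z)) u \<noteq> 0"
    using assms(3,4) by (simp only: vs.scale_eq_0_iff mult_eq_0_iff) simp
  ultimately show False by contradiction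
qed

text \<open>
  The factors commute, so the one with the largest index may be applied last; at that moment the
  vector does not involve the corresponding Clifford generator.
\<close>

lemma Xprod_nonzero:
  assumes "v \<in> segspace a {1..m}" "v \<noteq> 0" "m \<le> n" "n \<le> d"
    and "\<And>j. m < j \<Longrightarrow> j \<le> n \<Longrightarrow> t j + \<kappa> j \<noteq> 0"
  shows "Xprod \<kappa> [m + 1..<n + 1] v \<noteq> 0 \<and> Xprod \<kappa> [m + 1..<n + 1] v \<in> segspace a {1..n}"
  using assms(3,4,5)
proof (induction n rule: dec_induct)
  case base
  then show ?case using assms(1,2) by simp
next
  case (step n)
  let ?u = "Xprod \<kappa> [m + 1..<n + 1] v" and ?i = "n + 1"
  have IH: "?u \<noteq> 0" "?u \<in> segspace a {1..<?i}"
    using step by (auto simp flip: Suc_eq_plus1 simp: atLeastLessThanSuc_atLeastAtMost)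
  have i: "?i \<in> {1..d}" using step.prems by auto
  have "segspace a {1..m} \<subseteq> M"
    using step by (intro segspace_mono) auto
  then have v: "v \<in> M" using assms(1) by blast
  have "[m + 1..<?i + 1] = [m + 1..<?i] @ [?i]"
    using upt_Suc_append[of "m + 1" ?i] step.hyps(1) unfolding Suc_eq_plus1 by auto
  then have "Xprod \<kappa> [m + 1..<?i + 1] v = Xprod \<kappa> [m + 1..<n + 1] (Xprod \<kappa> [?i] v)"
    by (simp only: Xprod_append)
  also have "\<dots> = X ?i ?u + cscale (\<kappa> ?i) ?u"
    using step.prems v i by (subst Xprod_commute) auto
  finally have eq: "Xprod \<kappa> [m + 1..<?i + 1] v = X ?i ?u + cscale (\<kappa> ?i) ?u" .
  have "segspace a {1..<?i} \<subseteq> segspace a {1..?i}"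
    by (rule segspace_mono) auto
  then have "X ?i ?u + cscale (\<kappa> ?i) ?u \<in> segspace a {1..?i}"
    using X_segspace_smaller[OF IH(2) i] IH(2) by blast
  moreover have "X ?i ?u + cscale (\<kappa> ?i) ?u \<noteq> 0"
    using step by (intro shift_nonzero IH i) auto
  ultimately show ?case
    unfolding Suc_eq_plus1 eq by blast
qed

text \<open>
  Among the \<open>S i\<close> only the one with \<open>t i = - 1\<close> is not expressible through the other generators.
\<close>

lemma H_closedI:
  assumes "C_closed {1..d} U" "\<And>i v. i \<in> {1..d} \<Longrightarrow> v \<in> U \<Longrightarrow> X i v \<in> U" "U \<subseteq> M"
    and "\<And>i v. i \<in> {1..<d} \<Longrightarrow> t i = - 1 \<Longrightarrow> v \<in> U \<Longrightarrow> S i v \<in> U"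
  shows "H_closed U"
proof -
  have "S i v \<in> U" if i: "i \<in> {1..<d}" and v: "v \<in> U" for i v
  proof (cases "t i = - 1")
    case False
    have "t (i + 1) = t i + 1" by (simp add: tval_def)
    then have "t (i + 1) * t (i + 1) + t (i + 1) - (t i * t i + t i) = 2 * (t i + 1)"
      by (simp add: algebra_simps)
    moreover have "2 * (t i + 1) \<noteq> 0"
      using False unfolding mult_eq_0_iff by (simp add: add_eq_0_iff2)
    ultimately have "t i * t i + t i \<noteq> t (i + 1) * t (i + 1) + t (i + 1)"
      by (metis diff_self)
    then show ?thesis
      using assms i v by (intro S_in_CX_closed[where N = U]) (auto simp: C_closed_def)
  qed (use assms i v in blast)
  then show ?thesis
    using assms by (auto simp: H_closed_def C_closed_def)
qed

lemma closed_C_closed: "H_closed U \<Longrightarrow> J \<subseteq> {1..d} \<Longrightarrow> C_closed J U"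
  by (auto simp: H_closed_def C_closed_def)

lemma C_closed_Int: "C_closed J U \<Longrightarrow> C_closed J U' \<Longrightarrow> C_closed J (U \<inter> U')"
  by (auto simp: C_closed_def vs.subspace_inter)

lemma C_closed_zero: "C_closed J {0}"
  by (simp add: C_closed_def)

lemma C_closed_sumset: "C_closed J U \<Longrightarrow> C_closed J U' \<Longrightarrow> C_closed J (sumset U U')"
  unfolding C_closed_def sumset_def using vs.subspace_sums[of U U'] by fastforce

lemma even_odd_zero: "parity_op v = v \<Longrightarrow> parity_op v = - v \<Longrightarrow> v = 0"
proof -
  assume "parity_op v = v" "parity_op v = - v"
  then have "v = - v" by simp
  then have "v + v = 0" by (simp only: eq_neg_iff_add_eq_0)
  then have "cscale 2 v = 0" using vs.scale_left_distrib[of 1 1 v] by simp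
  then show "v = 0" by simp
qed

lemma even_span: "(\<And>b. b \<in> B \<Longrightarrow> parity_op b = b) \<Longrightarrow> v \<in> vs.span B \<Longrightarrow> parity_op v = v"
  by (rule clin_eq_on_span[OF clin_parity_op vs.linear_ident])

text \<open>
  Multiplication by \<open>C k\<close> makes even vectors odd, so the span of the image meets that of \<open>B\<close> in 0.
\<close>

lemma independent_Un_C:
  assumes "finite B" "vs.independent B" "B \<subseteq> M" "\<And>b. b \<in> B \<Longrightarrow> parity_op b = b"
  shows "vs.independent (B \<union> C k ` B)" "card (B \<union> C k ` B) = 2 * card B"
proof -
  have "u = 0" if u: "u \<in> vs.span B" "C k u \<in> vs.span B" for u
  proof -
    have "u \<in> M" using vs.span_minimal[OF assms(3) subspace_segspace] u(1) by blast
    then have "parity_op (C k u) = - C k u"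
      using even_span[OF assms(4) u(1)] parity_C[of u k] by simp
    moreover have "parity_op (C k u) = C k u" by (rule even_span[OF assms(4) u(2)])
    ultimately have "C k u = 0" by (intro even_odd_zero)
    then show ?thesis using Cop_square[of k u] by simp
  qed
  note * = independent_Un_image[where f = "C k", OF clin_Cop assms(1,2) this]
  show "vs.independent (B \<union> C k ` B)" by (rule *(1))
  show "card (B \<union> C k ` B) = 2 * card B" by (rule *(2))
qed

text \<open>
  If \<open>\<kappa>\<^sub>j = - t\<^sub>j\<close>, then comparing squares gives \<open>t\<^sub>j = 0\<close>; and \<open>t\<^sup>2 + t\<close> has the roots 0 and -1 only.
\<close>

lemma root_of_q_nonzero:
  assumes "\<kappa> j * \<kappa> j = t j * t j + t j"
  shows "t j \<noteq> 0 \<Longrightarrow> t j + \<kappa> j \<noteq> 0" "t j \<noteq> 0 \<Longrightarrow> t j \<noteq> - 1 \<Longrightarrow> \<kappa> j \<noteq> 0"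
proof -
  show "t j + \<kappa> j \<noteq> 0" if "t j \<noteq> 0"
  proof
    assume "t j + \<kappa> j = 0"
    then have "\<kappa> j = - t j" by (simp add: add_eq_0_iff)
    then show False using assms that by simp
  qed
  have "t j * t j + t j = t j * (t j + 1)" by (simp add: distrib_left)
  then show "\<kappa> j \<noteq> 0" if "t j \<noteq> 0" "t j \<noteq> - 1"
    using assms that by (auto simp: add_eq_0_iff2)
qed

text \<open>Otherwise \<open>subset_if_weight_space_subset\<close> would confine \<open>N\<close> to 0.\<close>

lemma weight_vector_exists:
  assumes J: "J \<subseteq> {1..d}" "\<And>j. j \<in> J \<Longrightarrow> \<kappa> j \<noteq> 0 \<and> \<kappa> j * \<kappa> j = t j * t j + t j"
    and N: "C_closed J N" "N \<subseteq> M" "\<And>i v. i \<in> J \<Longrightarrow> v \<in> N \<Longrightarrow> X i v \<in> N" "N \<noteq> {0}"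
  obtains v where "v \<in> N" "v \<in> weight_space \<kappa> J" "v \<noteq> 0"
proof -
  have "0 \<in> N" using N(1) by (simp add: C_closed_def vs.subspace_0)
  then have "\<not> N \<subseteq> {0}" using N(4) by auto
  then have "\<not> N \<inter> weight_space \<kappa> J \<subseteq> {0}"
    using subset_if_weight_space_subset[of J \<kappa> N "{0}"] J N(1-3) C_closed_zero by blast
  then show ?thesis using that by auto
qed

end

section \<open>Segments starting at zero\<close>

context segment
begin

lemma X_first_zero:
  assumes "a = 0" "v \<in> M" "1 \<le> d"
  shows "X 1 v = 0"
proof (rule M_eq[OF assms(2), where f = "X 1" and g = "\<lambda>v. 0"])
  have d: "1 \<in> {1..d}" using assms(3) by simp
  have "Rop a hat_one = 0"
    by (simp add: assms(1) hat_one_bvec Rop_bvec Lop_bvec)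
  moreover have "t 1 = 0"
    by (simp add: tval_def assms(1))
  ultimately show "X 1 hat_one = 0"
    by (simp add: X_one[OF d] Csum_def)
  show "X 1 (C j v) = 0" if "v \<in> M" "X 1 v = 0" for j v
    using X_C_same[OF that(1) d] X_C_other[OF that(1) d, of j] that(2) by (cases "j = 1") auto
  show "X 1 (R v) = 0" if "v \<in> M" "X 1 v = 0" for v
    using X_R[OF that(1) d] that(2) by simp
qed (simp_all add: clin_Xop vs2.linear_zero)

text \<open>
  The weight space is spanned by the even \<open>w\<close> and the odd \<open>C 1 w\<close>. The line of \<open>u = w + \<i> C 1 w\<close> is stable under
  \<open>C 1\<close>, so the Clifford span of \<open>u\<close> misses \<open>w\<close>; this span is not graded.
\<close>

theorem simple_type_Q_zero_segment:
  assumes "a = 0" "1 \<le> d"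
  shows "simple_type_Q d V"
proof -
  have d: "1 \<in> {1..d}" using assms(2) by simp
  have t: "t i = of_nat (i - 1)" if "1 \<le> i" for i
    using that by (simp add: tval_def assms(1) of_nat_diff)
  define \<kappa> :: "nat \<Rightarrow> complex" where "\<kappa> i = of_real (sqrt (real (i - 1) * real (i - 1) + real (i - 1)))" for i
  have sq: "\<kappa> i * \<kappa> i = t i * t i + t i" if "1 \<le> i" for i
    unfolding t[OF that] \<kappa>_def of_real_mult[symmetric] real_sqrt_mult_self by simp
  let ?J = "{2..d}"
  have J: "?J \<subseteq> {1..d}" by auto
  have tJ: "t j \<noteq> 0 \<and> t j \<noteq> - 1" if "2 \<le> j" for j
  proof -
    have "t j = of_nat (j - 1)" "t j + 1 = of_nat j"
      using that by (simp_all add: t of_nat_diff)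
    moreover have "of_nat (j - 1) \<noteq> (0 :: complex)" "of_nat j \<noteq> (0 :: complex)"
      using that by simp_all
    ultimately show ?thesis by auto
  qed
  have \<kappa>: "\<kappa> j \<noteq> 0 \<and> \<kappa> j * \<kappa> j = t j * t j + t j" if "j \<in> ?J" for j
    using that tJ[of j] sq[of j] root_of_q_nonzero(2)[of \<kappa> j] by auto
  have t_minus: "t i \<noteq> - 1" if "i \<in> {1..<d}" for i
    using that tJ[of i] t[of 1] by (cases "i = 1") auto
  define w where "w = Xprod \<kappa> [2..<d + 1] hat_one"
  have L: "set [2..<d + 1] = ?J" by auto
  have one: "hat_one \<in> segspace a {1..1}" "hat_one \<noteq> (0 :: segvec)"
    by (auto simp: hat_one_nonzero)
  have w0: "w \<noteq> 0"
    using Xprod_nonzero[OF one assms(2) order.refl, of \<kappa>] tJ sq root_of_q_nonzero(1)[of \<kappa>]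
    by (simp add: w_def)
  have wM: "w \<in> M" unfolding w_def by (rule Xprod_M) (auto simp: J)
  have w_even: "parity_op w = w"
    unfolding w_def using L J by (subst Xprod_parity) auto
  have w_weight: "X j w = cscale (\<kappa> j) w" if "j \<in> ?J" for j
    unfolding w_def using L J \<kappa>[OF that] that by (intro Xprod_weight) auto
  have Cw_weight: "X j (C 1 w) = cscale (\<kappa> j) (C 1 w)" if j: "j \<in> ?J" for j
  proof -
    have "j \<in> {1..d}" "1 \<noteq> j" using j by auto
    then show ?thesis using X_C_other[OF wM] w_weight[OF j] by simp
  qed
  have CwM: "C 1 w \<in> M" using wM d by auto
  have Cw_odd: "parity_op (C 1 w) = - C 1 w"
    using parity_C[OF wM] w_even by simp
  have CCw: "C 1 (C 1 w) = - w" by (rule Cop_square)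
  have Cw0: "C 1 w \<noteq> 0" using CCw w0 by auto
  let ?B = "{w} \<union> C 1 ` {w}"
  note ind = independent_Un_C[of "{w}" 1, simplified]
  have B: "finite ?B" "vs.independent ?B" "?B \<subseteq> weight_space \<kappa> ?J"
    using ind(1) w0 wM w_even CwM w_weight Cw_weight by (auto simp: weight_space_def)
  have "card ?B = 2" using ind(2) w0 wM w_even by simp
  then have W: "weight_space \<kappa> ?J \<subseteq> vs.span ?B"
    using assms \<kappa> B J
    by (intro weight_space_spanned) (auto simp: phi_basis_def power_eq_if)
  show ?thesis
  proof (rule simple_type_Q_V)
    fix U assume U: "H_closed U" and parity: "\<And>v. v \<in> U \<Longrightarrow> parity_op v \<in> U"
    have sub: "vs.subspace U" "U \<subseteq> M" and XU: "\<And>i v. i \<in> {1..d} \<Longrightarrow> v \<in> U \<Longrightarrow> X i v \<in> U"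
      and CU: "\<And>v. v \<in> U \<Longrightarrow> C 1 v \<in> U"
      using U d by (auto simp: H_closed_def)
    show "U = {0} \<or> U = M"
    proof (cases "U = {0}")
      case False
      obtain v where v: "v \<in> U" "v \<in> weight_space \<kappa> ?J" "v \<noteq> 0"
        using weight_vector_exists[of ?J \<kappa> U] J \<kappa> closed_C_closed[OF U J] sub(2) XU False by blast
      then obtain x y where xy: "v = cscale x w + cscale y (C 1 w)"
        using W by (auto simp: vs.span_insert vs.span_singleton algebra_simps)
      have Pv: "parity_op v = cscale x w - cscale y (C 1 w)"
        by (simp add: xy w_even Cw_odd)
      have "cscale (1/2) (v + parity_op v) = cscale x w" "cscale (1/2) (v - parity_op v) = cscale y (C 1 w)"
        unfolding Pv unfolding xy by (simp_all add: vs.scale_right_distrib flip: vs.scale_left_distrib)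
      then have "cscale x w \<in> U" "cscale y (C 1 w) \<in> U"
        using v(1) parity[OF v(1)] vs.subspace_scale[OF sub(1)] vs.subspace_add[OF sub(1)]
          vs.subspace_diff[OF sub(1)] by metis+
      moreover have "z \<in> U" if "cscale x z \<in> U" "x \<noteq> 0" for x z
        using vs.subspace_scale[OF sub(1) that(1), of "1 / x"] that(2) by simp
      moreover have "x \<noteq> 0 \<or> y \<noteq> 0" using v(3) xy by auto
      ultimately have "w \<in> U \<or> C 1 w \<in> U" by blast
      then have wU: "w \<in> U" using CU[of "C 1 w"] CCw vs.subspace_neg[OF sub(1), of "- w"] by auto
      have "vs.span ?B \<subseteq> U"
        using wU CU[OF wU] by (intro vs.span_minimal sub) auto
      then have "M \<subseteq> U"
        using C_closed_contains_M[of ?J \<kappa> U] J \<kappa> closed_C_closed[OF U J] W by blast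
      then show ?thesis using sub(2) by auto
    qed simp
  next
    define u where "u = w + cscale \<i> (C 1 w)"
    have uM: "u \<in> M" using wM CwM by (auto simp: u_def)
    have u_weight: "X j u = cscale (\<kappa> j) u" if "j \<in> ?J" for j
      using w_weight[OF that] Cw_weight[OF that]
      by (simp add: u_def vs.scale_right_distrib mult.commute)
    have Pu: "parity_op u = w - cscale \<i> (C 1 w)"
      by (simp add: u_def w_even Cw_odd)
    have w_not: "w \<notin> vs.span {u}"
    proof
      assume "w \<in> vs.span {u}"
      then obtain x where x: "w = cscale x u" by (auto simp: vs.span_singleton)
      then have "cscale x (u - parity_op u) = w - parity_op w" by (simp add: vs.scale_right_diff_distrib)
      then have "cscale x (u - parity_op u) = 0" using w_even by simp
      moreover have "u - parity_op u = cscale (2 * \<i>) (C 1 w)"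
        unfolding Pu unfolding u_def mult_2 vs.scale_left_distrib by simp
      ultimately show False using x w0 Cw0 by auto
    qed
    have u0: "u \<noteq> 0"
    proof
      assume "u = 0"
      then have "u + parity_op u = 0" by simp
      moreover have "u + parity_op u = cscale 2 w"
        unfolding Pu unfolding u_def one_add_one[symmetric] vs.scale_left_distrib by simp
      ultimately show False using w0 by simp
    qed
    let ?U = "Cl u"
    have "C 1 u = cscale (- \<i>) u"
      by (simp add: u_def CCw vs.scale_right_distrib)
    then have span: "?U \<inter> weight_space \<kappa> ?J \<subseteq> vs.span {u}"
    proof (intro clifford_span_weight)
      fix k b assume "C 1 u = cscale (- \<i>) u" "k \<in> {1..d} - ?J" "b \<in> {u}"
      moreover from this have "k = 1" by auto
      ultimately show "C k b \<in> vs.span {u}"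
        using vs.span_scale[OF vs.span_base[of u "{u}"], of "- \<i>"] by simp
    qed (use J \<kappa> u0 uM u_weight in \<open>auto simp: weight_space_def vs.span_base\<close>)
    have CU: "C_closed {1..d} ?U" by (rule clifford_span_C_closed[OF uM])
    show "H_closed ?U"
    proof (rule H_closedI[OF CU])
      fix i v assume i: "i \<in> {1..d}" and v: "v \<in> ?U"
      have "X i u \<in> ?U"
      proof (cases "i = 1")
        case True
        then show ?thesis
          using X_first_zero[OF assms(1) uM assms(2)] vs.subspace_0[OF clifford_span_subspace[OF uM]] by simp
      next
        case False
        then show ?thesis
          using i u_weight[of i] vs.subspace_scale[OF clifford_span_subspace[OF uM] clifford_span_self[OF uM]] by simp
      qed
      then show "X i v \<in> ?U" using clifford_span_X[OF uM i _ CU v] by blast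
    qed (use t_minus clifford_span_M[OF uM] in auto)
    show "?U \<noteq> {0}" using clifford_span_self[OF uM] u0 by auto
    show "?U \<noteq> M"
      using span w_not wM w_weight by (auto simp: weight_space_def)
  qed
qed

end

section \<open>Positive segments\<close>

context segment
begin

text \<open>
  When every index belongs to \<open>J\<close>, the Clifford span of an even weight vector meets the weight space in a
  single line, and every nonzero submodule of it contains that line.
\<close>

lemma clifford_span_simple:
  assumes J: "\<And>j. j \<in> {1..d} \<Longrightarrow> \<kappa> j \<noteq> 0 \<and> \<kappa> j * \<kappa> j = t j * t j + t j"
    and w: "w \<in> weight_space \<kappa> {1..d}" "w \<noteq> 0" "parity_op w = w"
    and t_minus: "\<And>i. i \<in> {1..<d} \<Longrightarrow> t i \<noteq> - 1"
  shows "H_closed (Cl w)" "hc_subsupermodule d V (Cl w)"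
    "simple_type_M d (restrict_to V (Cl w))"
    "Cl w \<inter> weight_space \<kappa> {1..d} \<subseteq> vs.span {w}"
proof -
  let ?U = "Cl w"
  have wM: "w \<in> M" and weight: "\<And>j. j \<in> {1..d} \<Longrightarrow> X j w = cscale (\<kappa> j) w"
    using w(1) by (auto simp: weight_space_def)
  note sub = clifford_span_subspace[OF wM] and self = clifford_span_self[OF wM]
    and CU = clifford_span_C_closed[OF wM]
  have parity: "parity_op v \<in> ?U" if "v \<in> ?U" for v
    using clifford_span_parity[OF wM _ CU that] w(3) self by simp
  have X: "X j v \<in> ?U" if "j \<in> {1..d}" "v \<in> ?U" for j v
    using clifford_span_X[OF wM that(1) _ CU that(2)] weight[OF that(1)] vs.subspace_scale[OF sub self]
    by simp
  show H_closed: "H_closed ?U"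
    using H_closedI[OF CU X clifford_span_M[OF wM]] t_minus by blast
  show "hc_subsupermodule d V ?U"
    using H_closed parity by (simp add: subsupermodule_iff)
  show span: "?U \<inter> weight_space \<kappa> {1..d} \<subseteq> vs.span {w}"
    by (rule clifford_span_weight) (use J w in \<open>auto simp: vs.span_base\<close>)
  show "simple_type_M d (restrict_to V ?U)"
  proof (rule simple_type_M_restrict[OF H_closed parity])
    show "?U \<noteq> {0}" using self w(2) by auto
    fix U assume U: "H_closed U" "U \<subseteq> ?U"
    have sub': "vs.subspace U" "U \<subseteq> M" and XU: "\<And>i v. i \<in> {1..d} \<Longrightarrow> v \<in> U \<Longrightarrow> X i v \<in> U"
      using U by (auto simp: H_closed_def)
    show "U = {0} \<or> U = ?U"
    proof (cases "U = {0}")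
      case False
      obtain v where v: "v \<in> U" "v \<in> weight_space \<kappa> {1..d}" "v \<noteq> 0"
        using weight_vector_exists[of "{1..d}" \<kappa> U] J closed_C_closed[OF U(1)] sub'(2) XU False
        by blast
      then obtain x where x: "v = cscale x w" using span U(2) by (auto simp: vs.span_singleton)
      then have "w \<in> U" using vs.subspace_scale[OF sub'(1) v(1), of "1 / x"] v(3) by simp
      then have "?U \<subseteq> U"
        using wM closed_C_closed[OF U(1) order.refl] by (rule clifford_span_minimal)
      then show ?thesis using U(2) by auto
    qed simp
  qed
qed

text \<open>
  Multiplication by \<open>c\<^sub>1\<close> exchanges the weight spaces for \<open>\<kappa>\<close> and for \<open>\<kappa>\<close> with the sign changed at 1. So the even
  \<open>w\<close> and the odd \<open>c\<^sub>1 w'\<close> span the weight space, which makes the two Clifford spans exhaust the module, and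
  a common weight vector would be even and odd at once.
\<close>

theorem positive_segment_decomposition:
  assumes "0 < a" "1 \<le> d"
    and sq: "\<And>j. j \<in> {1..d} \<Longrightarrow> \<kappa> j * \<kappa> j = t j * t j + t j"
  defines "w \<equiv> Xprod \<kappa> [1..<d + 1] hat_one"
    and "w' \<equiv> Xprod (\<kappa>(1 := - \<kappa> 1)) [1..<d + 1] hat_one"
  shows "hc_subsupermodule d V (Cl w)" "hc_subsupermodule d V (Cl w')"
    "direct_sum_of M (Cl w) (Cl w')"
    "simple_type_M d (restrict_to V (Cl w))"
    "simple_type_M d (restrict_to V (Cl w'))"
proof -
  let ?\<kappa> = "\<kappa>(1 := - \<kappa> 1)"
  have t: "t j \<noteq> 0 \<and> t j \<noteq> - 1" if "1 \<le> j" for j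
  proof -
    obtain n where n: "a = int (Suc n)" using assms(1) by (metis zero_less_imp_eq_int gr0_implies_Suc)
    have "t j = of_nat (n + j)" "t j + 1 = of_nat (n + j + 1)"
      by (simp_all add: tval_def n)
    moreover have "of_nat (n + j) \<noteq> (0 :: complex)" "of_nat (n + j + 1) \<noteq> (0 :: complex)"
      using that unfolding of_nat_eq_0_iff by simp_all
    ultimately show ?thesis by (auto simp del: of_nat_add)
  qed
  have d: "1 \<in> {1..d}" using assms(2) by simp
  have one: "hat_one \<in> segspace a {1..0}" "hat_one \<noteq> (0 :: segvec)"
    by (auto simp: hat_one_nonzero)
  have L: "set [1..<d + 1] = {1..d}" by auto
  have main: "\<mu> j \<noteq> 0 \<and> \<mu> j * \<mu> j = t j * t j + t j"
    "Xprod \<mu> [1..<d + 1] hat_one \<in> weight_space \<mu> {1..d}" "Xprod \<mu> [1..<d + 1] hat_one \<noteq> 0"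
    "parity_op (Xprod \<mu> [1..<d + 1] hat_one) = Xprod \<mu> [1..<d + 1] hat_one"
    if sq: "\<And>j. j \<in> {1..d} \<Longrightarrow> \<mu> j * \<mu> j = t j * t j + t j" and j: "j \<in> {1..d}" for \<mu> j
  proof -
    show "\<mu> j \<noteq> 0 \<and> \<mu> j * \<mu> j = t j * t j + t j"
      using root_of_q_nonzero(2)[of \<mu> j, OF sq[OF j]] t[of j] sq[OF j] j by auto
    show "Xprod \<mu> [1..<d + 1] hat_one \<in> weight_space \<mu> {1..d}"
      unfolding weight_space_def using sq L by (auto intro!: Xprod_M Xprod_weight)
    show "Xprod \<mu> [1..<d + 1] hat_one \<noteq> 0"
    proof -
      have "t j + \<mu> j \<noteq> 0" if "0 < j" "j \<le> d" for j
        using root_of_q_nonzero(1)[of \<mu> j, OF sq[of j]] t[of j] that by auto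
      then show ?thesis using Xprod_nonzero[OF one, of d \<mu>] by simp
    qed
    show "parity_op (Xprod \<mu> [1..<d + 1] hat_one) = Xprod \<mu> [1..<d + 1] hat_one"
      by (subst Xprod_parity) auto
  qed
  have sq': "?\<kappa> j * ?\<kappa> j = t j * t j + t j" if "j \<in> {1..d}" for j
    using sq[OF that] by (cases "j = 1") simp_all
  note w = main[of \<kappa>, OF sq] and w' = main[of ?\<kappa>, OF sq']
  have t_minus: "t i \<noteq> - 1" if "i \<in> {1..<d}" for i using t[of i] that by simp
  note simple = clifford_span_simple[OF w(1) w(2,3,4)[OF _ d] t_minus, folded w_def]
    and simple' = clifford_span_simple[OF w'(1) w'(2,3,4)[OF _ d] t_minus, folded w'_def]
  show "hc_subsupermodule d V (Cl w)" "hc_subsupermodule d V (Cl w')"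
    "simple_type_M d (restrict_to V (Cl w))"
    "simple_type_M d (restrict_to V (Cl w'))"
    using simple(2,3) simple'(2,3) by simp_all
  have W: "w \<in> weight_space \<kappa> {1..d}" "w' \<in> weight_space ?\<kappa> {1..d}" and nz: "w \<noteq> 0" "w' \<noteq> 0"
    and even: "parity_op w = w" "parity_op w' = w'"
    using w(2-4)[OF _ d, folded w_def] w'(2-4)[OF _ d, folded w'_def] by blast+
  then have M: "w \<in> M" "w' \<in> M" by (auto simp: weight_space_def)
  have swap: "C 1 v \<in> weight_space (\<mu>(1 := - \<mu> 1)) {1..d}" if v: "v \<in> weight_space \<mu> {1..d}" for v \<mu>
  proof -
    have vM: "v \<in> M" and weight: "\<And>j. j \<in> {1..d} \<Longrightarrow> X j v = cscale (\<mu> j) v"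
      using v by (auto simp: weight_space_def)
    have "X j (C 1 v) = cscale ((\<mu>(1 := - \<mu> 1)) j) (C 1 v)" if j: "j \<in> {1..d}" for j
      using X_C_same[OF vM j] X_C_other[OF vM j, of 1] weight[OF j] by (cases "j = 1") auto
    then show ?thesis using vM d by (auto simp: weight_space_def)
  qed
  have Cw': "C 1 w' \<in> weight_space \<kappa> {1..d}" using swap[OF W(2)] by simp
  have odd: "parity_op (C 1 w') = - C 1 w'" using parity_C[OF M(2)] even by simp
  have odd_zero: "z = 0" if "z = cscale y (C 1 w')" "parity_op z = z" for y z
    using that odd by (intro even_odd_zero) auto
  have "C 1 w' \<noteq> 0" using Cop_square[of 1 w'] nz by auto
  have not_span: "w \<notin> vs.span {C 1 w'}"
    using odd_zero[of w] even nz by (auto simp: vs.span_singleton)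
  have ind: "vs.independent {w, C 1 w'}"
    using not_span \<open>C 1 w' \<noteq> 0\<close> by (intro vs.independent_insertI) (auto simp: vs.independent_empty)
  have "w \<noteq> C 1 w'" using not_span vs.span_base[of "C 1 w'"] by auto
  then have "card {w, C 1 w'} = 2" by simp
  then have span: "weight_space \<kappa> {1..d} \<subseteq> vs.span {w, C 1 w'}"
    using ind W(1) Cw' w(1) assms(1) by (intro weight_space_spanned) (auto simp: phi_basis_def)
  let ?A = "Cl w" and ?B = "Cl w'"
  have CA: "C_closed {1..d} ?A" and CB: "C_closed {1..d} ?B"
    using M by (simp_all add: clifford_span_C_closed)
  have sub: "vs.subspace ?A" "vs.subspace ?B"
    using M by (simp_all add: clifford_span_subspace)
  have "M \<subseteq> sumset ?A ?B"
  proof (rule C_closed_contains_M[of "{1..d}" \<kappa>])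
    show "C_closed {1..d} (sumset ?A ?B)" using CA CB by (rule C_closed_sumset)
    have "w \<in> ?A" "C 1 w' \<in> ?B"
      using M clifford_span_self CB d by (auto simp: C_closed_def)
    then have "w + 0 \<in> sumset ?A ?B" "0 + C 1 w' \<in> sumset ?A ?B"
      unfolding sumset_def using vs.subspace_0[OF sub(1)] vs.subspace_0[OF sub(2)] by blast+
    then have "vs.span {w, C 1 w'} \<subseteq> sumset ?A ?B"
      using C_closed_sumset[OF CA CB] by (intro vs.span_minimal) (auto simp: C_closed_def)
    then show "weight_space \<kappa> {1..d} \<subseteq> sumset ?A ?B" using span by blast
  qed (use w(1) in auto)
  moreover have "sumset ?A ?B \<subseteq> M"
    using clifford_span_M[OF M(1)] clifford_span_M[OF M(2)] by (auto simp: sumset_def)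
  moreover have "?A \<inter> ?B \<subseteq> {0}"
  proof (rule subset_if_weight_space_subset[of "{1..d}" \<kappa>])
    show "C_closed {1..d} (?A \<inter> ?B)" using CA CB by (rule C_closed_Int)
    show "?A \<inter> ?B \<inter> weight_space \<kappa> {1..d} \<subseteq> {0}"
    proof
      fix v assume v: "v \<in> ?A \<inter> ?B \<inter> weight_space \<kappa> {1..d}"
      then obtain x where x: "v = cscale x w" using simple(4) by (auto simp: vs.span_singleton)
      have "C 1 v \<in> ?B \<inter> weight_space ?\<kappa> {1..d}"
        using v swap[of v \<kappa>] CB d by (auto simp: C_closed_def)
      then obtain y where "C 1 v = cscale y w'" using simple'(4) by (auto simp: vs.span_singleton)
      then have "- v = cscale y (C 1 w')" using Cop_square[of 1 v] by simp
      then have "- v = 0" by (rule odd_zero) (simp add: x even)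
      then show "v \<in> {0}" by simp
    qed
  qed (use w(1) simple(1) simple'(1) C_closed_zero in \<open>auto simp: H_closed_def\<close>)
  ultimately show "direct_sum_of M ?A ?B"
    using sub vs.subspace_0[OF sub(1)] vs.subspace_0[OF sub(2)] by (auto simp: direct_sum_of_def)
qed

end

section \<open>Segments through zero\<close>

text \<open>
  The segment starts at \<open>- p\<close>, so \<open>t p = - 1\<close>, \<open>t (p + 1) = 0\<close>, and \<open>\<kappa>\<close> vanishes at \<open>p\<close> and \<open>p + 1\<close> only.
\<close>

locale crossing_segment = segment +
  fixes p :: nat and \<kappa> :: "nat \<Rightarrow> complex"
  assumes p: "p \<in> {1..<d}" and a: "a = - int p"
    and sq: "\<And>j. j \<in> {1..d} \<Longrightarrow> \<kappa> j * \<kappa> j = t j * t j + t j"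
begin

abbreviation "J \<equiv> {1..d} - {p, p + 1}"

definition y :: "segvec \<Rightarrow> segvec" where
  "y v = C p (C (p + 1) v)"

definition xvec :: segvec where
  "xvec = Xprod \<kappa> (filter (\<lambda>i. i \<noteq> p + 1) [1..<d + 1]) hat_one"

text \<open>
  For \<open>z = \<plusminus>\<i>\<close> these are the two generators; \<open>1 + z y\<close> projects, up to a factor, to the eigenspace of \<open>y\<close> for
  \<open>- z\<close>, as \<open>y\<^sup>2 = - 1\<close>.
\<close>

definition wvec :: "complex \<Rightarrow> segvec" where
  "wvec z = - (xvec + cscale z (y xvec))"

lemma p_mem: "p \<in> {1..d}" "p + 1 \<in> {1..d}"
  using p by auto

lemma t_eq: "t j = of_nat j - of_nat (p + 1)"
  by (simp add: tval_def a)

lemma t_p: "t p = - 1" "t (p + 1) = 0"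
  by (simp_all add: t_eq)

lemma t_J: "j \<noteq> p \<Longrightarrow> j \<noteq> p + 1 \<Longrightarrow> t j \<noteq> 0 \<and> t j \<noteq> - 1"
proof -
  assume j: "j \<noteq> p" "j \<noteq> p + 1"
  have eq: "t j + 1 = of_nat j - of_nat p" by (simp add: t_eq)
  moreover have "of_nat j \<noteq> (of_nat p :: complex)" "of_nat j \<noteq> (of_nat (p + 1) :: complex)"
    using j unfolding of_nat_eq_iff by simp_all
  ultimately have "t j + 1 \<noteq> 0" "t j \<noteq> 0"
    unfolding eq unfolding t_eq right_minus_eq by simp_all
  then show ?thesis by auto
qed

lemma kappa_J: "j \<in> J \<Longrightarrow> \<kappa> j \<noteq> 0 \<and> \<kappa> j * \<kappa> j = t j * t j + t j"
  using root_of_q_nonzero(2)[of \<kappa> j, OF sq] t_J[of j] sq[of j] by auto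

lemma kappa_p: "\<kappa> p = 0"
  using sq[OF p_mem(1)] by (simp add: t_p)

lemma clin_y: "clin y"
  unfolding y_def by (rule clin_comp[OF clin_Cop clin_Cop])

lemmas y_linear [simp] = linear_simps[OF clin_y]

lemma y_M: "v \<in> M \<Longrightarrow> y v \<in> M"
  unfolding y_def by (intro Cop_segspace p_mem)

lemma C_C_p: "C (p + 1) (C p v) = - C p (C (p + 1) v)"
  by (rule Cop_anticommute) simp

lemma y_y: "y (y v) = - v"
  by (simp add: y_def C_C_p Cop_square)

text \<open>
  Since \<open>y\<^sup>2 = - 1\<close>, the operator \<open>1 - y\<close> is twice the inverse of \<open>1 + y\<close>.
\<close>

lemma one_plus_y: "v + y v = 0 \<Longrightarrow> v = 0"
proof -
  assume "v + y v = 0"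
  then have "v + y v - y (v + y v) = 0" by simp
  then have "v + v = 0" by (simp add: y_y)
  then have "cscale 2 v = 0" using vs.scale_left_distrib[of 1 1 v] by simp
  then show "v = 0" by simp
qed

lemma xvec_M: "xvec \<in> M"
  unfolding xvec_def by (rule Xprod_M) auto

lemma xvec_weight: "j \<in> {1..d} \<Longrightarrow> j \<noteq> p + 1 \<Longrightarrow> X j xvec = cscale (\<kappa> j) xvec"
  unfolding xvec_def using sq by (intro Xprod_weight) auto

lemma upt_split:
  "filter (\<lambda>i. i \<noteq> p + 1) [1..<d + 1] = [1..<p] @ [p] @ [p + 1 + 1..<d + 1]"
proof -
  have "[1..<d + 1] = [1..<p] @ [p..<d + 1]"
    using upt_add_eq_append[of 1 p "d + 1 - p"] p by simp
  also have "[p..<d + 1] = p # (p + 1) # [p + 1 + 1..<d + 1]"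
    using p by (subst upt_conv_Cons, simp, subst upt_conv_Cons) (auto simp flip: Suc_eq_plus1)
  finally show ?thesis
    by (auto simp: filter_id_conv)
qed

lemma X_p_xvec: "X p xvec = 0"
  using xvec_weight[OF p_mem(1)] by (simp add: kappa_p)

text \<open>
  The factor \<open>x\<^sub>p + \<kappa>\<^sub>p = x\<^sub>p\<close> of the product can be applied first, and \<open>x\<^sub>p\<^sub>+\<^sub>1 x\<^sub>p\<close> kills the cyclic vector.
\<close>

lemma X_Suc_p_xvec: "X (p + 1) xvec = 0"
proof -
  have 1: "set [1..<p] \<subseteq> {1..d}" "set [p] \<subseteq> {1..d}" "set [p + 1 + 1..<d + 1] \<subseteq> {1..d}"
    using p by auto
  have "xvec = Xprod \<kappa> [1..<p] (Xprod \<kappa> [p + 1 + 1..<d + 1] (X p hat_one))"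
    unfolding xvec_def upt_split Xprod_append
    using Xprod_commute[OF 1(2,3) hat_one_segspace, of \<kappa>] by (simp add: kappa_p)
  also have "X (p + 1) \<dots> = Xprod \<kappa> [1..<p] (Xprod \<kappa> [p + 1 + 1..<d + 1] (X (p + 1) (X p hat_one)))"
    using 1 p_mem X_M[OF hat_one_segspace p_mem(1)] by (simp add: Xprod_X Xprod_M)
  also have "\<dots> = 0"
    using X_X_one_zero[OF p_mem t_p(1)] by (simp add: Xprod_linear)
  finally show ?thesis .
qed

lemma xvec_even: "parity_op xvec = xvec"
  unfolding xvec_def by (subst Xprod_parity) auto

context
  fixes z :: complex
  assumes z: "z * z = - 1"
begin

lemma wvec_M: "wvec z \<in> M"
  using xvec_M y_M[OF xvec_M] by (auto simp: wvec_def)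

lemma y_wvec: "y (wvec z) = - cscale z (wvec z)"
  by (simp add: wvec_def y_y vs.scale_right_distrib vs.scale_right_diff_distrib z)

lemma C_Suc_p_wvec: "C (p + 1) (wvec z) = cscale z (C p (wvec z))"
proof -
  have "C p (y (wvec z)) = - C (p + 1) (wvec z)" by (simp add: y_def Cop_square)
  then show ?thesis unfolding y_wvec by simp
qed

lemma wvec_even: "parity_op (wvec z) = wvec z"
proof -
  have "C (p + 1) xvec \<in> M" using xvec_M p by auto
  then show ?thesis
    using parity_C[OF xvec_M] parity_C[of "C (p + 1) xvec"] by (simp add: wvec_def y_def xvec_even)
qed

lemma X_y: "v \<in> M \<Longrightarrow> j \<in> J \<Longrightarrow> X j (y v) = y (X j v)"
  "v \<in> M \<Longrightarrow> j \<in> {p, p + 1} \<Longrightarrow> X j (y v) = - y (X j v)"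
proof -
  assume v: "v \<in> M"
  have Cv: "C (p + 1) v \<in> M" using v p by auto
  show "X j (y v) = y (X j v)" if "j \<in> J"
    using that X_C_other[OF v, of j "p + 1"] X_C_other[OF Cv, of j p] by (simp add: y_def)
  show "X j (y v) = - y (X j v)" if "j \<in> {p, p + 1}"
    using that X_C_other[OF v p_mem(1), of "p + 1"] X_C_same[OF Cv p_mem(1)]
      X_C_same[OF v p_mem(2)] X_C_other[OF Cv p_mem(2), of p] by (auto simp: y_def)
qed

lemma wvec_weight: "j \<in> J \<Longrightarrow> X j (wvec z) = cscale (\<kappa> j) (wvec z)"
  using X_y(1)[OF xvec_M] xvec_weight[of j]
  by (simp add: wvec_def vs.scale_right_distrib vs.scale_right_diff_distrib mult.commute)

lemma X_p_wvec: "X p (wvec z) = 0" "X (p + 1) (wvec z) = 0"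
  using X_y(2)[OF xvec_M, of p] X_y(2)[OF xvec_M, of "p + 1"] X_p_xvec X_Suc_p_xvec by (simp_all add: wvec_def)

text \<open>The factors with index above \<open>p + 1\<close> commute with \<open>y\<close>, so they can be applied last; they
  preserve being nonzero. The remaining factors leave the generator \<open>p + 1\<close> untouched, and
  \<open>Eop (p + 1)\<close> separates the two summands.\<close>

lemma wvec_nonzero: "wvec z \<noteq> 0"
proof -
  define v where "v = Xprod \<kappa> [1..<p + 1] hat_one"
  have one: "hat_one \<in> segspace a {1..0}" by auto
  have nz: "t j + \<kappa> j \<noteq> 0" if "j \<in> {1..d}" "j \<noteq> p + 1" for j
  proof (rule root_of_q_nonzero(1)[of \<kappa> j, OF sq[OF that(1)]])
    show "t j \<noteq> 0" using t_J[of j] t_p(1) that(2) by (cases "j = p") auto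
  qed
  have v: "v \<noteq> 0" "v \<in> segspace a {1..p}"
    using Xprod_nonzero[OF one hat_one_nonzero, of p \<kappa>] nz p by (auto simp: v_def)
  have "segspace a {1..p} \<subseteq> M" "segspace a {1..p} \<subseteq> segspace a {1..p + 1}"
    "segspace a {1..p} = segspace a {1..<p + 1}"
    using p by (auto intro!: segspace_mono simp: atLeastLessThanSuc_atLeastAtMost simp flip: Suc_eq_plus1)
  then have vM: "v \<in> M" and v1: "v \<in> segspace a {1..p + 1}" and v2: "v \<in> segspace a {1..<p + 1}"
    using v(2) by auto
  let ?L = "[p + 1 + 1..<d + 1]"
  have L: "set ?L \<subseteq> {1..d}" "set [1..<p + 1] \<subseteq> {1..d}" using p by auto
  have "[1..<p] @ [p] = [1..<p + 1]"
    using upt_Suc_append[of 1 p] p unfolding Suc_eq_plus1 by auto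
  then have "filter (\<lambda>i. i \<noteq> p + 1) [1..<d + 1] = [1..<p + 1] @ ?L"
    unfolding upt_split append_assoc[symmetric] by simp
  then have xvec: "xvec = Xprod \<kappa> ?L v"
    unfolding xvec_def v_def using Xprod_commute[OF L hat_one_segspace] by (simp add: Xprod_append)
  have Cv: "C (p + 1) v \<in> M" using vM p by auto
  have "Xprod \<kappa> ?L (y v) = y xvec"
    using Xprod_C[OF L(1) vM p_mem(2)] Xprod_C[OF L(1) Cv p_mem(1)] by (simp add: y_def xvec)
  then have wvec: "- wvec z = Xprod \<kappa> ?L (v + cscale z (y v))"
    by (simp add: wvec_def Xprod_linear xvec)
  have "v + cscale z (y v) \<noteq> 0"
  proof
    assume eq: "v + cscale z (y v) = 0"
    have E: "Eop (p + 1) v = v" using X_Eop(2)[OF v2 p_mem(2)] .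
    then have "Eop (p + 1) (y v) = - y v"
      by (simp add: y_def Eop_Cop_other Eop_Cop_same)
    then have "Eop (p + 1) (v + cscale z (y v)) = v - cscale z (y v)"
      using E by simp
    then have "v - cscale z (y v) = 0" by (simp add: eq)
    then have "(v + cscale z (y v)) + (v - cscale z (y v)) = 0" by (simp only: eq add_0)
    then have "cscale 2 v = 0" using vs.scale_left_distrib[of 1 1 v] by simp
    then show False using v(1) by simp
  qed
  moreover have "v + cscale z (y v) \<in> segspace a {1..p + 1}"
    unfolding y_def using v1
    by (intro vs.subspace_add[OF subspace_segspace] vs.subspace_scale[OF subspace_segspace]
        Cop_segspace) (use p in auto)
  ultimately have "Xprod \<kappa> ?L (v + cscale z (y v)) \<noteq> 0"
    using Xprod_nonzero[of "v + cscale z (y v)" "p + 1" d \<kappa>] p nz by auto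
  then show ?thesis unfolding wvec[symmetric] by simp
qed

abbreviation "A \<equiv> Cl (wvec z)"
abbreviation "A' \<equiv> Cl (S p (wvec z))"

lemma S_wvec_M: "S p (wvec z) \<in> M"
  by (rule S_M[OF wvec_M p])

lemma A_basics:
  "C_closed {1..d} A" "vs.subspace A" "A \<subseteq> M" "wvec z \<in> A"
  "C_closed {1..d} A'" "vs.subspace A'" "A' \<subseteq> M" "S p (wvec z) \<in> A'"
  using wvec_M S_wvec_M
  by (simp_all add: clifford_span_C_closed clifford_span_subspace clifford_span_M clifford_span_self)

lemma X_A: "v \<in> A \<Longrightarrow> X p v = 0" "v \<in> A \<Longrightarrow> X (p + 1) v = 0"
  using clifford_span_X[OF wvec_M p_mem(1) _ C_closed_zero] clifford_span_X[OF wvec_M p_mem(2) _ C_closed_zero]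
  by (auto simp: X_p_wvec)

lemma X_A_closed: "j \<in> {1..d} \<Longrightarrow> v \<in> A \<Longrightarrow> X j v \<in> A"
proof -
  assume j: "j \<in> {1..d}" and v: "v \<in> A"
  have "X j (wvec z) \<in> A"
    using wvec_weight[of j] X_p_wvec j A_basics vs.subspace_scale[OF A_basics(2,4)] vs.subspace_0[OF A_basics(2)]
    by (cases "j \<in> {p, p + 1}") auto
  then show "X j v \<in> A" using clifford_span_X[OF wvec_M j _ A_basics(1) v] by blast
qed

text \<open>
  This is where \<open>S p\<close> is not expressible through the other generators: both \<open>x\<close> vanish on the Clifford
  span, and what remains of the cross relation is an invertible operator leading back to it.
\<close>

lemma X_S:
  assumes "v \<in> M"
  shows "X p (S p v) = S p (X (p + 1) v) - (v + y v)"
    "X (p + 1) (S p v) = S p (X p v) + v - y v"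
proof -
  have Sv: "S p v \<in> M" using S_M[OF assms p] .
  have CSv: "C (p + 1) (S p v) \<in> M" using Sv p by auto
  have "S p (C p (C (p + 1) (S p v))) = C (p + 1) (C p (S p (S p v)))"
    using S_C[OF CSv p, of p] S_C[OF Sv p, of "p + 1"] by simp
  then have "S p (C p (C (p + 1) (S p v))) = - y v"
    by (simp add: S_square[OF assms p] C_C_p y_def)
  moreover have "S p (S p (X p (S p v))) = S p (X (p + 1) v - S p v + C p (C (p + 1) (S p v)))"
    using S_X[OF Sv p] by (simp add: S_square[OF assms p])
  ultimately show "X p (S p v) = S p (X (p + 1) v) - (v + y v)"
    using S_square[OF X_M[OF Sv p_mem(1)] p] S_square[OF assms p] by (simp add: algebra_simps)
  show "X (p + 1) (S p v) = S p (X p v) + v - y v"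
    using S_X[OF assms p] by (simp add: y_def)
qed

text \<open>
  Conjugation by \<open>S p\<close> permutes the Clifford generators, so \<open>S p\<close> carries Clifford spans to Clifford
  spans.
\<close>

lemma A'_image: "A' = S p ` A"
proof
  have sub: "vs.subspace (S p ` A)"
    using vs2.linear_subspace_image[OF clin_S A_basics(2)] .
  have "C_closed {1..d} (S p ` A)"
    unfolding C_closed_def
  proof (intro conjI ballI sub)
    fix i v assume i: "i \<in> {1..d}" and "v \<in> S p ` A"
    then obtain u where u: "u \<in> A" "v = S p u" by auto
    have "u \<in> M" using u A_basics(3) by auto
    let ?i = "transpose p (p + 1) i"
    have "?i \<in> {1..d}" using i p by (auto simp: transpose_def)
    then have "C ?i u \<in> A" using A_basics(1) u(1) by (auto simp: C_closed_def)
    moreover have "S p (C ?i u) = C i v" using S_C[OF \<open>u \<in> M\<close> p, of ?i] by (simp add: u(2))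
    ultimately show "C i v \<in> S p ` A" by (metis image_eqI)
  qed
  then show "A' \<subseteq> S p ` A"
    using A_basics(4) by (intro clifford_span_minimal S_wvec_M) auto
  show "S p ` A \<subseteq> A'"
    using clifford_span_S[OF wvec_M p A_basics(8,5)] by auto
qed

lemma X_p_A':
  assumes "u \<in> A"
  shows "X p (S p u) = - (u + y u)"
  using X_S(1)[of u] X_A(2)[OF assms] A_basics(3) assms by auto

lemma y_A: "v \<in> A \<Longrightarrow> y v \<in> A"
  using A_basics(1) p by (auto simp: C_closed_def y_def)

text \<open>
  \<open>X p\<close> vanishes on the Clifford span of \<open>wvec z\<close> and is injective on its image under \<open>S p\<close>.
\<close>

lemma direct_sum_A: "direct_sum_of (sumset A A') A A'"
proof -
  have "v = 0" if v: "v \<in> A" "v \<in> A'" for v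
  proof -
    obtain u where u: "u \<in> A" "v = S p u" using v(2) A'_image by auto
    have "- (u + y u) = 0" using X_A(1)[OF v(1)] unfolding u(2) X_p_A'[OF u(1)] .
    then have "u + y u = 0" by (simp only: neg_equal_0_iff_equal)
    then have "u = 0" by (rule one_plus_y)
    then show "v = 0" by (simp add: u(2))
  qed
  then show ?thesis
    using A_basics vs.subspace_0[OF A_basics(2)] vs.subspace_0[OF A_basics(6)]
    by (auto simp: direct_sum_of_def)
qed

lemma sumset_M: "sumset A A' \<subseteq> M"
  using A_basics(3,7) by (auto simp: sumset_def)

lemma sumset_C_closed: "C_closed {1..d} (sumset A A')"
  by (rule C_closed_sumset[OF A_basics(1,5)])

lemma sumset_subspace: "vs.subspace (sumset A A')"
  using sumset_C_closed by (simp add: C_closed_def)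

text \<open>
  The second summand is the image of the first under \<open>S p\<close>.
\<close>

lemma sumsetE:
  assumes "v \<in> sumset A A'"
  obtains x u where "x \<in> A" "u \<in> A" "x \<in> M" "u \<in> M" "v = x + S p u"
proof -
  obtain x u' where "x \<in> A" "u' \<in> A'" "v = x + u'" using assms by (auto simp: sumset_def)
  then show ?thesis using that A'_image A_basics(3) by auto
qed

lemma sumsetI: "x \<in> A \<Longrightarrow> u \<in> A \<Longrightarrow> x + S p u \<in> sumset A A'"
  unfolding sumset_def A'_image by blast

lemma A_sumset: "A \<subseteq> sumset A A'" "A' \<subseteq> sumset A A'"
  using sumsetI[of _ 0] sumsetI[of 0] vs.subspace_0[OF A_basics(2)] A'_image by auto

text \<open>
  \<open>S p\<close> exchanges the two summands, and \<open>X p\<close>, \<open>X (p + 1)\<close> map the second into the first.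
\<close>

lemma closed_sumset: "H_closed (sumset A A')"
proof (rule H_closedI[OF sumset_C_closed _ sumset_M])
  fix j v assume j: "j \<in> {1..d}" and "v \<in> sumset A A'"
  then obtain x u where v: "x \<in> A" "u \<in> A" "x \<in> M" "u \<in> M" "v = x + S p u" by (elim sumsetE)
  consider "j = p" | "j = p + 1" | "j \<noteq> p" "j \<noteq> p + 1" by blast
  then have "X j (S p u) \<in> sumset A A'"
  proof cases
    case 1
    have "- (u + y u) \<in> A"
      using v(2) y_A vs.subspace_add[OF A_basics(2)] vs.subspace_neg[OF A_basics(2)] by blast
    then show ?thesis using 1 X_p_A'[OF v(2)] A_sumset by auto
  next
    case 2
    have "u - y u \<in> A" using v(2) y_A vs.subspace_diff[OF A_basics(2)] by blast
    then show ?thesis using 2 X_S(2)[OF v(4)] X_A(1)[OF v(2)] A_sumset by auto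
  next
    case 3
    then have "X j (S p u) = S p (X j u)" using S_X_other[OF v(4) p j] by simp
    then show ?thesis using X_A_closed[OF j v(2)] A_sumset A'_image by auto
  qed
  moreover have "X j x \<in> sumset A A'" using X_A_closed[OF j v(1)] A_sumset by auto
  ultimately show "X j v \<in> sumset A A'"
    using vs.subspace_add[OF sumset_subspace] by (simp add: v(5))
next
  fix i v assume i: "i \<in> {1..<d}" and ti: "t i = - 1" and v: "v \<in> sumset A A'"
  have "i = p" using t_J[of i] ti t_p(2) by (cases "i = p + 1") auto
  obtain x u where xu: "x \<in> A" "u \<in> A" "x \<in> M" "u \<in> M" "v = x + S p u" using v by (elim sumsetE)
  then have "S p v = u + S p x" by (simp add: S_square[OF xu(4) p])
  then show "S i v \<in> sumset A A'" using sumsetI[OF xu(2,1)] by (simp only: \<open>i = p\<close>)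
qed

lemma parity_sumset: "v \<in> sumset A A' \<Longrightarrow> parity_op v \<in> sumset A A'"
proof -
  assume v: "v \<in> sumset A A'"
  obtain x u where xu: "x \<in> A" "u \<in> A" "x \<in> M" "u \<in> M" "v = x + S p u" using v by (elim sumsetE)
  have "parity_op x \<in> A" "parity_op u \<in> A"
    using clifford_span_parity[OF wvec_M _ A_basics(1)] wvec_even A_basics(4) xu by auto
  then show "parity_op v \<in> sumset A A'"
    using sumsetI by (simp add: xu(5) parity_S[OF xu(4) p])
qed

lemma C_p_wvec: "C p (wvec z) \<in> M" "parity_op (C p (wvec z)) = - C p (wvec z)"
  "C p (wvec z) \<in> weight_space \<kappa> J" "wvec z \<in> weight_space \<kappa> J"
proof -
  show M: "C p (wvec z) \<in> M" using wvec_M p by auto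
  show "parity_op (C p (wvec z)) = - C p (wvec z)" using parity_C[OF wvec_M] wvec_even by simp
  show "wvec z \<in> weight_space \<kappa> J" using wvec_M wvec_weight by (simp add: weight_space_def)
  have "X j (C p (wvec z)) = cscale (\<kappa> j) (C p (wvec z))" if j: "j \<in> J" for j
  proof -
    have "j \<in> {1..d}" "p \<noteq> j" using j by auto
    then show ?thesis using X_C_other[OF wvec_M] wvec_weight[OF j] by simp
  qed
  then show "C p (wvec z) \<in> weight_space \<kappa> J" using M by (simp add: weight_space_def)
qed

lemma y_C_p_wvec: "y (C p (wvec z)) = cscale z (C p (wvec z))"
proof -
  have "y (C p (wvec z)) = C (p + 1) (wvec z)" by (simp add: y_def C_C_p Cop_square)
  then show ?thesis by (simp add: C_Suc_p_wvec)
qed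

text \<open>
  On \<open>wvec z\<close> the generators \<open>c\<^sub>p\<close> and \<open>c\<^sub>p\<^sub>+\<^sub>1\<close> agree up to a scalar, so the plane spanned by \<open>wvec z\<close> and its
  image under \<open>c\<^sub>p\<close> is stable under both.
\<close>

lemma A_weight: "A \<inter> weight_space \<kappa> J \<subseteq> vs.span {wvec z, C p (wvec z)}"
proof -
  let ?B = "{wvec z} \<union> C p ` {wvec z}"
  have "vs.independent ?B"
    using wvec_nonzero wvec_M wvec_even by (intro independent_Un_C) auto
  moreover have "C k b \<in> vs.span ?B" if k: "k \<in> {1..d} - J" and b: "b \<in> ?B" for k b
  proof -
    have base: "wvec z \<in> vs.span ?B" "C p (wvec z) \<in> vs.span ?B" by (simp_all add: vs.span_base)
    have "C (p + 1) (C p (wvec z)) = cscale z (wvec z)"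
      by (simp add: C_C_p C_Suc_p_wvec Cop_square)
    moreover have "k = p \<or> k = p + 1" using k by auto
    ultimately show ?thesis
      using b base vs.span_scale[OF base(1)] vs.span_scale[OF base(2)] vs.span_neg[OF base(1)]
      by (auto simp: Cop_square C_Suc_p_wvec)
  qed
  ultimately have "A \<inter> weight_space \<kappa> J \<subseteq> vs.span ?B"
    using kappa_J C_p_wvec by (intro clifford_span_weight) (auto simp: vs.span_base)
  then show ?thesis by (simp add: insert_commute)
qed

text \<open>
  Applying \<open>X p\<close> moves a nonzero submodule into the Clifford span of \<open>wvec z\<close>, where it contains a
  nonzero combination of \<open>wvec z\<close> and \<open>C p (wvec z)\<close>. These have different eigenvalues under \<open>y\<close>, so one of
  them lies in the submodule, and then both do.
\<close>

lemma simple_sumset: "simple_type_M d (restrict_to V (sumset A A'))"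
proof (rule simple_type_M_restrict[OF closed_sumset parity_sumset])
  show "sumset A A' \<noteq> {0}" using A_sumset A_basics(4) wvec_nonzero by auto
  fix U assume U: "H_closed U" "U \<subseteq> sumset A A'"
  have sub: "vs.subspace U" "U \<subseteq> M" and XU: "\<And>i v. i \<in> {1..d} \<Longrightarrow> v \<in> U \<Longrightarrow> X i v \<in> U"
    and CU: "\<And>i v. i \<in> {1..d} \<Longrightarrow> v \<in> U \<Longrightarrow> C i v \<in> U" and SU: "\<And>v. v \<in> U \<Longrightarrow> S p v \<in> U"
    using U(1) p by (auto simp: H_closed_def)
  have yU: "v \<in> U \<Longrightarrow> y v \<in> U" for v using CU p_mem by (simp add: y_def)
  show "U = {0} \<or> U = sumset A A'"
  proof (cases "U = {0}")
    case False
    then obtain v where v: "v \<in> U" "v \<noteq> 0" using vs.subspace_0[OF sub(1)] by auto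
    then obtain x u where xu: "x \<in> A" "u \<in> A" "x \<in> M" "u \<in> M" "v = x + S p u" using U(2) by (blast elim: sumsetE)
    have "U \<inter> A \<noteq> {0}"
    proof (cases "u = 0")
      case True
      then show ?thesis using v xu by auto
    next
      case False
      have eq: "X p v = - (u + y u)" using X_p_A'[OF xu(2)] X_A(1)[OF xu(1)] by (simp add: xu(5))
      have "X p v \<in> U" using XU[OF p_mem(1) v(1)] .
      moreover have "X p v \<in> A"
        unfolding eq using xu(2) y_A vs.subspace_add[OF A_basics(2)] vs.subspace_neg[OF A_basics(2)]
        by blast
      moreover have "X p v \<noteq> 0"
        unfolding eq neg_equal_0_iff_equal using one_plus_y[of u] False by blast
      ultimately show ?thesis by blast
    qed
    moreover have "C_closed J (U \<inter> A)"
      using closed_C_closed[OF U(1)] A_basics(1) by (intro C_closed_Int) (auto simp: C_closed_def)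
    moreover have "X i v \<in> U \<inter> A" if "i \<in> J" "v \<in> U \<inter> A" for i v
      using that XU X_A_closed by auto
    ultimately obtain v where v: "v \<in> U \<inter> A" "v \<in> weight_space \<kappa> J" "v \<noteq> 0"
      using weight_vector_exists[of J \<kappa> "U \<inter> A"] kappa_J sub(2) by blast
    then obtain \<alpha> \<beta> where \<alpha>\<beta>: "v = cscale \<alpha> (wvec z) + cscale \<beta> (C p (wvec z))"
      using A_weight by (auto simp: vs.span_insert vs.span_singleton algebra_simps)
    have yv: "y v = - cscale z (cscale \<alpha> (wvec z)) + cscale z (cscale \<beta> (C p (wvec z)))"
      unfolding \<alpha>\<beta> by (simp add: y_wvec y_C_p_wvec mult.commute)
    have "cscale z v - y v = cscale (z + z) (cscale \<alpha> (wvec z))"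
      "cscale z v + y v = cscale (z + z) (cscale \<beta> (C p (wvec z)))"
      unfolding yv unfolding \<alpha>\<beta> vs.scale_left_distrib vs.scale_right_distrib by simp_all
    moreover have "cscale z v - y v \<in> U" "cscale z v + y v \<in> U"
      using v(1) yU vs.subspace_add[OF sub(1)] vs.subspace_diff[OF sub(1)] vs.subspace_scale[OF sub(1)]
      by auto
    moreover have "v \<in> U" if "cscale (z + z) (cscale c v) \<in> U" "c \<noteq> 0" for c v
    proof -
      have "z + z \<noteq> 0" using z by auto
      then have "cscale (1 / ((z + z) * c)) (cscale (z + z) (cscale c v)) = v" using that(2) by simp
      then show ?thesis using vs.subspace_scale[OF sub(1) that(1)] by metis
    qed
    moreover have "\<alpha> \<noteq> 0 \<or> \<beta> \<noteq> 0" using v(3) \<alpha>\<beta> by auto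
    ultimately have "wvec z \<in> U \<or> C p (wvec z) \<in> U" by metis
    then have gU: "wvec z \<in> U"
      using CU[OF p_mem(1), of "C p (wvec z)"] vs.subspace_neg[OF sub(1), of "- wvec z"]
      by (auto simp: Cop_square)
    have "A \<subseteq> U" "A' \<subseteq> U"
      using closed_C_closed[OF U(1) order.refl] gU SU[OF gU] wvec_M S_wvec_M
      by (simp_all add: clifford_span_minimal)
    then have "sumset A A' \<subseteq> U" using vs.subspace_add[OF sub(1)] by (auto simp: sumset_def)
    then show ?thesis using U(2) by auto
  qed simp
qed

end

text \<open>
  The eight vectors obtained from the two generators by \<open>C p\<close> and \<open>S p\<close> form a basis of the weight space:
  \<open>y\<close> separates the generators, the parity separates the images under \<open>C p\<close>, and \<open>X p\<close> detects the images
  under \<open>S p\<close>. Hence the sum is everything. For the intersection, \<open>X p\<close> reduces to the Clifford spans, where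
  \<open>parity_op\<close> composed with \<open>y\<close> acts on the weight vectors by \<open>- z\<close> and by \<open>z\<close>.
\<close>

lemma direct_sum_crossing:
  assumes z: "z * z = - 1"
  defines "P \<equiv> \<lambda>z. sumset (Cl (wvec z)) (Cl (S p (wvec z)))"
  shows "direct_sum_of M (P z) (P (- z))"
proof -
  have z': "(- z) * (- z) = - 1" using z by simp
  have zz: "z + z \<noteq> 0" using z by auto
  let ?g = "wvec z" and ?g' = "wvec (- z)"
  note A = A_basics[OF z] and A' = A_basics[OF z']
  have ind1: "vs.independent {?g', ?g}" and "?g \<noteq> ?g'"
  proof -
    have not: "?g' \<notin> vs.span {?g}"
    proof
      assume "?g' \<in> vs.span {?g}"
      then obtain x where x: "?g' = cscale x ?g" by (auto simp: vs.span_singleton)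
      have "y ?g' = - cscale z ?g'" using y_wvec[OF z] by (simp add: x mult.commute)
      moreover have "y ?g' = cscale z ?g'" using y_wvec[OF z'] by simp
      ultimately have "cscale z ?g' = - cscale z ?g'" by simp
      then have "cscale (z + z) ?g' = 0" by (simp only: vs.scale_left_distrib eq_neg_iff_add_eq_0)
      then show False using zz wvec_nonzero[OF z'] by simp
    qed
    then show "vs.independent {?g', ?g}"
      using wvec_nonzero[OF z] by (intro vs.independent_insertI) (auto simp: vs.independent_empty)
    show "?g \<noteq> ?g'" using not vs.span_base[of ?g "{?g}"] by auto
  qed
  let ?Bg = "{?g', ?g}"
  let ?Bc = "?Bg \<union> C p ` ?Bg"
  let ?Bs = "?Bc \<union> S p ` ?Bc"
  have B1: "?Bg \<subseteq> M" "\<And>b. b \<in> ?Bg \<Longrightarrow> parity_op b = b"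
    using wvec_M[OF z] wvec_M[OF z'] wvec_even[OF z] wvec_even[OF z'] by auto
  have ind0: "vs.independent ?Bc" "card ?Bc = 4"
  proof -
    show "vs.independent ?Bc" by (rule independent_Un_C(1)[OF _ ind1 B1]) simp
    have "card ?Bc = 2 * card ?Bg" by (rule independent_Un_C(2)[OF _ ind1 B1]) simp
    then show "card ?Bc = 4" using \<open>?g \<noteq> ?g'\<close> by simp
  qed
  have B0W: "?Bc \<subseteq> weight_space \<kappa> J"
    using C_p_wvec[OF z] C_p_wvec[OF z'] by auto
  then have B0M: "?Bc \<subseteq> M" by (auto simp: weight_space_def)
  have X_kill: "X j v = 0" if j: "j \<in> {p, p + 1}" and v: "v \<in> vs.span ?Bc" for j v
  proof (rule clin_eq_on_span[OF clin_Xop vs2.linear_zero _ v])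
    fix b assume "b \<in> ?Bc"
    moreover have "?g \<in> Cl ?g" "C p ?g \<in> Cl ?g"
      "?g' \<in> Cl ?g'" "C p ?g' \<in> Cl ?g'"
      using A A' p_mem by (auto simp: C_closed_def)
    ultimately show "X j b = 0" using j X_A[OF z] X_A[OF z'] by auto
  qed
  have "u = 0" if u: "u \<in> vs.span ?Bc" "S p u \<in> vs.span ?Bc" for u
  proof -
    have "u \<in> M" using vs.span_minimal[OF B0M subspace_segspace] u(1) by blast
    have kill: "X (p + 1) u = 0" "X p (S p u) = 0"
      using X_kill[OF _ u(1), of "p + 1"] X_kill[OF _ u(2), of p] by simp_all
    have "- (u + y u) = 0"
      using X_S(1)[OF z \<open>u \<in> M\<close>] unfolding kill S_linear diff_0 by (rule sym)
    then have "u + y u = 0" by (simp only: neg_equal_0_iff_equal)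
    then show ?thesis by (rule one_plus_y)
  qed
  moreover have "finite ?Bc" by simp
  ultimately have ind: "vs.independent ?Bs" "card ?Bs = 2 * card ?Bc"
    using independent_Un_image[where f = "S p" and B = ?Bc, OF clin_S _ ind0(1)] by blast+
  have SW: "S p b \<in> weight_space \<kappa> J" if b: "b \<in> ?Bc" for b
  proof -
    have bM: "b \<in> M" and weight: "\<And>j. j \<in> J \<Longrightarrow> X j b = cscale (\<kappa> j) b"
      using b B0W unfolding weight_space_def by blast+
    have "X j (S p b) = cscale (\<kappa> j) (S p b)" if j: "j \<in> J" for j
      using S_X_other[OF bM p, of j] weight[OF j] j by auto
    then show ?thesis using S_M[OF bM p] by (simp add: weight_space_def)
  qed
  have "card J = d - 2" using p by (auto simp: card_Diff_subset)
  moreover have "2 \<le> d" using p by auto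
  moreover have "card ?Bs = 8" unfolding ind(2) ind0(2) by simp
  moreover have "card (phi_basis a) = 2" using p by (simp add: phi_basis_def a)
  moreover have "2 ^ (d - 2) * 8 = (2 :: nat) * 2 ^ d" if d2: "2 \<le> d"
  proof -
    obtain e where "d = 2 + e" using le_Suc_ex[OF d2] by blast
    then show ?thesis by (simp add: power_add)
  qed
  ultimately have card: "2 ^ card J * card ?Bs = card (phi_basis a) * 2 ^ d" by simp
  have W: "weight_space \<kappa> J \<subseteq> vs.span ?Bs"
  proof (rule weight_space_spanned[OF _ _ _ _ _ card])
    show "vs.independent ?Bs" by (rule ind(1))
    show "?Bs \<subseteq> weight_space \<kappa> J" using B0W SW by blast
  qed (use kappa_J in auto)
  have PC: "C_closed {1..d} (P z)" "C_closed {1..d} (P (- z))"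
    and Psub: "vs.subspace (P z)" "vs.subspace (P (- z))" and PM: "P z \<subseteq> M" "P (- z) \<subseteq> M"
    unfolding P_def using sumset_C_closed[OF z] sumset_C_closed[OF z'] sumset_subspace[OF z]
      sumset_subspace[OF z'] sumset_M[OF z] sumset_M[OF z'] by blast+
  have sum_sub: "vs.subspace (sumset (P z) (P (- z)))"
    using C_closed_sumset[OF PC] by (simp add: C_closed_def)
  have zero: "0 \<in> P z" "0 \<in> P (- z)" using Psub by (simp_all add: vs.subspace_0)
  have in_sum: "v \<in> sumset (P z) (P (- z))" if "v \<in> P z \<or> v \<in> P (- z)" for v
  proof -
    have "v + 0 \<in> sumset (P z) (P (- z)) \<or> 0 + v \<in> sumset (P z) (P (- z))"
      unfolding sumset_def using that zero by blast
    then show ?thesis by simp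
  qed
  have "b \<in> sumset (P z) (P (- z))" if "b \<in> ?Bs" for b
  proof -
    have "?g \<in> P z" "?g' \<in> P (- z)"
      unfolding P_def using A_sumset[OF z] A_sumset[OF z'] A(4) A'(4) by auto
    moreover have "H_closed (P z)" "H_closed (P (- z))"
      unfolding P_def using closed_sumset z z' by blast+
    ultimately have "{?g, C p ?g, S p ?g, S p (C p ?g)} \<subseteq> P z"
      "{?g', C p ?g', S p ?g', S p (C p ?g')} \<subseteq> P (- z)"
      using p p_mem by (auto simp: H_closed_def)
    then show ?thesis using that in_sum by auto
  qed
  then have "vs.span ?Bs \<subseteq> sumset (P z) (P (- z))" by (intro vs.span_minimal sum_sub) auto
  then have "M \<subseteq> sumset (P z) (P (- z))"
    using W C_closed_contains_M[of J \<kappa>] kappa_J C_closed_sumset[OF PC]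
    by (auto simp: C_closed_def)
  moreover have "sumset (P z) (P (- z)) \<subseteq> M" using PM by (auto simp: sumset_def)
  moreover have "P z \<inter> P (- z) \<subseteq> {0}"
  proof -
    let ?A = "Cl ?g" and ?A' = "Cl ?g'"
    have disj: "?A \<inter> ?A' \<subseteq> {0}"
    proof (rule subset_if_weight_space_subset[of J \<kappa>])
      show "C_closed J (?A \<inter> ?A')" using A(1) A'(1) by (auto simp: C_closed_def vs.subspace_inter)
      show "?A \<inter> ?A' \<inter> weight_space \<kappa> J \<subseteq> {0}"
      proof
        fix v assume v: "v \<in> ?A \<inter> ?A' \<inter> weight_space \<kappa> J"
        have sign: "parity_op (y v) = - cscale z v" if "v \<in> vs.span {wvec z, C p (wvec z)}" "z * z = - 1" for v z
        proof (rule clin_eq_on_span[OF _ _ _ that(1)])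
          show "clin (\<lambda>v. parity_op (y v))" by (rule clinI) simp_all
          show "clin (\<lambda>v. - cscale z v)" by (rule clinI) (simp_all add: vs.scale_right_distrib mult.commute)
          show "b \<in> {wvec z, C p (wvec z)} \<Longrightarrow> parity_op (y b) = - cscale z b" for b
            using y_wvec[OF that(2)] y_C_p_wvec[OF that(2)] wvec_even[OF that(2)] C_p_wvec(2)[OF that(2)] by auto
        qed
        have "v \<in> vs.span {?g, C p ?g}" "v \<in> vs.span {?g', C p ?g'}"
          using A_weight[OF z] A_weight[OF z'] v by blast+
        then have "parity_op (y v) = - cscale z v" "parity_op (y v) = cscale z v"
          using sign[OF _ z, of v] sign[OF _ z', of v] by simp_all
        then have "cscale z v = - cscale z v" by simp
        then have "cscale (z + z) v = 0" by (simp only: vs.scale_left_distrib eq_neg_iff_add_eq_0)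
        then show "v \<in> {0}" using zz by simp
      qed
      show "X i v \<in> ?A \<inter> ?A'" if "i \<in> J" "v \<in> ?A \<inter> ?A'" for i v
        using X_A_closed[OF z, of i v] X_A_closed[OF z', of i v] that by auto
    qed (use kappa_J A(3) C_closed_zero in auto)
    show ?thesis
    proof
      fix v assume v: "v \<in> P z \<inter> P (- z)"
      obtain x u where xu: "x \<in> ?A" "u \<in> ?A" "v = x + S p u"
        using v unfolding P_def by (blast elim: sumsetE[OF z])
      obtain x' u' where xu': "x' \<in> ?A'" "u' \<in> ?A'" "v = x' + S p u'"
        using v unfolding P_def by (blast elim: sumsetE[OF z'])
      have "X p v = - (u + y u)" using X_A(1)[OF z xu(1)] X_p_A'[OF z xu(2)] by (simp add: xu(3))
      moreover have "X p v = - (u' + y u')"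
        using X_A(1)[OF z' xu'(1)] X_p_A'[OF z' xu'(2)] by (simp add: xu'(3))
      ultimately have "(u - u') + y (u - u') = 0" by (simp add: algebra_simps)
      then have "u - u' = 0" by (rule one_plus_y)
      then have "u = 0" "u' = 0" using disj xu xu' by auto
      then show "v \<in> {0}" using disj xu xu' by auto
    qed
  qed
  ultimately show ?thesis
    using Psub zero by (auto simp: direct_sum_of_def)
qed

end

section \<open>The submodules in terms of the algebra\<close>

context segment
begin

interpretation hc: ring "hecke_clifford d"
  by (rule ring_hecke_clifford)

lemma generators_carrier:
  "i \<in> {1..d} \<Longrightarrow> hx d i \<in> carrier (hecke_clifford d)"
  "i \<in> {1..d} \<Longrightarrow> hc d i \<in> carrier (hecke_clifford d)"
  "hscalar d z \<in> carrier (hecke_clifford d)"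
  using gen_in_F single_zero_free_carrier
  by (simp_all only: hx_def hc_def hscalar_def carrier_hecke_clifford imageI)

lemma act_mult:
  assumes "g \<in> carrier (hecke_clifford d)" "h \<in> carrier (hecke_clifford d)" "v \<in> M"
  shows "act V (g \<otimes>\<^bsub>hecke_clifford d\<^esub> h) v = act V g (act V h v)"
  using module_closed[OF closed_M] assms by (auto simp: hc_module_def)

lemma act_add:
  assumes "g \<in> carrier (hecke_clifford d)" "h \<in> carrier (hecke_clifford d)" "v \<in> M"
  shows "act V (g \<oplus>\<^bsub>hecke_clifford d\<^esub> h) v = act V g v + act V h v"
  using module_closed[OF closed_M] assms by (auto simp: hc_module_def)

lemma act_M: "h \<in> carrier (hecke_clifford d) \<Longrightarrow> v \<in> M \<Longrightarrow> act V h v \<in> M"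
  using module_closed[OF closed_M] by (auto simp: hc_module_def)

lemma act_diff:
  assumes "g \<in> carrier (hecke_clifford d)" "h \<in> carrier (hecke_clifford d)" "v \<in> M"
  shows "act V (g \<ominus>\<^bsub>hecke_clifford d\<^esub> h) v = act V g v - act V h v"
proof -
  have "(g \<ominus>\<^bsub>hecke_clifford d\<^esub> h) \<oplus>\<^bsub>hecke_clifford d\<^esub> h = g"
    using assms(1,2) by (simp add: hc.minus_eq hc.a_assoc hc.l_neg)
  then have "act V g v = act V (g \<ominus>\<^bsub>hecke_clifford d\<^esub> h) v + act V h v"
    using act_add[OF hc.minus_closed[OF assms(1,2)] assms(2,3)] by simp
  then show ?thesis by simp
qed

lemma act_one: "v \<in> M \<Longrightarrow> act V \<one>\<^bsub>hecke_clifford d\<^esub> v = v"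
  using act_class[OF one_in_free_carrier] by (simp add: hc_class_one)

lemma X_prod_carrier: "X_prod d \<kappa> T \<in> carrier (hecke_clifford d)"
  and act_X_prod: "v \<in> M \<Longrightarrow> act V (X_prod d \<kappa> T) v
    = Xprod (\<lambda>i. of_real (\<kappa> i)) (filter (\<lambda>i. i \<notin> T) [1..<d + 1]) v"
proof -
  let ?h = "\<lambda>L. foldr (\<lambda>i h. (hx d i \<oplus>\<^bsub>hecke_clifford d\<^esub> hscalar d (of_real (\<kappa> i)))
    \<otimes>\<^bsub>hecke_clifford d\<^esub> h) L \<one>\<^bsub>hecke_clifford d\<^esub>"
  have carrier: "set L \<subseteq> {1..d} \<Longrightarrow> ?h L \<in> carrier (hecke_clifford d)" for L
    by (induction L) (auto simp: generators_carrier)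
  have act: "set L \<subseteq> {1..d} \<Longrightarrow> v \<in> M \<Longrightarrow> act V (?h L) v = Xprod (\<lambda>i. of_real (\<kappa> i)) L v" for L v
  proof (induction L)
    case (Cons i L)
    then have i: "i \<in> {1..d}" and L: "set L \<subseteq> {1..d}" and v: "v \<in> M" by auto
    have "act V (?h (i # L)) v
      = act V (hx d i \<oplus>\<^bsub>hecke_clifford d\<^esub> hscalar d (of_real (\<kappa> i))) (act V (?h L) v)"
      using carrier[OF L] v generators_carrier(1)[OF i] generators_carrier(3) by (simp add: act_mult)
    also have "\<dots> = X i (act V (?h L) v) + cscale (of_real (\<kappa> i)) (act V (?h L) v)"
      using act_M[OF carrier[OF L] v] generators_carrier(1)[OF i] generators_carrier(3)
        act_gens(2)[OF _ i] act_gens(4) by (simp add: act_add)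
    finally show ?case using Cons.IH[OF L v] by simp
  qed (simp add: act_one)
  have L: "set (filter (\<lambda>i. i \<notin> T) [1..<d + 1]) \<subseteq> {1..d}" by auto
  show "X_prod d \<kappa> T \<in> carrier (hecke_clifford d)"
    unfolding X_prod_def Suc_eq_plus1 by (rule carrier[OF L])
  show "v \<in> M \<Longrightarrow> act V (X_prod d \<kappa> T) v
    = Xprod (\<lambda>i. of_real (\<kappa> i)) (filter (\<lambda>i. i \<notin> T) [1..<d + 1]) v"
    unfolding X_prod_def Suc_eq_plus1 by (rule act[OF L])
qed

lemma tval_qfun:
  assumes "(r :: real)\<^sup>2 = qfun (real_of_int a + real j - 1)"
  shows "complex_of_real r * of_real r = t j * t j + t j"
proof -
  have "t j = of_real (real_of_int a + real j - 1)" by (simp add: tval_def)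
  moreover have "r * r = (real_of_int a + real j - 1) * (real_of_int a + real j - 1) + (real_of_int a + real j - 1)"
    using assms by (simp add: qfun_def power2_eq_square algebra_simps)
  ultimately show ?thesis by (metis of_real_add of_real_mult)
qed

end

lemma Xprod_cong:
  "(\<And>i. i \<in> set L \<Longrightarrow> \<kappa> i = \<kappa>' i) \<Longrightarrow> segment.Xprod a \<kappa> L v = segment.Xprod a \<kappa>' L v"
  by (induction L) (simp_all add: segment.Xprod_simps)

theorem theorem4p1p8:
  shows
   "(\<forall>d\<ge>1. simple_type_Q d (hatPhi 0 (int d - 1)))
  \<and>
    (\<forall>(a::nat) (b::nat) (d::nat) (\<kappa> :: nat \<Rightarrow> real).
       0 < a \<and> a \<le> b \<and> int d = int b - int a + 1 \<and>
       (\<forall>i\<in>{1..d}. (\<kappa> i)\<^sup>2 = qfun (real a + real i - 1)) \<longrightarrow>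
       (let V = hatPhi (int a) (int b);
            w = act V (X_prod d \<kappa> {}) hat_one;
            w' = act V ((hx d 1 \<ominus>\<^bsub>hecke_clifford d\<^esub> hscalar d (of_real (\<kappa> 1)))
                          \<otimes>\<^bsub>hecke_clifford d\<^esub> X_prod d \<kappa> {1}) hat_one;
            Vp = clifford_span d V w;
            Vm = clifford_span d V w'
        in hc_subsupermodule d V Vp \<and> hc_subsupermodule d V Vm \<and>
           direct_sum_of (mspace V) Vp Vm \<and>
           simple_type_M d (restrict_to V Vp) \<and> simple_type_M d (restrict_to V Vm)))
  \<and>
    (\<forall>(a::nat) (b::nat) (d::nat) (\<kappa> :: nat \<Rightarrow> real).
       0 < a \<and> a \<le> b \<and> d = a + b + 1 \<and>
       (\<forall>i\<in>{1..d}. (\<kappa> i)\<^sup>2 = qfun (- real a + real i - 1)) \<longrightarrow>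
       (let V = hatPhi (- int a) (int b);
            y = X_prod d \<kappa> {a + 1};
            icc = hscalar d \<i> \<otimes>\<^bsub>hecke_clifford d\<^esub> (hc d a \<otimes>\<^bsub>hecke_clifford d\<^esub> hc d (a + 1));
            w = - act V ((\<one>\<^bsub>hecke_clifford d\<^esub> \<oplus>\<^bsub>hecke_clifford d\<^esub> icc) \<otimes>\<^bsub>hecke_clifford d\<^esub> y) hat_one;
            w_bar = act V (hs d a) w;
            w' = - act V ((\<one>\<^bsub>hecke_clifford d\<^esub> \<ominus>\<^bsub>hecke_clifford d\<^esub> icc) \<otimes>\<^bsub>hecke_clifford d\<^esub> y) hat_one;
            w'_bar = act V (hs d a) w';
            Vp = sumset (clifford_span d V w) (clifford_span d V w_bar);
            Vm = sumset (clifford_span d V w') (clifford_span d V w'_bar)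
        in direct_sum_of Vp (clifford_span d V w) (clifford_span d V w_bar) \<and>
           direct_sum_of Vm (clifford_span d V w') (clifford_span d V w'_bar) \<and>
           hc_subsupermodule d V Vp \<and> hc_subsupermodule d V Vm \<and>
           direct_sum_of (mspace V) Vp Vm \<and>
           simple_type_M d (restrict_to V Vp) \<and> simple_type_M d (restrict_to V Vm)))"
proof (intro conjI allI impI, goal_cases)
  case (1 d)
  then show ?case
    using segment.simple_type_Q_zero_segment[of 0 d] by (simp add: segment.V_def)
next
  case (2 a b d \<kappa>)
  note asm = this
  interpret segment "int a" d .
  interpret hc: ring "hecke_clifford d" by (rule ring_hecke_clifford)
  let ?\<kappa> = "\<lambda>i. complex_of_real (\<kappa> i)"
  have b: "int b = int a + int d - 1" and d: "1 \<le> d" "1 \<in> {1..d}" using asm by auto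
  have V: "hatPhi (int a) (int b) = V" by (simp add: V_def b)
  have sq: "?\<kappa> j * ?\<kappa> j = t j * t j + t j" if "j \<in> {1..d}" for j
    using asm that by (intro tval_qfun) simp
  have w: "act V (X_prod d \<kappa> {}) hat_one = Xprod ?\<kappa> [1..<d + 1] hat_one"
    by (simp add: act_X_prod[OF hat_one_segspace])
  have "[1..<d + 1] = 1 # [2..<d + 1]" using d(1) by (simp add: upt_conv_Cons numeral_2_eq_2)
  moreover have "filter (\<lambda>i. i \<notin> {1}) [2..<d + 1] = [2..<d + 1]" by (auto simp: filter_id_conv)
  ultimately have list: "filter (\<lambda>i. i \<notin> {1}) [1..<d + 1] = [2..<d + 1]"
    and list': "[1..<d + 1] = 1 # [2..<d + 1]" by simp_all
  let ?u = "act V (X_prod d \<kappa> {1}) hat_one"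
  have u: "?u = Xprod ?\<kappa> [2..<d + 1] hat_one"
    unfolding act_X_prod[OF hat_one_segspace] list ..
  have uM: "?u \<in> M" by (rule act_M[OF X_prod_carrier hat_one_segspace])
  \<comment> \<open>The vector \<open>w'\<close> is formed like \<open>w\<close>, but with the root \<open>- \<kappa> 1\<close> in the place of \<open>\<kappa> 1\<close>.\<close>
  have "act V ((hx d 1 \<ominus>\<^bsub>hecke_clifford d\<^esub> hscalar d (of_real (\<kappa> 1)))
      \<otimes>\<^bsub>hecke_clifford d\<^esub> X_prod d \<kappa> {1}) hat_one = X 1 ?u - cscale (?\<kappa> 1) ?u"
    using d(2) uM X_prod_carrier generators_carrier(1)[OF d(2)] generators_carrier(3) hat_one_segspace
    by (simp add: act_mult act_diff act_gens del: atLeastAtMost_iff)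
  also have "\<dots> = Xprod (?\<kappa>(1 := - ?\<kappa> 1)) [1..<d + 1] hat_one"
    unfolding u list' using Xprod_cong[of "[2..<d + 1]" ?\<kappa> "?\<kappa>(1 := - ?\<kappa> 1)"] by simp
  finally have w': "act V ((hx d 1 \<ominus>\<^bsub>hecke_clifford d\<^esub> hscalar d (of_real (\<kappa> 1)))
      \<otimes>\<^bsub>hecke_clifford d\<^esub> X_prod d \<kappa> {1}) hat_one = Xprod (?\<kappa>(1 := - ?\<kappa> 1)) [1..<d + 1] hat_one" .
  have "0 < int a" using asm by simp
  note thms = positive_segment_decomposition[OF this d(1) sq]
  show ?case
    unfolding Let_def V w w' mspace_V using thms by blast
next
  case (3 a b d \<kappa>)
  note asm = this
  let ?\<kappa> = "\<lambda>i. complex_of_real (\<kappa> i)"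
  interpret crossing_segment "- int a" d a ?\<kappa>
  proof
    show "a \<in> {1..<d}" using asm by auto
    fix j assume "j \<in> {1..d}"
    then show "?\<kappa> j * ?\<kappa> j = tval (- int a) j * tval (- int a) j + tval (- int a) j"
      using asm by (intro segment.tval_qfun) simp
  qed simp
  interpret hc: ring "hecke_clifford d" by (rule ring_hecke_clifford)
  have b: "int b = - int a + int d - 1" using asm by simp
  have V: "hatPhi (- int a) (int b) = V" unfolding V_def b ..
  let ?y = "X_prod d \<kappa> {a + 1}"
  let ?icc = "hscalar d \<i> \<otimes>\<^bsub>hecke_clifford d\<^esub> (hc d a \<otimes>\<^bsub>hecke_clifford d\<^esub> hc d (a + 1))"
  have carrier: "hc d a \<in> carrier (hecke_clifford d)" "hc d (a + 1) \<in> carrier (hecke_clifford d)"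
    "?icc \<in> carrier (hecke_clifford d)"
    using generators_carrier(2)[OF p_mem(1)] generators_carrier(2)[OF p_mem(2)] generators_carrier(3)
    by (auto intro!: hc.m_closed)
  have u: "act V ?y hat_one = xvec"
    unfolding act_X_prod[OF hat_one_segspace] xvec_def by simp
  have Cu: "C (a + 1) xvec \<in> M" by (rule Cop_segspace[OF p_mem(2) xvec_M])
  have "act V (hc d a \<otimes>\<^bsub>hecke_clifford d\<^esub> hc d (a + 1)) xvec = y xvec"
    using act_mult[OF carrier(1,2) xvec_M] act_gens(1)[OF xvec_M p_mem(2)] act_gens(1)[OF Cu p_mem(1)]
    by (simp add: y_def)
  then have icc: "act V ?icc xvec = cscale \<i> (y xvec)"
    using act_mult[OF generators_carrier(3) hc.m_closed[OF carrier(1,2)] xvec_M] act_gens(4)[OF y_M[OF xvec_M]]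
    by simp
  have w: "- act V ((\<one>\<^bsub>hecke_clifford d\<^esub> \<oplus>\<^bsub>hecke_clifford d\<^esub> ?icc) \<otimes>\<^bsub>hecke_clifford d\<^esub> ?y) hat_one = wvec \<i>"
    using act_mult[OF hc.a_closed[OF hc.one_closed carrier(3)] X_prod_carrier hat_one_segspace]
      act_add[OF hc.one_closed carrier(3) xvec_M] act_one[OF xvec_M] icc u by (simp add: wvec_def)
  have w': "- act V ((\<one>\<^bsub>hecke_clifford d\<^esub> \<ominus>\<^bsub>hecke_clifford d\<^esub> ?icc) \<otimes>\<^bsub>hecke_clifford d\<^esub> ?y) hat_one = wvec (- \<i>)"
    using act_mult[OF hc.minus_closed[OF hc.one_closed carrier(3)] X_prod_carrier hat_one_segspace]
      act_diff[OF hc.one_closed carrier(3) xvec_M] act_one[OF xvec_M] icc u by (simp add: wvec_def)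
  have z: "\<i> * \<i> = - 1" "(- \<i>) * (- \<i>) = - 1" by simp_all
  have bar: "act V (hs d a) (wvec \<i>) = S a (wvec \<i>)" "act V (hs d a) (wvec (- \<i>)) = S a (wvec (- \<i>))"
    using act_gens(3)[OF wvec_M[OF z(1)] p] act_gens(3)[OF wvec_M[OF z(2)] p] by simp_all
  show ?case
    unfolding Let_def V w w' bar mspace_V
    using direct_sum_A[OF z(1)] direct_sum_A[OF z(2)] closed_sumset[OF z(1)] closed_sumset[OF z(2)]
      parity_sumset[OF z(1)] parity_sumset[OF z(2)] direct_sum_crossing[OF z(1)]
      simple_sumset[OF z(1)] simple_sumset[OF z(2)]
    by (simp add: subsupermodule_iff)
qed

end
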